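(* For the cyclic $(3,4)$-curve $y^3=x^4+\lambda_3x^3+\lambda_2x^2+\lambda_1x+\lambda_0$, the following $21$ bilinear relations hold identically in $\boldsymbol u$, and every bilinear relation associated with the curve may be given as a linear combination of them: 1. $0=\wp_{222}+\lambda_3\wp_{333}+2\wp_{23}\wp_{333}-2\wp_{33}\wp_{233}$ 2. $0=2\wp_{133}+\wp_{22}\wp_{333}+\wp_{23}\wp_{233}-2\wp_{33}\wp_{223}$ 3. $0=-4\wp_{123}+4\wp_{22}\wp_{233}-2\wp_{23}\wp_{223}-2\wp_{33}\wp_{222}$ 4. $0=4\wp_{122}-\lambda_3\wp_{222}-\lambda_3^2\wp_{333}+4\lambda_2\wp_{333}-2\wp_{23}\wp_{222}+2\wp_{22}\wp_{223}+8\wp_{13}\wp_{333}-8\wp_{33}\wp_{133}$ 5. $0=-\wp_{12}\wp_{333}+\wp_{23}\wp_{133}+2\wp_{33}\wp_{123}-2\wp_{13}\wp_{233}$ 6. $0=4\wp_{113}-3\wp_{12}\wp_{233}-\wp_{22}\wp_{133}+2\wp_{23}\wp_{123}+2\wp_{33}\wp_{122}$ 7. $0=\wp_{113}-3\wp_{13}\wp_{223}+2\wp_{22}\wp_{133}+2\wp_{23}\wp_{123}-\wp_{33}\wp_{122}$ 8. $0=\lambda_3(\wp_{13}\wp_{333}-\wp_{33}\wp_{133})+\lambda_1\wp_{333}+\wp_{12}\wp_{223}-\wp_{23}\wp_{122}$ 9. $0=\wp_{13}\wp_{222}-\wp_{112}-2\lambda_3(\wp_{13}\wp_{333}-\wp_{33}\wp_{133})-2\lambda_1\wp_{333}-2\wp_{22}\wp_{123}+\wp_{23}\wp_{122}$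 10. $0=3\lambda_3(\wp_{13}\wp_{233}-\wp_{23}\wp_{133})-2\lambda_2\wp_{133}+\lambda_1\wp_{233}+3\wp_{12}\wp_{222}-3\wp_{22}\wp_{122}+4\wp_{11}\wp_{333}+4\wp_{13}\wp_{133}-8\wp_{33}\wp_{113}$ 11. $0=-4\wp_{12}\wp_{133}+4\wp_{13}\wp_{123}-2\wp_{23}\wp_{113}+2\wp_{33}\wp_{112}$ 12. $0=\frac92\lambda_3\wp_{113}-3\lambda_2\wp_{123}+\frac32\lambda_1\wp_{223}-3\wp_{11}\wp_{233}-\wp_{12}\wp_{133}-2\wp_{13}\wp_{123}+4\wp_{23}\wp_{113}+2\wp_{33}\wp_{112}$ 13. $0=-\wp_{11}\wp_{223}-\frac23\wp_{12}\wp_{123}-\frac13\wp_{13}\wp_{122}+\frac23\wp_{22}\wp_{113}+\frac43\wp_{23}\wp_{112}+\frac13\lambda_1\wp_{222}-\wp_{111}+\frac32\lambda_3\wp_{112}-\frac23\lambda_2(\wp_{13}\wp_{333}-\wp_{33}\wp_{133})-\lambda_2\wp_{122}-\frac16\lambda_3\lambda_1\wp_{333}-\frac43\lambda_0\wp_{333}$ 14. $0=-\frac23\wp_{12}\wp_{123}+\frac23\wp_{13}\wp_{122}-\frac13\wp_{22}\wp_{113}+\frac13\wp_{23}\wp_{112}-\frac23\lambda_2(\wp_{13}\wp_{333}-\wp_{33}\wp_{133})-\frac16\lambda_1\wp_{222}-\frac16\lambda_3\lambda_1\wp_{333}-\frac43\lambda_0\wp_{333}$ 15. $0=-\lambda_3(\wp_{11}\wp_{333}+\wp_{13}\wp_{133}-2\wp_{33}\wp_{113})-2\lambda_2(\wp_{13}\wp_{233}-\wp_{23}\wp_{133})+3\lambda_1\wp_{133}-4\lambda_0\wp_{233}-\wp_{11}\wp_{222}-\wp_{12}\wp_{122}+2\wp_{22}\wp_{112}$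 16. $0=\frac23\lambda_2\wp_{113}-\frac43\lambda_1\wp_{123}+2\lambda_0\wp_{223}-\frac43\wp_{11}\wp_{133}+\frac23\wp_{13}\wp_{113}+\frac23\wp_{33}\wp_{111}$ 17. $0=-\lambda_3\lambda_0\wp_{333}+\lambda_0\wp_{222}+\frac23\lambda_2\wp_{112}-\frac43\wp_{11}\wp_{123}+\frac13\wp_{12}\wp_{113}+\frac13\wp_{13}\wp_{112}+\frac23\wp_{23}\wp_{111}-\frac43\lambda_1\wp_{122}-\lambda_1(\wp_{13}\wp_{333}-\wp_{33}\wp_{133})$ 18. $0=-\lambda_3\lambda_0\wp_{333}-2\lambda_0\wp_{222}-\frac13\lambda_2\wp_{112}-\frac53\wp_{12}\wp_{113}+\frac23\wp_{11}\wp_{123}+\frac43\wp_{13}\wp_{112}-\frac13\wp_{23}\wp_{111}+\frac23\lambda_1\wp_{122}-\lambda_1(\wp_{13}\wp_{333}-\wp_{33}\wp_{133})$ 19. $0=\frac83\lambda_0\wp_{133}-\frac49\lambda_2^2\wp_{133}-2\lambda_1(\wp_{13}\wp_{233}-\wp_{23}\wp_{133})-\frac49\lambda_2(\wp_{11}\wp_{333}+\wp_{13}\wp_{133}-2\wp_{33}\wp_{113})+\frac29\lambda_2\lambda_1\wp_{233}+\frac43\lambda_3\lambda_1\wp_{133}-2\lambda_3\lambda_0\wp_{233}-\frac43\wp_{11}\wp_{122}+\frac23\wp_{12}\wp_{112}+\frac23\wp_{22}\wp_{111}$ 20. $0=\frac12\lambda_1^2\wp_{333}-2\lambda_2\lambda_0\wp_{333}-3\lambda_0\wp_{122}-4\lambda_0(\wp_{13}\wp_{333}-\wp_{33}\wp_{133})+\frac12\lambda_1\wp_{112}+\wp_{13}\wp_{111}-\wp_{11}\wp_{113}$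 21. $0=-\frac13\lambda_2\lambda_1\wp_{133}-\wp_{11}\wp_{112}+\wp_{12}\wp_{111}-4\lambda_0(\wp_{13}\wp_{233}-\wp_{23}\wp_{133})-\frac13\lambda_1(\wp_{11}\wp_{333}+\wp_{13}\wp_{133}-2\wp_{33}\wp_{113})+\frac23\lambda_1^2\wp_{233}+3\lambda_3\lambda_0\wp_{133}-2\lambda_2\lambda_0\wp_{233}$
   Context: Let $C$ be the compact Riemann surface (genus $3$, one point $\infty$ at infinity) of the cyclic $(3,4)$-curve $y^3=x^4+\lambda_3x^3+\lambda_2x^2+\lambda_1x+\lambda_0$, assumed non-singular, $\lambda_j\in\mathbb C$. Put $\boldsymbol{du}=\big(\frac{dx}{3y^2},\frac{x\,dx}{3y^2},\frac{y\,dx}{3y^2}\big)$. $\Lambda\subset\mathbb C^3$ is the lattice of all periods of $\boldsymbol{du}$ over $H_1(C,\mathbb Z)$, $J=\mathbb C^3/\Lambda$, $\kappa:\mathbb C^3\to J$ the projection, $W^{[2]}\subset J$ the image of $(P_1,P_2)\mapsto\int_\infty^{P_1}\boldsymbol{du}+\int_\infty^{P_2}\boldsymbol{du}$, and $\Theta^{[2]}=W^{[2]}\cup(-W^{[2]})$. The Kleinian sigma function $\sigma(\boldsymbol u)$, $\boldsymbol u=(u_1,u_2,u_3)\in\mathbb C^3$, is classically $c\exp(\frac12\boldsymbol u\eta'(\omega')^{-1}\boldsymbol u^T)$ times the Riemann theta function whose characteristic gives the Riemann constant with base point $\infty$. It is uniquely determined by: (i) $\sigma$ is entire, with zeros of order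 one along $\kappa^{-1}(\Theta^{[2]})$ and no other zeros; (ii) for each $\boldsymbol\ell\in\Lambda$, $\sigma(\boldsymbol u+\boldsymbol\ell)=\chi(\boldsymbol\ell)\exp(L(\boldsymbol u+\frac12\boldsymbol\ell,\boldsymbol\ell))\sigma(\boldsymbol u)$ with $\chi(\boldsymbol\ell)\in\{\pm1\}$ and $L(\cdot,\boldsymbol\ell)$ a $\mathbb C$-linear form; (iii) $\sigma(-\boldsymbol u)=-\sigma(\boldsymbol u)$; (iv) giving $u_1,u_2,u_3$ weights $5,2,1$, the lowest-weight part of the Taylor expansion of $\sigma$ at $0$ is $\frac1{20}u_3^5-u_3u_2^2+u_1$; (v) (normalisation of the quadratic exponential factor, corresponding to the standard choice of second kind differentials) with $\wp_{ij}=-\partial_{u_i}\partial_{u_j}\log\sigma$ and $(\varphi_1,\varphi_2,\varphi_3)=(1,x,y)$, for generic $P_k=(x_k,y_k)$ ($k=1,2,3$), $\boldsymbol u=\sum_k\int_\infty^{P_k}\boldsymbol{du}$ and $P=(x,y)$, one has for each $k$: $\sum_{i,j=1}^3\wp_{ij}\big(\int_\infty^P\boldsymbol{du}-\boldsymbol u\big)\varphi_i(P)\varphi_j(P_k)=\frac{3y^2y_k^2+y_kT(x,x_k)+yT(x_k,x)}{(x-x_k)^2}$, where $T(x,z)=3\lambda_0+(z+2x)\lambda_1+x(x+2z)\lambda_2+3\lambda_3x^2z+x^2z^2+2x^3z$. For $m\ge2$, $\wp_{i_1\dots i_m}=-\frac{\partial}{\partial u_{i_1}}\cdots\frac{\partial}{\partial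 u_{i_m}}\log\sigma$. A bilinear relation is an identity, valid for all $\boldsymbol u$, stating that a linear combination, with coefficients independent of $\boldsymbol u$, of the 3-index functions $\wp_{ijk}$ and the products $\wp_{ij}\wp_{klm}$ of a 2-index and a 3-index function vanishes. Linear combinations are taken with coefficients independent of $\boldsymbol u$. *)

theory Defs
  imports "HOL-Analysis.Analysis" "HOL-Computational_Algebra.Polynomial"
begin

text \<open>
  The coefficients \<open>\<lambda>\<^sub>0, \<dots>, \<lambda>\<^sub>3\<close> are \<open>lam 0, \<dots>, lam 3\<close>; further values of \<open>lam\<close> play no role.
  Vectors \<open>u :: complex^3\<close> have coordinates \<open>u $ 1, u $ 2, u $ 3\<close>, indexed by the three-element
  type \<open>3\<close>.
\<close>

definition quartic :: "(nat \<Rightarrow> complex) \<Rightarrow> complex poly" where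
  "quartic lam = [:lam 0, lam 1, lam 2, lam 3, 1:]"

definition affine_curve :: "(nat \<Rightarrow> complex) \<Rightarrow> (complex \<times> complex) set" where
  "affine_curve lam = {(x, y). y ^ 3 = poly (quartic lam) x}"

text \<open>The point at infinity is always a smooth point of the curve.\<close>

definition nonsingular_curve :: "(nat \<Rightarrow> complex) \<Rightarrow> bool" where
  "nonsingular_curve lam \<longleftrightarrow>
     (\<forall>(x, y) \<in> affine_curve lam. 3 * y ^ 2 \<noteq> 0 \<or> poly (pderiv (quartic lam)) x \<noteq> 0)"

text \<open>Points of the compact curve; \<open>None\<close> is the point \<open>\<infinity>\<close>.\<close>

definition compact_curve :: "(nat \<Rightarrow> complex) \<Rightarrow> (complex \<times> complex) option set" where
  "compact_curve lam = insert None (Some ` affine_curve lam)"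

definition varphi :: "complex \<Rightarrow> complex \<Rightarrow> complex^3" where
  "varphi x y = vector [1, x, y]"

text \<open>
  The pullback of \<open>du = (dx, x dx, y dx) / (3 y\<^sup>2)\<close> along a path \<open>t \<mapsto> (X t, Y t)\<close> on the affine curve.
  On the curve \<open>3 y\<^sup>2 dy = f'(x) dx\<close>, where \<open>f\<close> is the quartic, so at the branch points \<open>y = 0\<close> the
  holomorphic form \<open>dx / (3 y\<^sup>2)\<close> is \<open>dy / f'(x)\<close>.
\<close>

definition du_along ::
    "(nat \<Rightarrow> complex) \<Rightarrow> (real \<Rightarrow> complex) \<Rightarrow> (real \<Rightarrow> complex) \<Rightarrow> real \<Rightarrow> complex^3" where
  "du_along lam X Y t =
     (if Y t \<noteq> 0 then vector_derivative X (at t) / (3 * Y t ^ 2)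
      else vector_derivative Y (at t) / poly (pderiv (quartic lam)) (X t)) *s varphi (X t) (Y t)"

definition affine_path ::
    "(nat \<Rightarrow> complex) \<Rightarrow> real \<Rightarrow> (real \<Rightarrow> complex) \<Rightarrow> (real \<Rightarrow> complex) \<Rightarrow> bool" where
  "affine_path lam a X Y \<longleftrightarrow>
     X piecewise_C1_differentiable_on {a..1} \<and> Y piecewise_C1_differentiable_on {a..1} \<and>
     (\<forall>t\<in>{a..1}. (X t, Y t) \<in> affine_curve lam)"

text \<open>
  The lattice of periods over \<open>H\<^sub>1(C, \<int>)\<close>. Every class of \<open>H\<^sub>1(C, \<int>)\<close> is represented by a
  closed path, which may be chosen to avoid the single point \<open>\<infinity>\<close>.
\<close>

definition period_lattice :: "(nat \<Rightarrow> complex) \<Rightarrow> (complex^3) set" where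
  "period_lattice lam =
     {integral {0..1} (du_along lam X Y) | X Y.
        affine_path lam 0 X Y \<and> X 0 = X 1 \<and> Y 0 = Y 1}"

text \<open>
  All values of \<open>\<integral> du\<close> from \<open>\<infinity>\<close> to a given point, over all paths joining them; this is a coset of
  the period lattice. A path starting at \<open>\<infinity>\<close> is a path in the affine curve parametrised by
  \<open>(0, 1]\<close> along which \<open>x\<close> tends to infinity at \<open>0\<close>, as \<open>\<infinity>\<close> is the only point at infinity.
\<close>

fun abel_values :: "(nat \<Rightarrow> complex) \<Rightarrow> (complex \<times> complex) option \<Rightarrow> (complex^3) set" where
  "abel_values lam None = period_lattice lam"
| "abel_values lam (Some (x, y)) =
     {u. \<exists>X Y. (\<forall>a\<in>{0<..1}. affine_path lam a X Y) \<and>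
            filterlim X at_infinity (at_right 0) \<and> X 1 = x \<and> Y 1 = y \<and>
            ((\<lambda>a. integral {a..1} (du_along lam X Y)) \<longlongrightarrow> u) (at_right 0)}"

text \<open>
  The preimages in \<open>\<complex>\<^sup>3\<close>, under \<open>\<kappa>\<close>, of \<open>W\<^sup>[\<^sup>2\<^sup>]\<close> and of \<open>\<Theta>\<^sup>[\<^sup>2\<^sup>] = W\<^sup>[\<^sup>2\<^sup>] \<union> (-W\<^sup>[\<^sup>2\<^sup>])\<close>.
\<close>

definition W2_preimage :: "(nat \<Rightarrow> complex) \<Rightarrow> (complex^3) set" where
  "W2_preimage lam =
     {a + b | a b P Q. P \<in> compact_curve lam \<and> Q \<in> compact_curve lam \<and>
                       a \<in> abel_values lam P \<and> b \<in> abel_values lam Q}"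

definition Theta2_preimage :: "(nat \<Rightarrow> complex) \<Rightarrow> (complex^3) set" where
  "Theta2_preimage lam = W2_preimage lam \<union> uminus ` W2_preimage lam"

definition entire3 :: "(complex^3 \<Rightarrow> complex) \<Rightarrow> bool" where
  "entire3 f \<longleftrightarrow> (\<forall>u. \<exists>D. (f has_derivative D) (at u) \<and> Vector_Spaces.linear (*s) (*) D)"

definition pd :: "3 \<Rightarrow> (complex^3 \<Rightarrow> complex) \<Rightarrow> complex^3 \<Rightarrow> complex" where
  "pd i f u = deriv (\<lambda>z. f (u + z *s axis i 1)) 0"

text \<open>
  A first derivative of \<open>log \<sigma>\<close> is the logarithmic derivative, so no branch of the logarithm is
  needed. The values below are meaningful where \<open>\<sigma> u \<noteq> 0\<close>.
\<close>

definition wp2 :: "(complex^3 \<Rightarrow> complex) \<Rightarrow> complex^3 \<Rightarrow> 3 \<Rightarrow> 3 \<Rightarrow> complex" where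
  "wp2 \<sigma> u i j = - pd i (\<lambda>v. pd j \<sigma> v / \<sigma> v) u"

definition wp3 :: "(complex^3 \<Rightarrow> complex) \<Rightarrow> complex^3 \<Rightarrow> 3 \<Rightarrow> 3 \<Rightarrow> 3 \<Rightarrow> complex" where
  "wp3 \<sigma> u i j k = - pd i (pd j (\<lambda>v. pd k \<sigma> v / \<sigma> v)) u"

definition taylor_coeff :: "(complex^3 \<Rightarrow> complex) \<Rightarrow> nat \<Rightarrow> nat \<Rightarrow> nat \<Rightarrow> complex" where
  "taylor_coeff f a b c =
     (pd 1 ^^ a) ((pd 2 ^^ b) ((pd 3 ^^ c) f)) 0 / (fact a * fact b * fact c)"

definition klein_T :: "(nat \<Rightarrow> complex) \<Rightarrow> complex \<Rightarrow> complex \<Rightarrow> complex" where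
  "klein_T lam x z =
     3 * lam 0 + (z + 2 * x) * lam 1 + x * (x + 2 * z) * lam 2 + 3 * lam 3 * x ^ 2 * z
       + x ^ 2 * z ^ 2 + 2 * x ^ 3 * z"

text \<open>
  A zero of a holomorphic function has order one iff some first partial derivative does not vanish
  there. All zeros satisfy this, since the curve, a smooth plane quartic, is not
  hyperelliptic and the theta divisor is therefore smooth.
\<close>

definition sigma_zeros :: "(nat \<Rightarrow> complex) \<Rightarrow> (complex^3 \<Rightarrow> complex) \<Rightarrow> bool" where
  "sigma_zeros lam \<sigma> \<longleftrightarrow>
     entire3 \<sigma> \<and> (\<forall>u. \<sigma> u = 0 \<longleftrightarrow> u \<in> Theta2_preimage lam) \<and>
     (\<forall>u. \<sigma> u = 0 \<longrightarrow> (\<exists>i. pd i \<sigma> u \<noteq> 0))"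

definition sigma_quasiperiodic :: "(nat \<Rightarrow> complex) \<Rightarrow> (complex^3 \<Rightarrow> complex) \<Rightarrow> bool" where
  "sigma_quasiperiodic lam \<sigma> \<longleftrightarrow>
     (\<forall>l \<in> period_lattice lam. \<exists>s \<in> {1, -1}. \<exists>L. Vector_Spaces.linear (*s) (*) L \<and>
        (\<forall>u. \<sigma> (u + l) = s * exp (L (u + (1/2) *s l)) * \<sigma> u))"

text \<open>For weights \<open>5, 2, 1\<close> the lowest-weight part is \<open>u\<^sub>3\<^sup>5 / 20 - u\<^sub>3 u\<^sub>2\<^sup>2 + u\<^sub>1\<close>, of weight 5.\<close>

definition sigma_leading_part :: "(complex^3 \<Rightarrow> complex) \<Rightarrow> bool" where
  "sigma_leading_part \<sigma> \<longleftrightarrow>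
     (\<forall>a b c. 5 * a + 2 * b + c \<le> 5 \<longrightarrow>
        taylor_coeff \<sigma> a b c =
          (if (a, b, c) = (0, 0, 5) then 1 / 20
           else if (a, b, c) = (0, 2, 1) then -1
           else if (a, b, c) = (1, 0, 0) then 1
           else 0))"

text \<open>
  Both sides are meromorphic in the points \<open>P, P\<^sub>1, P\<^sub>2, P\<^sub>3\<close>, so the identity at generic points amounts to
  the identity at all points where neither side has a pole, for all choices of the paths.
\<close>

definition sigma_klein_formula :: "(nat \<Rightarrow> complex) \<Rightarrow> (complex^3 \<Rightarrow> complex) \<Rightarrow> bool" where
  "sigma_klein_formula lam \<sigma> \<longleftrightarrow>
     (\<forall>x y w. \<forall>X Y :: 3 \<Rightarrow> complex. \<forall>U :: 3 \<Rightarrow> complex^3.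
        w \<in> abel_values lam (Some (x, y)) \<longrightarrow>
        (\<forall>k. U k \<in> abel_values lam (Some (X k, Y k))) \<longrightarrow>
        \<sigma> (w - (\<Sum>k\<in>UNIV. U k)) \<noteq> 0 \<longrightarrow>
        (\<forall>k. x \<noteq> X k \<longrightarrow>
          (\<Sum>i\<in>UNIV. \<Sum>j\<in>UNIV. wp2 \<sigma> (w - (\<Sum>k\<in>UNIV. U k)) i j
               * varphi x y $ i * varphi (X k) (Y k) $ j)
          = (3 * y ^ 2 * Y k ^ 2 + Y k * klein_T lam x (X k) + y * klein_T lam (X k) x)
              / (x - X k) ^ 2))"

definition kleinian_sigma :: "(nat \<Rightarrow> complex) \<Rightarrow> (complex^3 \<Rightarrow> complex) \<Rightarrow> bool" where
  "kleinian_sigma lam \<sigma> \<longleftrightarrow>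
     sigma_zeros lam \<sigma> \<and> sigma_quasiperiodic lam \<sigma> \<and> (\<forall>u. \<sigma> (- u) = - \<sigma> u) \<and>
     sigma_leading_part \<sigma> \<and> sigma_klein_formula lam \<sigma>"

text \<open>
  A bilinear expression is a polynomial in indeterminates \<open>p i j\<close> (for \<open>\<wp>\<^sub>i\<^sub>j\<close>) and \<open>q i j k\<close>
  (for \<open>\<wp>\<^sub>i\<^sub>j\<^sub>k\<close>), both symmetric in their indices. Since \<open>\<complex>\<close> is infinite, two such polynomials agree
  iff they take equal values for all symmetric arrays \<open>p, q\<close> of complex numbers; this is how equality
  of bilinear expressions as formal combinations (and not only of the functions of \<open>u\<close>
  obtained by substituting the \<open>\<wp>\<close>-functions) is stated.
\<close>

definition symmetric2 :: "(3 \<Rightarrow> 3 \<Rightarrow> complex) \<Rightarrow> bool" where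
  "symmetric2 p \<longleftrightarrow> (\<forall>i j. p i j = p j i)"

definition symmetric3 :: "(3 \<Rightarrow> 3 \<Rightarrow> 3 \<Rightarrow> complex) \<Rightarrow> bool" where
  "symmetric3 q \<longleftrightarrow> (\<forall>i j k. q i j k = q j i k \<and> q i j k = q i k j)"

definition bilinear_expr ::
    "(3 \<Rightarrow> 3 \<Rightarrow> 3 \<Rightarrow> complex) \<Rightarrow> (3 \<Rightarrow> 3 \<Rightarrow> 3 \<Rightarrow> 3 \<Rightarrow> 3 \<Rightarrow> complex) \<Rightarrow>
     (3 \<Rightarrow> 3 \<Rightarrow> complex) \<Rightarrow> (3 \<Rightarrow> 3 \<Rightarrow> 3 \<Rightarrow> complex) \<Rightarrow> complex" where
  "bilinear_expr c d p q =
     (\<Sum>i\<in>UNIV. \<Sum>j\<in>UNIV. \<Sum>k\<in>UNIV. c i j k * q i j k) +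
     (\<Sum>i\<in>UNIV. \<Sum>j\<in>UNIV. \<Sum>k\<in>UNIV. \<Sum>l\<in>UNIV. \<Sum>m\<in>UNIV. d i j k l m * (p i j * q k l m))"

definition bilinear_relation ::
    "(complex^3 \<Rightarrow> complex) \<Rightarrow> (3 \<Rightarrow> 3 \<Rightarrow> 3 \<Rightarrow> complex) \<Rightarrow>
     (3 \<Rightarrow> 3 \<Rightarrow> 3 \<Rightarrow> 3 \<Rightarrow> 3 \<Rightarrow> complex) \<Rightarrow> bool" where
  "bilinear_relation \<sigma> c d \<longleftrightarrow> (\<forall>u. \<sigma> u \<noteq> 0 \<longrightarrow> bilinear_expr c d (wp2 \<sigma> u) (wp3 \<sigma> u) = 0)"

definition relations34 ::
    "(nat \<Rightarrow> complex) \<Rightarrow> (3 \<Rightarrow> 3 \<Rightarrow> complex) \<Rightarrow> (3 \<Rightarrow> 3 \<Rightarrow> 3 \<Rightarrow> complex) \<Rightarrow> complex list" where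
  "relations34 lam p q =
   [q 2 2 2 + lam 3 * q 3 3 3 + 2 * p 2 3 * q 3 3 3 - 2 * p 3 3 * q 2 3 3,

    2 * q 1 3 3 + p 2 2 * q 3 3 3 + p 2 3 * q 2 3 3 - 2 * p 3 3 * q 2 2 3,

    - 4 * q 1 2 3 + 4 * p 2 2 * q 2 3 3 - 2 * p 2 3 * q 2 2 3 - 2 * p 3 3 * q 2 2 2,

    4 * q 1 2 2 - lam 3 * q 2 2 2 - lam 3 ^ 2 * q 3 3 3 + 4 * lam 2 * q 3 3 3
      - 2 * p 2 3 * q 2 2 2 + 2 * p 2 2 * q 2 2 3 + 8 * p 1 3 * q 3 3 3 - 8 * p 3 3 * q 1 3 3,

    - p 1 2 * q 3 3 3 + p 2 3 * q 1 3 3 + 2 * p 3 3 * q 1 2 3 - 2 * p 1 3 * q 2 3 3,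

    4 * q 1 1 3 - 3 * p 1 2 * q 2 3 3 - p 2 2 * q 1 3 3 + 2 * p 2 3 * q 1 2 3
      + 2 * p 3 3 * q 1 2 2,

    q 1 1 3 - 3 * p 1 3 * q 2 2 3 + 2 * p 2 2 * q 1 3 3 + 2 * p 2 3 * q 1 2 3
      - p 3 3 * q 1 2 2,

    lam 3 * (p 1 3 * q 3 3 3 - p 3 3 * q 1 3 3) + lam 1 * q 3 3 3 + p 1 2 * q 2 2 3
      - p 2 3 * q 1 2 2,

    p 1 3 * q 2 2 2 - q 1 1 2 - 2 * lam 3 * (p 1 3 * q 3 3 3 - p 3 3 * q 1 3 3)
      - 2 * lam 1 * q 3 3 3 - 2 * p 2 2 * q 1 2 3 + p 2 3 * q 1 2 2,

    3 * lam 3 * (p 1 3 * q 2 3 3 - p 2 3 * q 1 3 3) - 2 * lam 2 * q 1 3 3 + lam 1 * q 2 3 3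
      + 3 * p 1 2 * q 2 2 2 - 3 * p 2 2 * q 1 2 2 + 4 * p 1 1 * q 3 3 3 + 4 * p 1 3 * q 1 3 3
      - 8 * p 3 3 * q 1 1 3,

    - 4 * p 1 2 * q 1 3 3 + 4 * p 1 3 * q 1 2 3 - 2 * p 2 3 * q 1 1 3 + 2 * p 3 3 * q 1 1 2,

    (9/2) * lam 3 * q 1 1 3 - 3 * lam 2 * q 1 2 3 + (3/2) * lam 1 * q 2 2 3
      - 3 * p 1 1 * q 2 3 3 - p 1 2 * q 1 3 3 - 2 * p 1 3 * q 1 2 3 + 4 * p 2 3 * q 1 1 3
      + 2 * p 3 3 * q 1 1 2,

    - p 1 1 * q 2 2 3 - (2/3) * p 1 2 * q 1 2 3 - (1/3) * p 1 3 * q 1 2 2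
      + (2/3) * p 2 2 * q 1 1 3 + (4/3) * p 2 3 * q 1 1 2 + (1/3) * lam 1 * q 2 2 2
      - q 1 1 1 + (3/2) * lam 3 * q 1 1 2
      - (2/3) * lam 2 * (p 1 3 * q 3 3 3 - p 3 3 * q 1 3 3) - lam 2 * q 1 2 2
      - (1/6) * lam 3 * lam 1 * q 3 3 3 - (4/3) * lam 0 * q 3 3 3,

    - (2/3) * p 1 2 * q 1 2 3 + (2/3) * p 1 3 * q 1 2 2 - (1/3) * p 2 2 * q 1 1 3
      + (1/3) * p 2 3 * q 1 1 2 - (2/3) * lam 2 * (p 1 3 * q 3 3 3 - p 3 3 * q 1 3 3)
      - (1/6) * lam 1 * q 2 2 2 - (1/6) * lam 3 * lam 1 * q 3 3 3 - (4/3) * lam 0 * q 3 3 3,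

    - lam 3 * (p 1 1 * q 3 3 3 + p 1 3 * q 1 3 3 - 2 * p 3 3 * q 1 1 3)
      - 2 * lam 2 * (p 1 3 * q 2 3 3 - p 2 3 * q 1 3 3) + 3 * lam 1 * q 1 3 3
      - 4 * lam 0 * q 2 3 3 - p 1 1 * q 2 2 2 - p 1 2 * q 1 2 2 + 2 * p 2 2 * q 1 1 2,

    (2/3) * lam 2 * q 1 1 3 - (4/3) * lam 1 * q 1 2 3 + 2 * lam 0 * q 2 2 3
      - (4/3) * p 1 1 * q 1 3 3 + (2/3) * p 1 3 * q 1 1 3 + (2/3) * p 3 3 * q 1 1 1,

    - lam 3 * lam 0 * q 3 3 3 + lam 0 * q 2 2 2 + (2/3) * lam 2 * q 1 1 2
      - (4/3) * p 1 1 * q 1 2 3 + (1/3) * p 1 2 * q 1 1 3 + (1/3) * p 1 3 * q 1 1 2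
      + (2/3) * p 2 3 * q 1 1 1 - (4/3) * lam 1 * q 1 2 2
      - lam 1 * (p 1 3 * q 3 3 3 - p 3 3 * q 1 3 3),

    - lam 3 * lam 0 * q 3 3 3 - 2 * lam 0 * q 2 2 2 - (1/3) * lam 2 * q 1 1 2
      - (5/3) * p 1 2 * q 1 1 3 + (2/3) * p 1 1 * q 1 2 3 + (4/3) * p 1 3 * q 1 1 2
      - (1/3) * p 2 3 * q 1 1 1 + (2/3) * lam 1 * q 1 2 2
      - lam 1 * (p 1 3 * q 3 3 3 - p 3 3 * q 1 3 3),

    (8/3) * lam 0 * q 1 3 3 - (4/9) * lam 2 ^ 2 * q 1 3 3
      - 2 * lam 1 * (p 1 3 * q 2 3 3 - p 2 3 * q 1 3 3)
      - (4/9) * lam 2 * (p 1 1 * q 3 3 3 + p 1 3 * q 1 3 3 - 2 * p 3 3 * q 1 1 3)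
      + (2/9) * lam 2 * lam 1 * q 2 3 3 + (4/3) * lam 3 * lam 1 * q 1 3 3
      - 2 * lam 3 * lam 0 * q 2 3 3 - (4/3) * p 1 1 * q 1 2 2 + (2/3) * p 1 2 * q 1 1 2
      + (2/3) * p 2 2 * q 1 1 1,

    (1/2) * lam 1 ^ 2 * q 3 3 3 - 2 * lam 2 * lam 0 * q 3 3 3 - 3 * lam 0 * q 1 2 2
      - 4 * lam 0 * (p 1 3 * q 3 3 3 - p 3 3 * q 1 3 3) + (1/2) * lam 1 * q 1 1 2
      + p 1 3 * q 1 1 1 - p 1 1 * q 1 1 3,

    - (1/3) * lam 2 * lam 1 * q 1 3 3 - p 1 1 * q 1 1 2 + p 1 2 * q 1 1 1
      - 4 * lam 0 * (p 1 3 * q 2 3 3 - p 2 3 * q 1 3 3)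
      - (1/3) * lam 1 * (p 1 1 * q 3 3 3 + p 1 3 * q 1 3 3 - 2 * p 3 3 * q 1 1 3)
      + (2/3) * lam 1 ^ 2 * q 2 3 3 + 3 * lam 3 * lam 0 * q 1 3 3
      - 2 * lam 2 * lam 0 * q 2 3 3]"

end

theory Submission
  imports Defs "HOL-Complex_Analysis.Complex_Analysis"
begin

no_notation fps_nth (infixl "$" 75)

text \<open>
  Near \<open>\<infinity>\<close> the curve has a
  chart with a local parameter \<open>t\<close>, and three points in it reach an open set of \<open>u\<close>. Klein's formula
  for a fourth point near \<open>\<infinity>\<close>, expanded in its parameter, says that the functions
  \<open>\<wp>\<^sub>1\<^sub>3 + \<wp>\<^sub>2\<^sub>3 x + \<wp>\<^sub>3\<^sub>3 y - x\<^sup>2\<close>, and similar ones with leading terms \<open>xy\<close> and \<open>y\<^sup>2\<close>, vanish at the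
  three points. As \<open>1, x, y\<close> are independent there, associativity of multiplication modulo the
  divisor and the curve equation give relations among the \<open>\<wp>\<close>-functions on an open set of \<open>u\<close>, hence wherever
  \<open>\<sigma>\<close> does not vanish. Splitting them into even and odd parts and eliminating derivatives (dividing
  by \<open>\<wp>\<^sub>3\<^sub>3\<^sub>3\<close>, which is not identically zero) yields the bilinear relations.

  Conversely, rescaling \<open>u\<close> by the weights \<open>5, 2, 1\<close> turns the top-weight part of a bilinear relation into a
  relation for the Schur polynomial \<open>u\<^sub>3\<^sup>5 / 20 - u\<^sub>3 u\<^sub>2\<^sup>2 + u\<^sub>1\<close>. Evaluated at four points
  these relations leave only combinations of the top-weight parts of the given ones, which can be subtracted;
  the weight decreases and vanishes after finitely many steps.
\<close>

section \<open>Holomorphic functions of three variables\<close>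

text \<open>Two devices carry the elimination. Four-index equations (named \<open>N...\<close>) are
  differentiated in two ways, and equality of mixed fifth derivatives gives bilinear relations. In
  turn, derivatives of bilinear relations are combined so that products of two three-index functions
  cancel, which gives further four-index equations. The obstacle is \<open>p1333\<close>: alone
  among the fifteen four-index functions it gets no equation of its own, and it occurs in the other
  fourteen only through Q = \<open>p1333 - 6 * p13 * p33\<close>. The derivatives of Q are
  nevertheless bilinear, because \<open>p13333\<close>, \<open>p12333\<close>, \<open>p11333\<close>
  can be taken from the equations for \<open>p3333\<close>, \<open>p2333\<close>,
  \<open>p1133\<close>. They are the origin of recurring brackets such as
  \<open>p13 * p333 - p33 * p133\<close>. In the converse, each factor \<open>lam j\<close> lowers
  the weight by 12 - 3j. The top-weight parts of the relations therefore do not depend on the curve,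
  and one finite computation serves all curves. The leading part of \<sigma> also matters for the
  relations themselves: it provides the point where \<open>p333\<close> is nonzero.\<close>

definition hol3 :: "(complex^3) set \<Rightarrow> (complex^3 \<Rightarrow> complex) \<Rightarrow> bool" where
  "hol3 S f \<longleftrightarrow> continuous_on S f \<and>
     (\<forall>u\<in>S. \<forall>i. (\<lambda>z. f (u + z *s axis i 1)) field_differentiable at 0)"

lemma norm_axis3: "norm (axis i (z::complex) :: complex^3) = norm z"
  by (simp add: norm_vec_def L2_set_def axis_def if_distrib[of norm] if_distrib[of "\<lambda>x. x\<^sup>2"] cong: if_cong)

lemma bounded_linear_smult_axis: "bounded_linear (\<lambda>z::complex. z *s (axis i 1 :: complex^3))"
proof (rule bounded_linear_intro[where K = 1])
  show "norm (z *s (axis i 1 :: complex^3)) \<le> norm z * 1" for z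
  proof -
    have "z *s (axis i 1 :: complex^3) = axis i z" by (simp add: vec_eq_iff axis_def)
    then show ?thesis by (simp add: norm_axis3)
  qed
qed (simp_all add: vec_eq_iff algebra_simps)

lemmas continuous_on_smult_axis [continuous_intros] =
  bounded_linear.continuous_on[OF bounded_linear_smult_axis]
lemmas tendsto_smult_axis [tendsto_intros] =
  bounded_linear.tendsto[OF bounded_linear_smult_axis]

lemma norm_smult_axis [simp]: "norm (z *s (axis i 1 :: complex^3)) = norm z"
proof -
  have "z *s (axis i 1 :: complex^3) = axis i z" by (simp add: vec_eq_iff axis_def)
  then show ?thesis by (simp add: norm_axis3)
qed

lemma hol3_subset: "hol3 S f \<Longrightarrow> T \<subseteq> S \<Longrightarrow> hol3 T f"
  unfolding hol3_def using continuous_on_subset by blast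

lemma hol3_continuous: "hol3 S f \<Longrightarrow> continuous_on S f"
  by (simp add: hol3_def)

lemma hol3_has_pd:
  assumes "hol3 S f" "u \<in> S"
  shows "((\<lambda>z. f (u + z *s axis i 1)) has_field_derivative pd i f u) (at 0)"
  using assms unfolding hol3_def pd_def
  by (simp add: field_differentiable_derivI)

lemma hol3_has_pd_line:
  assumes "hol3 S f" "u + w *s axis i 1 \<in> S"
  shows "((\<lambda>z. f (u + z *s axis i 1)) has_field_derivative pd i f (u + w *s axis i 1)) (at w)"
proof -
  have "((\<lambda>z. f ((u + w *s axis i 1) + z *s axis i 1)) has_field_derivative
     pd i f (u + w *s axis i 1)) (at 0)"
    using hol3_has_pd assms by blast
  then have "((\<lambda>z. f (u + (w + z) *s axis i 1)) has_field_derivative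
     pd i f (u + w *s axis i 1)) (at 0)"
    by (simp add: vector_sadd_rdistrib add.assoc)
  then show ?thesis
    using DERIV_shift[of "\<lambda>z. f (u + z *s axis i 1)" _ 0 w] by (simp add: add.commute)
qed

lemma pd_eqI:
  "((\<lambda>z. f (u + z *s axis i 1)) has_field_derivative D) (at 0) \<Longrightarrow> pd i f u = D"
  unfolding pd_def by (rule DERIV_imp_deriv)

lemma pd_cong:
  assumes "open S" "u \<in> S" "\<And>v. v \<in> S \<Longrightarrow> f v = g v"
  shows "pd i f u = pd i g u"
proof -
  have "((\<lambda>z. u + z *s axis i 1) \<longlongrightarrow> u + 0 *s axis i 1) (nhds 0)"
    by (intro tendsto_add tendsto_const tendsto_smult_axis filterlim_ident)
  then have "\<forall>\<^sub>F z in nhds 0. u + z *s axis i 1 \<in> S"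
    using assms by (simp add: tendsto_def)
  then have "\<forall>\<^sub>F z in nhds 0. f (u + z *s axis i 1) = g (u + z *s axis i 1)"
    by eventually_elim (use assms in auto)
  then show ?thesis unfolding pd_def by (rule deriv_cong_ev) simp
qed

lemma hol3_const: "hol3 S (\<lambda>_. c)"
  unfolding hol3_def by simp

lemma hol3_add: "hol3 S f \<Longrightarrow> hol3 S g \<Longrightarrow> hol3 S (\<lambda>u. f u + g u)"
  unfolding hol3_def by (auto intro!: continuous_intros derivative_intros field_differentiable_add)

lemma hol3_mult: "hol3 S f \<Longrightarrow> hol3 S g \<Longrightarrow> hol3 S (\<lambda>u. f u * g u)"
  unfolding hol3_def by (auto intro!: continuous_intros field_differentiable_mult)

lemma hol3_minus: "hol3 S f \<Longrightarrow> hol3 S (\<lambda>u. - f u)"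
  unfolding hol3_def by (auto intro!: continuous_intros field_differentiable_minus)

lemma hol3_diff: "hol3 S f \<Longrightarrow> hol3 S g \<Longrightarrow> hol3 S (\<lambda>u. f u - g u)"
  unfolding hol3_def by (auto intro!: continuous_intros field_differentiable_diff)

lemma hol3_power: "hol3 S f \<Longrightarrow> hol3 S (\<lambda>u. f u ^ n)"
  by (induction n) (auto intro: hol3_const hol3_mult)

lemma hol3_divide:
  assumes "hol3 S f" "hol3 S g" "\<And>u. u \<in> S \<Longrightarrow> g u \<noteq> 0"
  shows "hol3 S (\<lambda>u. f u / g u)"
  using assms unfolding hol3_def
  by (auto intro!: continuous_intros field_differentiable_divide)

lemmas hol3_intros = hol3_const hol3_add hol3_mult hol3_minus hol3_diff hol3_power

lemma nbhd_polydisc: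
  assumes "open S" "(u::complex^3) \<in> S"
  obtains r where "r > 0"
    "\<And>v z i. v \<in> ball u r \<Longrightarrow> norm z < 2 * r \<Longrightarrow> v + z *s axis i 1 \<in> S"
proof -
  from assms obtain e where e: "e > 0" "ball u e \<subseteq> S"
    using openE by blast
  show ?thesis
  proof (rule that[of "e/3"])
    fix v and z :: complex and i :: 3 assume "v \<in> ball u (e/3)" "norm z < 2 * (e/3)"
    then have "dist u (v + z *s axis i 1) < e"
      using norm_triangle_ineq4[of "u - v" "z *s axis i 1"]
      by (simp add: dist_norm algebra_simps)
    then show "v + z *s axis i 1 \<in> S" using e by auto
  qed (use e in auto)
qed

section \<open>Cauchy's formula in one coordinate and iterated partial derivatives\<close>

definition circ :: "real \<Rightarrow> real \<Rightarrow> complex" where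
  "circ r t = of_real r * exp (2 * of_real pi * \<i> * of_real t)"

lemma norm_circ [simp]: "norm (circ r t) = \<bar>r\<bar>"
  by (simp add: circ_def norm_mult)

lemma circ_nonzero [simp]: "r > 0 \<Longrightarrow> circ r t \<noteq> 0"
  by (simp add: circ_def)

lemma continuous_circ [continuous_intros]:
  "continuous_on A g \<Longrightarrow> continuous_on A (\<lambda>x. circ r (g x))"
  unfolding circ_def by (intro continuous_intros)

text \<open>Continuity plus holomorphy in each coordinate suffices for everything that follows,
  because a partial derivative becomes an integral over a circle in one coordinate and the other
  coordinates enter only through the integrand. The bound \<open>2 * r\<close> keeps the closed disc
  of radius \<open>r\<close> inside the region of holomorphy.\<close>

lemma cauchy_pd:
  assumes S: "open S" and f: "hol3 S f" and r: "r > 0"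
    and sub: "\<And>z. norm z < 2 * r \<Longrightarrow> u + z *s axis i 1 \<in> S"
  shows "pd i f u = integral (cbox 0 1) (\<lambda>t. f (u + circ r t *s axis i 1) / circ r t)"
proof -
  let ?g = "\<lambda>z. f (u + z *s axis i 1)"
  have hol: "?g holomorphic_on ball 0 (2 * r)"
    unfolding holomorphic_on_def
  proof
    fix w :: complex assume "w \<in> ball 0 (2 * r)"
    then have "(?g has_field_derivative pd i f (u + w *s axis i 1)) (at w)"
      by (intro hol3_has_pd_line[OF f] sub) simp
    then show "?g field_differentiable at w within ball 0 (2 * r)"
      using field_differentiable_at_within field_differentiable_def by blast
  qed
  have "(?g has_field_derivative (1 / (2 * of_real pi * \<i>) *
      contour_integral (circlepath 0 r) (\<lambda>z. ?g z / (z - 0)\<^sup>2))) (at 0)"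
    by (rule Cauchy_derivative_integral_circlepath(2))
      (use hol r in \<open>auto intro!: holomorphic_on_imp_continuous_on holomorphic_on_subset[OF hol]\<close>)
  then have "pd i f u = 1 / (2 * of_real pi * \<i>) * contour_integral (circlepath 0 r) (\<lambda>z. ?g z / z\<^sup>2)"
    using pd_eqI by simp
  also have "contour_integral (circlepath 0 r) (\<lambda>z. ?g z / z\<^sup>2) =
      integral {0..1} (\<lambda>t. 2 * of_real pi * \<i> * (?g (circ r t) / circ r t))"
    unfolding contour_integral_integral
  proof (rule integral_cong)
    fix t :: real assume "t \<in> {0..1}"
    have c: "circlepath 0 r t = circ r t" by (simp add: circlepath circ_def)
    have "vector_derivative (circlepath 0 r) (at t) = 2 * of_real pi * \<i> * circ r t"
      by (simp add: vector_derivative_circlepath circ_def)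
    then show "?g (circlepath 0 r t) / (circlepath 0 r t)\<^sup>2 * vector_derivative (circlepath 0 r) (at t) =
        2 * of_real pi * \<i> * (?g (circ r t) / circ r t)"
      using r by (simp add: c power2_eq_square)
  qed
  also have "\<dots> = 2 * of_real pi * \<i> * integral {0..1} (\<lambda>t. ?g (circ r t) / circ r t)"
    by (rule integral_mult_right)
  finally show ?thesis by simp
qed

text \<open>The Cauchy integral depends continuously on its centre, since its integrand is jointly
  continuous in centre and angle.\<close>

lemma hol3_pd_aux:
  assumes S: "open S" and f: "hol3 S f"
  shows "continuous_on S (pd i f)"
proof -
  have "isCont (pd i f) u" if u: "u \<in> S" for u
  proof -
    obtain r where r: "r > 0"
      "\<And>v z i. v \<in> ball u r \<Longrightarrow> norm z < 2 * r \<Longrightarrow> v + z *s axis i 1 \<in> S"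
      using nbhd_polydisc[OF S u] by metis
    have "continuous_on (ball u r) (\<lambda>v. integral (cbox 0 1) (\<lambda>t. f (v + circ r t *s axis i 1) / circ r t))"
    proof (rule integral_continuous_on_param)
      show "continuous_on (ball u r \<times> cbox 0 1) (\<lambda>(v, t). f (v + circ r t *s axis i 1) / circ r t)"
        unfolding split_beta using r
        by (intro continuous_intros continuous_on_compose2[OF hol3_continuous[OF f]]) auto
    qed
    then have "continuous_on (ball u r) (pd i f)"
      by (rule continuous_on_eq) (rule cauchy_pd[OF S f r(1), symmetric], rule r(2))
    then show ?thesis using r(1) by (simp add: continuous_on_eq_continuous_at)
  qed
  then show ?thesis by (simp add: continuous_at_imp_continuous_on)
qed

text \<open>Differentiation under the Cauchy integral. The result is again a Cauchy integral, now of
  \<open>pd j f\<close>, so this one computation yields both the holomorphy of \<open>pd i f\<close>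
  and the equality of mixed derivatives.\<close>

lemma pd_has_pd_aux:
  assumes S: "open S" and f: "hol3 S f" and u: "u \<in> S"
  shows "\<exists>r>0. (\<forall>z i. norm z < 2 * r \<longrightarrow> u + z *s axis i 1 \<in> S) \<and>
    ((\<lambda>z. pd i f (u + z *s axis j 1)) has_field_derivative
      integral (cbox 0 1) (\<lambda>t. pd j f (u + circ r t *s axis i 1) / circ r t)) (at 0)"
proof -
  obtain e where e: "e > 0" "ball u e \<subseteq> S" using S u openE by blast
  \<comment> \<open>Displacements below \<open>r\<close> in one direction and below
    \<open>2 * r\<close> in another add up to less than \<open>e\<close>.\<close>
  define r where "r = e / 4"
  have r: "r > 0" using e by (simp add: r_def)
  have sub: "u + w *s axis j 1 + z *s axis i 1 \<in> S" if "norm w < r" "norm z < 2 * r" for w z and i j :: 3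
  proof -
    have "norm (w *s axis j 1 + z *s axis i 1 :: complex^3) < e"
      using norm_triangle_ineq[of "w *s axis j 1" "z *s axis i 1 :: complex^3"] that r
      by (simp add: r_def)
    then have "dist u (u + w *s axis j 1 + z *s axis i 1) < e"
      by (metis add.assoc add_diff_cancel_left' dist_commute dist_norm)
    then show ?thesis using e by auto
  qed
  have sub': "u + z *s axis i 1 \<in> S" if "norm z < 2 * r" for z and i :: 3
    using sub[of 0 z i i] that r by simp
  have "((\<lambda>z. integral (cbox 0 1) (\<lambda>t. f (u + z *s axis j 1 + circ r t *s axis i 1) / circ r t))
     has_field_derivative
     integral (cbox 0 1) (\<lambda>t. pd j f (u + 0 *s axis j 1 + circ r t *s axis i 1) / circ r t))
     (at 0 within ball 0 r)"
  proof (rule leibniz_rule_field_derivative[where U = "ball 0 r"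
      and fx = "\<lambda>z t. pd j f (u + z *s axis j 1 + circ r t *s axis i 1) / circ r t"])
    fix z :: complex and t :: real assume z: "z \<in> ball 0 r"
    have "((\<lambda>z. f ((u + circ r t *s axis i 1) + z *s axis j 1)) has_field_derivative
        pd j f ((u + circ r t *s axis i 1) + z *s axis j 1)) (at z)"
      using sub[of z "circ r t" j i] z r by (intro hol3_has_pd_line[OF f]) (simp add: algebra_simps)
    then show "((\<lambda>z. f (u + z *s axis j 1 + circ r t *s axis i 1) / circ r t) has_field_derivative
        pd j f (u + z *s axis j 1 + circ r t *s axis i 1) / circ r t) (at z within ball 0 r)"
      by (simp add: add_ac has_field_derivative_at_within DERIV_cdivide)
    show "(\<lambda>t. f (u + z *s axis j 1 + circ r t *s axis i 1) / circ r t) integrable_on cbox 0 1"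
      using z r
      by (intro integrable_continuous continuous_intros continuous_on_compose2[OF hol3_continuous[OF f]])
        (auto intro!: sub)
  next
    show "continuous_on (ball 0 r \<times> cbox 0 1)
       (\<lambda>(z, t). pd j f (u + z *s axis j 1 + circ r t *s axis i 1) / circ r t)"
      unfolding split_beta using r
      by (intro continuous_intros continuous_on_compose2[OF hol3_pd_aux[OF S f]]) (auto intro!: sub)
  qed (use r in auto)
  then have 1: "((\<lambda>z. integral (cbox 0 1) (\<lambda>t. f (u + z *s axis j 1 + circ r t *s axis i 1) / circ r t))
     has_field_derivative
     integral (cbox 0 1) (\<lambda>t. pd j f (u + circ r t *s axis i 1) / circ r t)) (at 0)"
    using r by (simp add: at_within_open[of 0 "ball 0 r"])
  have 2: "integral (cbox 0 1) (\<lambda>t. f (u + z *s axis j 1 + circ r t *s axis i 1) / circ r t) =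
     pd i f (u + z *s axis j 1)" if "z \<in> ball 0 r" for z
    using that by (intro cauchy_pd[OF S f r, symmetric] sub) auto
  have "((\<lambda>z. pd i f (u + z *s axis j 1)) has_field_derivative
      integral (cbox 0 1) (\<lambda>t. pd j f (u + circ r t *s axis i 1) / circ r t)) (at 0)"
    by (rule has_field_derivative_transform_within_open[OF 1 open_ball[of 0 r] _ 2]) (use r in auto)
  then show ?thesis
    by (intro exI[of _ r] conjI allI impI r sub')
qed

lemma hol3_pd:
  assumes S: "open S" and f: "hol3 S f"
  shows "hol3 S (pd i f)"
  unfolding hol3_def
proof (intro conjI ballI allI)
  show "continuous_on S (pd i f)" using hol3_pd_aux assms by blast
  fix u j assume "u \<in> S"
  then show "(\<lambda>z. pd i f (u + z *s axis j 1)) field_differentiable at 0"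
    using pd_has_pd_aux[OF S f, of u i j] unfolding field_differentiable_def by blast
qed

lemma pd_commute:
  assumes S: "open S" and f: "hol3 S f" and u: "u \<in> S"
  shows "pd j (pd i f) u = pd i (pd j f) u"
proof -
  from pd_has_pd_aux[OF assms, of i j] obtain r where r: "r > 0"
    "\<And>z i. norm z < 2 * r \<Longrightarrow> u + z *s axis i 1 \<in> S"
    "((\<lambda>z. pd i f (u + z *s axis j 1)) has_field_derivative
      integral (cbox 0 1) (\<lambda>t. pd j f (u + circ r t *s axis i 1) / circ r t)) (at 0)"
    by blast
  show ?thesis
    using pd_eqI[OF r(3)] cauchy_pd[OF S hol3_pd[OF S f, of j] r(1,2), of i] by simp
qed

text \<open>Telescoping along the axes reduces the total derivative to the mean value bound in one variable.\<close>

lemma hol3_has_derivative: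
  assumes S: "open S" and f: "hol3 S f" and u: "u \<in> S"
  shows "(f has_derivative (\<lambda>h. \<Sum>i\<in>UNIV. h $ i * pd i f u)) (at u)"
proof -
  have lin: "bounded_linear (\<lambda>h::complex^3. \<Sum>i\<in>UNIV. h $ i * pd i f u)"
    by (intro bounded_linear_sum bounded_linear_mult_const bounded_linear_vec_nth)
  have step: "norm (f (v + h *s axis i 1) - f v - h * pd i f u) \<le> e * norm h"
    if cl: "\<And>z. norm z \<le> norm h \<Longrightarrow> v + z *s axis i 1 \<in> S \<and> norm (pd i f (v + z *s axis i 1) - pd i f u) \<le> e"
    for v h i e
  proof -
    have "norm ((\<lambda>z. f (v + z *s axis i 1) - z * pd i f u) h - (\<lambda>z. f (v + z *s axis i 1) - z * pd i f u) 0)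
        \<le> e * norm (h - 0)"
    proof (rule field_differentiable_bound[where S = "cball 0 (norm h)"
          and f' = "\<lambda>z. pd i f (v + z *s axis i 1) - pd i f u"])
      fix z :: complex assume "z \<in> cball 0 (norm h)"
      then have z: "norm z \<le> norm h" by simp
      then show "((\<lambda>z. f (v + z *s axis i 1) - z * pd i f u) has_field_derivative
          pd i f (v + z *s axis i 1) - pd i f u) (at z within cball 0 (norm h))"
        using DERIV_diff[OF hol3_has_pd_line[OF f, of v z i] DERIV_cmult_right[OF DERIV_ident]] cl[OF z]
        by (auto simp: has_field_derivative_at_within)
      show "norm (pd i f (v + z *s axis i 1) - pd i f u) \<le> e" using cl[OF z] by blast
    qed auto
    then show ?thesis by (simp add: algebra_simps)
  qed
  have "\<exists>d>0. \<forall>h. norm h < d \<longrightarrow> norm (f (u + h) - f u - (\<Sum>i\<in>UNIV. h $ i * pd i f u)) \<le> e * norm h"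
    if "e > 0" for e
  proof -
    have "\<exists>d>0. \<forall>v. dist v u < d \<longrightarrow> v \<in> S \<and> norm (pd i f v - pd i f u) < e / 3" for i
    proof -
      have "isCont (pd i f) u"
        using hol3_pd_aux[OF S f] S u by (simp add: continuous_on_eq_continuous_at)
      then obtain d where "d > 0" "\<forall>v. dist v u < d \<longrightarrow> dist (pd i f v) (pd i f u) < e / 3"
        unfolding continuous_at_eps_delta using \<open>e > 0\<close> by (metis divide_pos_pos zero_less_numeral)
      moreover obtain d' where "d' > 0" "ball u d' \<subseteq> S" using S u openE by blast
      ultimately show ?thesis
        by (intro exI[of _ "min d d'"]) (auto simp: dist_norm norm_minus_commute subset_iff)
    qed
    then have "\<forall>i. \<exists>d. d > 0 \<and> (\<forall>v. dist v u < d \<longrightarrow> v \<in> S \<and> norm (pd i f v - pd i f u) < e / 3)"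
      by blast
    from choice[OF this] obtain D where D: "\<And>i. D i > 0"
      "\<And>i v. dist v u < D i \<Longrightarrow> v \<in> S \<and> norm (pd i f v - pd i f u) < e / 3" by blast
    define d where "d = Min (range D) / 3"
    have "Min (range D) > 0" using D(1) by (subst Min_gr_iff) auto
    then have d: "d > 0" by (simp add: d_def)
    have dD: "3 * d \<le> D i" for i by (simp add: d_def)
    have "norm (f (u + h) - f u - (\<Sum>i\<in>UNIV. h $ i * pd i f u)) \<le> e * norm h" if h: "norm h < d" for h
    proof -
      have hi: "norm (h $ i) < d" for i using h Finite_Cartesian_Product.norm_nth_le[of h i] by simp
      define v1 where "v1 = u + (h $ 1) *s axis 1 1"
      define v2 where "v2 = v1 + (h $ 2) *s axis 2 1"
      have near: "v + z *s axis i 1 \<in> S \<and> norm (pd i f (v + z *s axis i 1) - pd i f u) \<le> e / 3"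
        if "norm (v - u) \<le> 2 * d" "norm z < d" for v :: "complex^3" and z :: complex and i :: 3
      proof -
        have "dist (v + z *s axis i 1) u < D i"
          using norm_triangle_ineq[of "v - u" "z *s axis i 1"] that dD[of i]
          by (simp add: dist_norm algebra_simps)
        then show ?thesis using D(2) less_imp_le by blast
      qed
      have n1: "norm (v1 - u) \<le> 2 * d" using hi[of 1] d by (simp add: v1_def)
      have n2: "norm (v2 - u) \<le> 2 * d"
        using norm_triangle_ineq[of "(h $ 1) *s axis 1 1" "(h $ 2) *s axis 2 1 :: complex^3"] hi[of 1] hi[of 2]
        by (simp add: v1_def v2_def algebra_simps)
      have uh: "u + h = v2 + (h $ 3) *s axis 3 1"
        by (simp add: v1_def v2_def vec_eq_iff axis_def forall_3)
      have s1: "norm (f v1 - f u - h $ 1 * pd 1 f u) \<le> e / 3 * norm (h $ 1)"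
        unfolding v1_def using near[of u] hi[of 1] d by (intro step) auto
      have s2: "norm (f v2 - f v1 - h $ 2 * pd 2 f u) \<le> e / 3 * norm (h $ 2)"
        unfolding v2_def using near[OF n1] hi[of 2] d by (intro step) auto
      have s3: "norm (f (u + h) - f v2 - h $ 3 * pd 3 f u) \<le> e / 3 * norm (h $ 3)"
        unfolding uh using near[OF n2] hi[of 3] d by (intro step) auto
      have "f (u + h) - f u - (\<Sum>i\<in>UNIV. h $ i * pd i f u) =
          (f v1 - f u - h $ 1 * pd 1 f u) + (f v2 - f v1 - h $ 2 * pd 2 f u)
          + (f (u + h) - f v2 - h $ 3 * pd 3 f u)"
        by (simp add: sum_3)
      also have "norm \<dots> \<le> e / 3 * norm (h $ 1) + e / 3 * norm (h $ 2) + e / 3 * norm (h $ 3)"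
        using s1 s2 s3 by (intro order_trans[OF norm_triangle_ineq] add_mono) auto
      also have "\<dots> \<le> e / 3 * norm h + e / 3 * norm h + e / 3 * norm h"
        using \<open>e > 0\<close> Finite_Cartesian_Product.norm_nth_le[of h]
        by (intro add_mono mult_left_mono) auto
      finally show ?thesis by simp
    qed
    with d show ?thesis by blast
  qed
  note bound = this
  show ?thesis
    unfolding has_derivative_at_alt
  proof (intro conjI allI impI lin)
    fix e :: real assume "e > 0"
    then obtain d where d: "d > 0"
      "\<And>h. norm h < d \<Longrightarrow> norm (f (u + h) - f u - (\<Sum>i\<in>UNIV. h $ i * pd i f u)) \<le> e * norm h"
      using bound by blast
    show "\<exists>d>0. \<forall>y. norm (y - u) < d \<longrightarrow>
        norm (f y - f u - (\<Sum>i\<in>UNIV. (y - u) $ i * pd i f u)) \<le> e * norm (y - u)"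
      using d(1) d(2)[of "_ - u"] by (intro exI[of _ d]) (simp del: vector_minus_component)
  qed
qed

text \<open>Curves with a complex parameter serve three times: complex lines in the identity
  theorem, the chart at infinity, and the weighted dilations.\<close>

lemma hol3_chain:
  assumes S: "open S" and f: "hol3 S f" and u: "\<gamma> t \<in> S"
    and \<gamma>: "\<And>i. ((\<lambda>t. \<gamma> t $ i) has_field_derivative \<gamma>' i) (at t)"
  shows "((\<lambda>t. f (\<gamma> t)) has_field_derivative (\<Sum>i\<in>UNIV. \<gamma>' i * pd i f (\<gamma> t))) (at t)"
proof -
  have "(\<gamma> has_derivative (\<lambda>h. \<chi> i. \<gamma>' i * h)) (at t)"
  proof (subst has_derivative_componentwise_within, intro ballI)
    fix b :: "complex^3" assume "b \<in> Basis"
    then obtain i k where b: "b = axis i k" by (auto simp: Basis_vec_def)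
    show "((\<lambda>x. \<gamma> x \<bullet> b) has_derivative (\<lambda>x. (\<chi> i. \<gamma>' i * x) \<bullet> b)) (at t)"
      using \<gamma>[of i, unfolded has_field_derivative_def]
      by (auto simp: b inner_axis intro!: derivative_eq_intros)
  qed
  from has_derivative_compose[OF this hol3_has_derivative[OF S f u]]
  show ?thesis
    unfolding has_field_derivative_def
    by (rule has_derivative_eq_rhs) (auto simp: fun_eq_iff sum_distrib_left sum_distrib_right mult_ac)
qed

text \<open>Complex linearity of the total derivative is what turns its restriction to a coordinate
  line into a complex derivative.\<close>

lemma entire3_hol3: "entire3 f \<Longrightarrow> hol3 UNIV f"
  unfolding hol3_def
proof (intro conjI ballI allI)
  assume f: "entire3 f"
  then show "continuous_on UNIV f"
    unfolding entire3_def
    by (metis continuous_at_imp_continuous_on has_derivative_continuous)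
  fix u and i :: 3
  obtain D where D: "(f has_derivative D) (at u)" "Vector_Spaces.linear (*s) (*) D"
    using f unfolding entire3_def by blast
  have "((\<lambda>z. u + z *s axis i 1) has_derivative (\<lambda>z. z *s axis i 1)) (at (0::complex))"
    by (auto intro!: derivative_eq_intros bounded_linear.has_derivative[OF bounded_linear_smult_axis])
  from has_derivative_compose[OF this, of f D]
  have "((\<lambda>z. f (u + z *s axis i 1)) has_derivative (\<lambda>z. D (z *s axis i 1))) (at 0)"
    using D by simp
  moreover have "D (z *s axis i 1) = D (axis i 1) * z" for z
    using D(2) by (simp add: Vector_Spaces.linear_iff)
  ultimately show "(\<lambda>z. f (u + z *s axis i 1)) field_differentiable at 0"
    unfolding field_differentiable_def has_field_derivative_def by (auto simp: ext)
qed

text \<open>Analytic continuation along the complex line through two points: the zeros of \<open>\<sigma>\<close> on that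
  line are isolated, so their complement is connected.\<close>

lemma hol3_identity:
  assumes \<sigma>: "hol3 UNIV \<sigma>" and f: "hol3 {u. \<sigma> u \<noteq> 0} f"
    and G: "open G" "G \<noteq> {}" "\<And>u. u \<in> G \<Longrightarrow> \<sigma> u \<noteq> 0" "\<And>u. u \<in> G \<Longrightarrow> f u = 0"
    and u: "\<sigma> u \<noteq> 0"
  shows "f u = 0"
proof -
  obtain v where v: "v \<in> G" using G by blast
  define L where "L = (\<lambda>z::complex. v + z *s (u - v))"
  have L': "((\<lambda>z. L z $ i) has_field_derivative (u - v) $ i) (at z)" for z i
    unfolding L_def by (auto intro!: derivative_eq_intros)
  have contL: "continuous_on A L" for A
  proof -
    have "L = (\<lambda>z. \<chi> i. v $ i + z * (u - v) $ i)" by (simp add: L_def fun_eq_iff vec_eq_iff algebra_simps)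
    then show ?thesis by (auto intro!: continuous_on_vec_lambda continuous_intros)
  qed
  have openS: "open {u. \<sigma> u \<noteq> 0}"
    using hol3_continuous[OF \<sigma>] by (simp add: open_Collect_neq)
  have hs: "(\<lambda>z. \<sigma> (L z)) holomorphic_on UNIV"
    unfolding holomorphic_on_def field_differentiable_def
    using hol3_chain[OF open_UNIV \<sigma> UNIV_I L'] has_field_derivative_at_within by blast
  define Z where "Z = {z \<in> UNIV. \<sigma> (L z) = 0}"
  have L0: "L 0 = v" "L 1 = u" by (simp_all add: L_def)
  \<comment> \<open>If \<sigma> is constant along the line, the constant is its nonzero value at
    \<open>u\<close> and there are no zeros at all; otherwise the zeros are countable.\<close>
  have "\<not> (\<lambda>z. \<sigma> (L z)) constant_on UNIV \<or> Z = {}"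
    using L0 u by (auto simp: constant_on_def Z_def)
  then have "countable Z"
    unfolding Z_def using holomorphic_countable_zeros[OF hs] by auto
  then have conn: "connected (UNIV - Z)"
    by (intro connected_open_diff_countable) auto
  have cl: "closed Z"
    unfolding Z_def using holomorphic_on_imp_continuous_on[OF hs] by (simp add: closed_Collect_eq)
  have hf: "(\<lambda>z. f (L z)) holomorphic_on (UNIV - Z)"
    unfolding holomorphic_on_def field_differentiable_def
  proof
    fix z assume "z \<in> UNIV - Z"
    then have "L z \<in> {u. \<sigma> u \<noteq> 0}" by (simp add: Z_def)
    from hol3_chain[OF openS f this L']
    show "\<exists>f'. ((\<lambda>z. f (L z)) has_field_derivative f') (at z within UNIV - Z)"
      using has_field_derivative_at_within by blast
  qed
  have U: "open (L -` G)" using open_vimage[OF G(1) contL] .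
  have "(\<lambda>z. f (L z)) 1 = (\<lambda>z. 0) 1"
  proof (rule analytic_continuation_open[OF U _ _ conn _ hf holomorphic_on_const])
    show "L -` G \<noteq> {}" using L0 v by blast
    show "open (UNIV - Z)" using cl by auto
    show "L -` G \<subseteq> UNIV - Z" using G(3) by (auto simp: Z_def)
    show "(\<lambda>z. f (L z)) z = (\<lambda>z. 0) z" if "z \<in> L -` G" for z using that G(4) by auto
    show "1 \<in> UNIV - Z" using L0 u by (simp add: Z_def)
  qed
  then show ?thesis using L0 by simp
qed

section \<open>Logarithmic derivatives of an odd entire function\<close>

lemma hol3_pd_pow: "open S \<Longrightarrow> hol3 S f \<Longrightarrow> hol3 S ((pd j ^^ n) f)"
  by (induction n) (auto intro: hol3_pd)

lemma pd_pow_cong: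
  assumes "open S" "\<And>v. v \<in> S \<Longrightarrow> f v = g v" "u \<in> S"
  shows "(pd j ^^ n) f u = (pd j ^^ n) g u"
  using assms(3)
proof (induction n arbitrary: u)
  case (Suc n)
  then show ?case using pd_cong[OF assms(1) Suc.prems, of "(pd j ^^ n) f" "(pd j ^^ n) g"] by simp
qed (simp add: assms)

lemma pd_pow_commute:
  assumes "open S" "hol3 S f" "u \<in> S"
  shows "pd i ((pd j ^^ n) f) u = (pd j ^^ n) (pd i f) u"
  using assms(3)
proof (induction n arbitrary: u)
  case (Suc n)
  have "pd i ((pd j ^^ Suc n) f) u = pd j (pd i ((pd j ^^ n) f)) u"
    using pd_commute[OF assms(1) hol3_pd_pow[OF assms(1,2)] Suc.prems, of i j n j] by simp
  also have "\<dots> = pd j ((pd j ^^ n) (pd i f)) u"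
    by (rule pd_cong[OF assms(1) Suc.prems]) (rule Suc.IH)
  finally show ?case by simp
qed simp

lemma pd_reflect:
  assumes S: "open S" "\<And>v. v \<in> S \<Longrightarrow> - v \<in> S" and f: "hol3 S f"
    and r: "\<And>v. v \<in> S \<Longrightarrow> f (- v) = s * f v" and u: "u \<in> S"
  shows "pd i f (- u) = - s * pd i f u"
proof -
  have h: "((\<lambda>z. f (- u + z *s axis i 1)) has_field_derivative pd i f (- u)) (at (- 0))"
    using hol3_has_pd[OF f S(2)[OF u]] by simp
  have m: "((\<lambda>z. - z) has_field_derivative - 1) (at (0::complex))"
    by (intro DERIV_minus DERIV_ident)
  have "((\<lambda>z. f (- u + (- z) *s axis i 1)) has_field_derivative - pd i f (- u)) (at 0)"
    using DERIV_chain2[OF h m] by simp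
  moreover have "((\<lambda>z. s * f (u + z *s axis i 1)) has_field_derivative s * pd i f u) (at 0)"
    by (intro DERIV_cmult hol3_has_pd[OF f u])
  moreover have "\<forall>\<^sub>F z in nhds 0. f (- u + (- z) *s axis i 1) = s * f (u + z *s axis i 1)"
  proof -
    have "((\<lambda>z. u + z *s axis i 1) \<longlongrightarrow> u + 0 *s axis i 1) (nhds 0)"
      by (intro tendsto_add tendsto_const tendsto_smult_axis filterlim_ident)
    then have "\<forall>\<^sub>F z in nhds 0. u + z *s axis i 1 \<in> S"
      using S u by (simp add: tendsto_def)
    then show ?thesis
    proof eventually_elim
      case (elim z)
      have "- u + (- z) *s axis i 1 = - (u + z *s axis i 1)" by (simp add: vec_eq_iff)
      then show ?case using r[OF elim] by simp
    qed
  qed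
  ultimately have "((\<lambda>z. s * f (u + z *s axis i 1)) has_field_derivative - pd i f (- u)) (at 0)"
    "((\<lambda>z. s * f (u + z *s axis i 1)) has_field_derivative s * pd i f u) (at 0)"
    by (simp_all add: DERIV_cong_ev)
  from DERIV_unique[OF this] have "pd i f (- u) = - (s * pd i f u)"
    by (metis minus_minus)
  then show ?thesis by simp
qed

lemma pd_pow_reflect:
  assumes S: "open S" "\<And>v. v \<in> S \<Longrightarrow> - v \<in> S" and f: "hol3 S f"
    and r: "\<And>v. v \<in> S \<Longrightarrow> f (- v) = s * f v" and u: "u \<in> S"
  shows "(pd i ^^ n) f (- u) = (- 1) ^ n * s * (pd i ^^ n) f u"
  using u
proof (induction n arbitrary: u)
  case (Suc n)
  then show ?case
    using pd_reflect[OF S hol3_pd_pow[OF S(1) f] Suc.IH Suc.prems, where i = i] by simp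
qed (simp add: r)

section \<open>The functions \<open>wp\<close> on the complement of the zeros of \<sigma>\<close>

locale odd_entire =
  fixes \<sigma> :: "complex^3 \<Rightarrow> complex"
  assumes hol_sigma: "hol3 UNIV \<sigma>"
    and odd_sigma: "\<sigma> (- u) = - \<sigma> u"
begin

definition Om :: "(complex^3) set" where "Om = {u. \<sigma> u \<noteq> 0}"

lemma open_Om: "open Om"
  unfolding Om_def using hol3_continuous[OF hol_sigma] by (simp add: open_Collect_neq)

lemma minus_Om: "u \<in> Om \<Longrightarrow> - u \<in> Om"
  by (simp add: Om_def odd_sigma)

text \<open>The sign is built in here once, so that every \<open>wp\<close> is an iterated partial
  derivative of some \<open>ld k\<close> without further signs.\<close>

definition ld :: "3 \<Rightarrow> complex^3 \<Rightarrow> complex" where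
  "ld k u = - (pd k \<sigma> u / \<sigma> u)"

lemma hol_ld: "hol3 Om (ld k)"
  unfolding ld_def using hol3_pd[OF open_UNIV hol_sigma] hol_sigma
  by (intro hol3_minus hol3_divide) (auto intro: hol3_subset simp: Om_def)

lemma pd_ld:
  assumes "u \<in> Om"
  shows "pd i (ld j) u = (pd i \<sigma> u * pd j \<sigma> u - \<sigma> u * pd i (pd j \<sigma>) u) / \<sigma> u ^ 2"
proof (rule pd_eqI)
  show "((\<lambda>z. ld j (u + z *s axis i 1)) has_field_derivative
      (pd i \<sigma> u * pd j \<sigma> u - \<sigma> u * pd i (pd j \<sigma>) u) / \<sigma> u ^ 2) (at 0)"
    unfolding ld_def using assms
    by (auto intro!: derivative_eq_intros hol3_has_pd[OF hol_sigma UNIV_I]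
        hol3_has_pd[OF hol3_pd[OF open_UNIV hol_sigma] UNIV_I] simp: Om_def power2_eq_square field_simps)
qed

lemma pd_ld_commute: "u \<in> Om \<Longrightarrow> pd i (ld j) u = pd j (ld i) u"
  using pd_commute[OF open_UNIV hol_sigma UNIV_I, where i = i and j = j and u = u]
  by (simp only: pd_ld mult.commute)

lemma ld_reflect: "u \<in> Om \<Longrightarrow> ld k (- u) = (- 1) * ld k u"
  using pd_reflect[OF open_UNIV UNIV_I hol_sigma, of "- 1" u k]
  by (simp add: ld_def odd_sigma)

text \<open>Writing the logarithmic derivatives by the number of indices \<open>1\<close>, \<open>2\<close>, \<open>3\<close> makes their
  symmetry automatic: \<open>\<wp>\<^sub>1\<^sub>2\<^sub>2\<^sub>3\<close> is \<open>wp 1 2 1\<close>. The value \<open>wp 0 0 0\<close> is junk.\<close>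

definition wp :: "nat \<Rightarrow> nat \<Rightarrow> nat \<Rightarrow> complex^3 \<Rightarrow> complex" where
  "wp a b c =
     (if a > 0 then (pd 1 ^^ (a - 1)) ((pd 2 ^^ b) ((pd 3 ^^ c) (ld 1)))
      else if b > 0 then (pd 2 ^^ (b - 1)) ((pd 3 ^^ c) (ld 2))
      else (pd 3 ^^ (c - 1)) (ld 3))"

lemma hol_wp: "hol3 Om (wp a b c)"
  unfolding wp_def by (auto intro!: hol3_pd_pow open_Om hol_ld)

text \<open>The innermost logarithmic derivative in \<open>wp\<close> belongs to the smallest index
  present. A derivative in direction 3 never changes that index, so operators only have to be moved
  past each other; \<open>pd2_wp\<close> and \<open>pd1_wp\<close> may also have to exchange the
  innermost \<open>ld k\<close>, which is done by \<open>pd_ld_commute\<close>. Positivity of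
  \<open>a + b + c\<close> excludes the junk value.\<close>

lemma pd3_wp: "a + b + c > 0 \<Longrightarrow> u \<in> Om \<Longrightarrow> pd 3 (wp a b c) u = wp a b (Suc c) u"
proof -
  assume n: "a + b + c > 0" and u: "u \<in> Om"
  have 2: "pd 3 ((pd 2 ^^ b) ((pd 3 ^^ c) (ld k))) v = (pd 2 ^^ b) ((pd 3 ^^ Suc c) (ld k)) v"
    if "v \<in> Om" for v k b
    using pd_pow_commute[OF open_Om hol3_pd_pow[OF open_Om hol_ld] that] by simp
  have 1: "pd 3 ((pd 1 ^^ a) ((pd 2 ^^ b) ((pd 3 ^^ c) (ld k)))) u =
      (pd 1 ^^ a) ((pd 2 ^^ b) ((pd 3 ^^ Suc c) (ld k))) u" for a k
    by (subst pd_pow_commute[OF open_Om hol3_pd_pow[OF open_Om hol3_pd_pow[OF open_Om hol_ld]] u])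
      (rule pd_pow_cong[OF open_Om 2 u])
  show ?thesis
  proof (cases "a > 0")
    case True then show ?thesis using 1 by (simp add: wp_def)
  next
    case a: False
    show ?thesis
    proof (cases "b > 0")
      case True then show ?thesis using a 2 u by (simp add: wp_def)
    next
      case False
      then obtain m where "c = Suc m" using n a by (cases c) auto
      then show ?thesis using a False by (simp add: wp_def)
    qed
  qed
qed

lemma pd2_wp: "a + b + c > 0 \<Longrightarrow> u \<in> Om \<Longrightarrow> pd 2 (wp a b c) u = wp a (Suc b) c u"
proof -
  assume n: "a + b + c > 0" and u: "u \<in> Om"
  show ?thesis
  proof (cases "a > 0")
    case True
    then show ?thesis
      using pd_pow_commute[OF open_Om hol3_pd_pow[OF open_Om hol3_pd_pow[OF open_Om hol_ld]] u]
      by (simp add: wp_def)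
  next
    case a: False
    show ?thesis
    proof (cases "b > 0")
      case True
      then obtain m where "b = Suc m" by (cases b) auto
      then show ?thesis using a by (simp add: wp_def)
    next
      case b: False
      then obtain m where m: "c = Suc m" using n a by (cases c) auto
      have "pd 2 ((pd 3 ^^ m) (ld 3)) u = (pd 3 ^^ m) (pd 2 (ld 3)) u"
        by (rule pd_pow_commute[OF open_Om hol_ld u])
      also have "\<dots> = (pd 3 ^^ m) (pd 3 (ld 2)) u"
        by (rule pd_pow_cong[OF open_Om pd_ld_commute u])
      finally show ?thesis using a b m by (simp add: wp_def funpow_swap1)
    qed
  qed
qed

lemma pd1_wp: "a + b + c > 0 \<Longrightarrow> u \<in> Om \<Longrightarrow> pd 1 (wp a b c) u = wp (Suc a) b c u"
proof -
  assume n: "a + b + c > 0" and u: "u \<in> Om"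
  show ?thesis
  proof (cases "a > 0")
    case True
    then obtain m where "a = Suc m" by (cases a) auto
    then show ?thesis by (simp add: wp_def)
  next
    case a: False
    have c1: "pd 1 ((pd 3 ^^ m) (ld k)) v = (pd 3 ^^ m) (pd k (ld 1)) v" if "v \<in> Om" for v m k
    proof -
      have "pd 1 ((pd 3 ^^ m) (ld k)) v = (pd 3 ^^ m) (pd 1 (ld k)) v"
        by (rule pd_pow_commute[OF open_Om hol_ld that])
      also have "\<dots> = (pd 3 ^^ m) (pd k (ld 1)) v"
        by (rule pd_pow_cong[OF open_Om pd_ld_commute that])
      finally show ?thesis .
    qed
    show ?thesis
    proof (cases "b > 0")
      case True
      then obtain m where m: "b = Suc m" by (cases b) auto
      have "pd 1 ((pd 2 ^^ m) ((pd 3 ^^ c) (ld 2))) u = (pd 2 ^^ m) (pd 1 ((pd 3 ^^ c) (ld 2))) u"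
        by (rule pd_pow_commute[OF open_Om hol3_pd_pow[OF open_Om hol_ld] u])
      also have "\<dots> = (pd 2 ^^ m) (pd 2 ((pd 3 ^^ c) (ld 1))) u"
        by (rule pd_pow_cong[OF open_Om _ u])
          (rule trans[OF c1 pd_pow_commute[OF open_Om hol_ld, symmetric]])
      finally show ?thesis using a m by (simp add: wp_def funpow_swap1)
    next
      case b: False
      then obtain m where m: "c = Suc m" using n a by (cases c) auto
      show ?thesis using c1[OF u, of m 3] a b m by (simp add: wp_def funpow_swap1)
    qed
  qed
qed

lemma wp_deriv:
  assumes "u \<in> Om" "0 < a + b + c"
  shows "((\<lambda>z. wp a b c (u + z *s axis 1 1)) has_field_derivative wp (Suc a) b c u) (at 0)"
    and "((\<lambda>z. wp a b c (u + z *s axis 2 1)) has_field_derivative wp a (Suc b) c u) (at 0)"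
    and "((\<lambda>z. wp a b c (u + z *s axis 3 1)) has_field_derivative wp a b (Suc c) u) (at 0)"
  unfolding pd1_wp[OF assms(2,1), symmetric] pd2_wp[OF assms(2,1), symmetric]
    pd3_wp[OF assms(2,1), symmetric]
  by (rule hol3_has_pd[OF hol_wp assms(1)])+

text \<open>Since \<sigma> is odd, its first derivatives are even and each \<open>ld k\<close> is
  odd; every further derivative changes the parity. This later splits each identity into an even and
  an odd one.\<close>

lemma wp_reflect:
  assumes "u \<in> Om" "0 < a + b + c"
  shows "wp a b c (- u) = (- 1) ^ (a + b + c) * wp a b c u"
proof -
  note h = hol3_pd_pow[OF open_Om]
  have r3: "(pd 3 ^^ n) (ld k) (- v) = (- 1) ^ Suc n * (pd 3 ^^ n) (ld k) v" if "v \<in> Om" for n k v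
    using pd_pow_reflect[OF open_Om minus_Om hol_ld ld_reflect that] by simp
  have r2: "(pd 2 ^^ m) ((pd 3 ^^ n) (ld k)) (- v) = (- 1) ^ Suc (m + n) * (pd 2 ^^ m) ((pd 3 ^^ n) (ld k)) v"
    if "v \<in> Om" for m n k v
    using pd_pow_reflect[OF open_Om minus_Om h[OF hol_ld] r3 that] by (simp add: power_add)
  have r1: "(pd 1 ^^ l) ((pd 2 ^^ m) ((pd 3 ^^ n) (ld k))) (- u) =
      (- 1) ^ Suc (l + m + n) * (pd 1 ^^ l) ((pd 2 ^^ m) ((pd 3 ^^ n) (ld k))) u" for l m n k
    using pd_pow_reflect[OF open_Om minus_Om h[OF h[OF hol_ld]] r2 assms(1)] by (simp add: power_add)
  show ?thesis
  proof (cases "a > 0")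
    case True
    then obtain m where "a = Suc m" by (cases a) auto
    then show ?thesis using r1[of m b c 1] by (simp add: wp_def)
  next
    case a: False
    show ?thesis
    proof (cases "b > 0")
      case True
      then obtain m where "b = Suc m" by (cases b) auto
      then show ?thesis using a r2[OF assms(1), of m c 2] by (simp add: wp_def)
    next
      case False
      then obtain m where "c = Suc m" using assms a by (cases c) auto
      then show ?thesis using a False r3[OF assms(1), of m 3] by (simp add: wp_def)
    qed
  qed
qed

lemma wp_unit:
  "wp (of_bool (k = 1)) (of_bool (k = 2)) (of_bool (k = 3)) = ld k"
  using exhaust_3[of k] by (auto simp: wp_def)

lemma pd_wp:
  assumes "0 < a + b + c" "u \<in> Om"
  shows "pd i (wp a b c) u = wp (of_bool (i = 1) + a) (of_bool (i = 2) + b) (of_bool (i = 3) + c) u"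
  using exhaust_3[of i] pd1_wp[OF assms] pd2_wp[OF assms] pd3_wp[OF assms] by auto

lemma unit_pos: "0 < of_bool (k = 1) + of_bool (k = 2) + of_bool (k = (3::3)) + (n::nat)"
  using exhaust_3[of k] by auto

lemma pd_minus: "hol3 S f \<Longrightarrow> u \<in> S \<Longrightarrow> pd i (\<lambda>v. - f v) u = - pd i f u"
  by (intro pd_eqI DERIV_minus hol3_has_pd)

lemma wp2_eq:
  assumes "u \<in> Om"
  shows "wp2 \<sigma> u i j = wp (of_bool (i = 1) + of_bool (j = 1)) (of_bool (i = 2) + of_bool (j = 2))
      (of_bool (i = 3) + of_bool (j = 3)) u"
proof -
  have "wp2 \<sigma> u i j = pd i (ld j) u"
    using pd_minus[OF hol_ld assms, of i j] by (simp add: wp2_def ld_def)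
  then show ?thesis
    using pd_wp[OF _ assms, of "of_bool (j = 1)" "of_bool (j = 2)" "of_bool (j = 3)" i] unit_pos[of j 0]
    by (simp add: wp_unit)
qed

lemma wp3_eq:
  assumes "u \<in> Om"
  shows "wp3 \<sigma> u i j k = wp (of_bool (i = 1) + (of_bool (j = 1) + of_bool (k = 1)))
      (of_bool (i = 2) + (of_bool (j = 2) + of_bool (k = 2)))
      (of_bool (i = 3) + (of_bool (j = 3) + of_bool (k = 3))) u"
proof -
  have 1: "pd j (\<lambda>v. pd k \<sigma> v / \<sigma> v) v = - wp (of_bool (j = 1) + of_bool (k = 1))
      (of_bool (j = 2) + of_bool (k = 2)) (of_bool (j = 3) + of_bool (k = 3)) v" if "v \<in> Om" for v
    using wp2_eq[OF that, of j k] unfolding wp2_def by (metis minus_minus)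
  have "pd i (pd j (\<lambda>v. pd k \<sigma> v / \<sigma> v)) u = pd i (\<lambda>v. - wp (of_bool (j = 1) + of_bool (k = 1))
      (of_bool (j = 2) + of_bool (k = 2)) (of_bool (j = 3) + of_bool (k = 3)) v) u"
    by (rule pd_cong[OF open_Om assms 1])
  also have "\<dots> = - pd i (wp (of_bool (j = 1) + of_bool (k = 1))
      (of_bool (j = 2) + of_bool (k = 2)) (of_bool (j = 3) + of_bool (k = 3))) u"
    by (rule pd_minus[OF hol_wp assms])
  finally show ?thesis
    unfolding wp3_def
    using pd_wp[OF _ assms, of "of_bool (j = 1) + of_bool (k = 1)" "of_bool (j = 2) + of_bool (k = 2)"
        "of_bool (j = 3) + of_bool (k = 3)" i] unit_pos[of j "of_bool (k = 1) + of_bool (k = 2) + of_bool (k = 3)"]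
    by (simp add: add_ac)
qed

section \<open>Extending, cancelling and differentiating identities\<close>

lemma Om_identity:
  assumes "hol3 Om F" "open G" "G \<noteq> {}" "G \<subseteq> Om" "\<And>u. u \<in> G \<Longrightarrow> F u = 0" "u \<in> Om"
  shows "F u = 0"
  using hol3_identity[OF hol_sigma, of F G u] assms by (auto simp: Om_def)

text \<open>Where \<open>F\<close> is nonzero, a nonempty open set, \<open>H\<close> must vanish,
  and the identity theorem spreads this over \<open>Om\<close>. A factor that is not identically
  zero may thus be cancelled even at its zeros.\<close>

lemma Om_no_zero_divisors:
  assumes "hol3 Om F" "hol3 Om H" "\<And>u. u \<in> Om \<Longrightarrow> F u * H u = 0" "v \<in> Om" "F v \<noteq> 0" "u \<in> Om"
  shows "H u = 0"
proof (rule Om_identity[OF assms(2) _ _ _ _ assms(6)])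
  show "open {u \<in> Om. F u \<noteq> 0}"
  proof -
    have "{u \<in> Om. F u \<noteq> 0} = Om \<inter> F -` (- {0})" by blast
    then show ?thesis
      using continuous_open_preimage[OF hol3_continuous[OF assms(1)] open_Om, of "- {0}"] by (simp add: open_Compl)
  qed
  show "{u \<in> Om. F u \<noteq> 0} \<noteq> {}" using assms by auto
  show "\<And>w. w \<in> {u \<in> Om. F u \<noteq> 0} \<Longrightarrow> H w = 0" using assms(3) by fastforce
qed auto

lemma Om_differentiate:
  assumes "\<And>u. u \<in> Om \<Longrightarrow> F u = 0" "u \<in> Om"
    and "((\<lambda>z. F (u + z *s axis i 1)) has_field_derivative D) (at 0)"
  shows "D = 0"
proof -
  have "pd i F u = pd i (\<lambda>_. 0) u" by (rule pd_cong[OF open_Om assms(2,1)])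
  also have "\<dots> = 0" by (rule pd_eqI) simp
  finally show ?thesis using pd_eqI[OF assms(3)] by simp
qed

end

section \<open>A chart at infinity\<close>

lemma has_derivative_componentsI:
  fixes f :: "'a::real_normed_vector \<Rightarrow> 'b::euclidean_space ^ 'n"
  assumes "\<And>i. ((\<lambda>x. f x $ i) has_derivative (\<lambda>h. f' h $ i)) (at a within S)"
  shows "(f has_derivative f') (at a within S)"
proof (subst has_derivative_componentwise_within, intro ballI)
  fix b :: "'b ^ 'n" assume "b \<in> Basis"
  then obtain i k where b: "b = axis i k" by (auto simp: Basis_vec_def)
  show "((\<lambda>x. f x \<bullet> b) has_derivative (\<lambda>h. f' h \<bullet> b)) (at a within S)"
    unfolding b inner_axis by (rule has_derivative_inner_left[OF assms])
qed

definition curve_poly :: "(nat \<Rightarrow> complex) \<Rightarrow> complex \<Rightarrow> complex" where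
  "curve_poly lam t = 1 + lam 3 * t^3 + lam 2 * t^6 + lam 1 * t^9 + lam 0 * t^12"

text \<open>In the local parameter \<open>t\<close> with \<open>x = t\<^sup>-\<^sup>3\<close> and \<open>y = Y(t) t\<^sup>-\<^sup>4\<close> at \<open>\<infinity>\<close>, the form
  \<open>du\<close> is \<open>du_germ Y t dt\<close>.\<close>

definition du_germ :: "(complex \<Rightarrow> complex) \<Rightarrow> complex \<Rightarrow> complex^3" where
  "du_germ Y t = - vector [t^4 / (Y t)^2, t / (Y t)^2, 1 / Y t]"

lemma du_germ_nth [simp]:
  "du_germ Y t $ 1 = - (t^4 / (Y t)^2)" "du_germ Y t $ 2 = - (t / (Y t)^2)" "du_germ Y t $ 3 = - (1 / Y t)"
  by (simp_all add: du_germ_def)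

locale chart =
  fixes lam :: "nat \<Rightarrow> complex" and \<rho> :: real and Y :: "complex \<Rightarrow> complex" and W :: "complex \<Rightarrow> complex^3"
  assumes \<rho>: "\<rho> > 0"
    and holY: "Y holomorphic_on ball 0 \<rho>"
    and Y3: "\<And>t. t \<in> ball 0 \<rho> \<Longrightarrow> Y t ^ 3 = curve_poly lam t"
    and Y_nonzero: "\<And>t. t \<in> ball 0 \<rho> \<Longrightarrow> Y t \<noteq> 0"
    and Y_0: "Y 0 = 1"
    and W_deriv: "\<And>t i. t \<in> ball 0 \<rho> \<Longrightarrow> ((\<lambda>t. W t $ i) has_field_derivative du_germ Y t $ i) (at t)"
    and W_0: "W 0 = 0"

text \<open>On a small disc \<open>curve_poly\<close> differs from 1 by less than 1, hence has
  positive real part, and the principal logarithm gives a holomorphic cube root. The components of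
  \<open>W\<close> are primitives on that disc, normalised at its centre.\<close>

lemma chart_exists: "\<exists>\<rho> Y W. chart lam \<rho> Y W"
proof -
  have "isCont (curve_poly lam) 0" unfolding curve_poly_def by (intro continuous_intros)
  then have "\<exists>d>0. \<forall>t. dist t 0 < d \<longrightarrow> dist (curve_poly lam t) (curve_poly lam 0) < 1"
    unfolding continuous_at_eps_delta by (metis zero_less_one)
  moreover have "curve_poly lam 0 = 1" by (simp add: curve_poly_def)
  ultimately obtain \<rho> where \<rho>: "\<rho> > 0" "\<And>t. norm t < \<rho> \<Longrightarrow> norm (curve_poly lam t - 1) < 1"
    by (auto simp: dist_norm)
  let ?B = "ball 0 \<rho> :: complex set"
  have Re: "Re (curve_poly lam t) > 0" if "t \<in> ?B" for t
    using \<rho>(2)[of t] that abs_Re_le_cmod[of "curve_poly lam t - 1"] by auto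
  define Y where "Y = (\<lambda>t. exp (Ln (curve_poly lam t) / 3))"
  have hol: "Y holomorphic_on ?B"
  proof -
    have "curve_poly lam holomorphic_on ?B" unfolding curve_poly_def by (intro holomorphic_intros)
    moreover have "curve_poly lam t \<notin> \<real>\<^sub>\<le>\<^sub>0" if "t \<in> ?B" for t
      using Re[OF that] by (simp add: complex_nonpos_Reals_iff)
    ultimately show ?thesis unfolding Y_def by (intro holomorphic_intros) auto
  qed
  have nz: "Y t \<noteq> 0" for t by (simp add: Y_def)
  have Y3: "Y t ^ 3 = curve_poly lam t" if "t \<in> ?B" for t
  proof -
    have "Y t ^ 3 = exp (Ln (curve_poly lam t))"
      by (simp add: Y_def flip: exp_of_nat_mult)
    moreover have "curve_poly lam t \<noteq> 0" using Re[OF that] by auto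
    ultimately show ?thesis by simp
  qed
  have prim: "\<exists>g. \<forall>t\<in>?B. (g has_field_derivative du_germ Y t $ i) (at t within ?B)" for i
  proof -
    have "(\<lambda>t. du_germ Y t $ i) holomorphic_on ?B"
      using exhaust_3[of i] nz by (auto intro!: holomorphic_intros hol)
    then show ?thesis
      by (rule holomorphic_convex_primitive'[OF convex_ball open_ball]) blast
  qed
  have "\<exists>g. \<forall>t\<in>?B. (g has_field_derivative du_germ Y t $ i) (at t)" for i
  proof -
    have "at t within ?B = at t" if "t \<in> ?B" for t using that by (rule at_within_open) simp
    then show ?thesis using prim[of i] by auto
  qed
  then have "\<forall>i. \<exists>g. \<forall>t\<in>?B. (g has_field_derivative du_germ Y t $ i) (at t)" by blast
  from choice[OF this] obtain g
    where g: "\<And>i t. t \<in> ?B \<Longrightarrow> (g i has_field_derivative du_germ Y t $ i) (at t)" by blast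
  define W where "W = (\<lambda>t. \<chi> i. g i t - g i 0)"
  have "chart lam \<rho> Y W"
  proof
    show "((\<lambda>t. W t $ i) has_field_derivative du_germ Y t $ i) (at t)" if "t \<in> ?B" for t i
      using DERIV_diff[OF g[OF that] DERIV_const] by (simp add: W_def)
    show "Y 0 = 1" by (simp add: Y_def curve_poly_def)
    show "W 0 = 0" by (simp add: W_def vec_eq_iff)
  qed (use \<rho> hol Y3 nz in auto)
  then show ?thesis by blast
qed

context chart
begin

definition cx :: "complex \<Rightarrow> complex" where "cx t = 1 / t^3"
definition cy :: "complex \<Rightarrow> complex" where "cy t = Y t / t^4"

lemma on_curve: "t \<in> ball 0 \<rho> \<Longrightarrow> t \<noteq> 0 \<Longrightarrow> cy t ^ 3 = poly (quartic lam) (cx t)"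
  unfolding cy_def cx_def quartic_def
proof -
  assume t: "t \<in> ball 0 \<rho>" "t \<noteq> 0"
  have p: "t^12 = t^3 * t^9" "t^12 = t^6 * t^6" "t^12 = t^9 * t^3" "(t^4)^3 = t^12" "t^9 = t^3 * t^6"
    "t^6 = t^3 * t^3" by (simp_all flip: power_add power_mult)
  have "(Y t / t^4)^3 = curve_poly lam t / t^12" by (simp add: power_divide p(4) Y3[OF t(1)])
  also have "\<dots> = poly [:lam 0, lam 1, lam 2, lam 3, 1:] (1 / t^3)"
    using t(2) unfolding curve_poly_def p(1) p(5) p(6) by (simp add: divide_simps)
  finally show "(Y t / t^4)^3 = poly [:lam 0, lam 1, lam 2, lam 3, 1:] (1 / t^3)" .
qed

section \<open>Abelian integrals along radial paths in the chart\<close>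

lemma C1_along_line:
  assumes h: "h holomorphic_on A" and A: "open A" "\<And>s. s \<in> S \<Longrightarrow> of_real s * t \<in> A"
  shows "(\<lambda>s. h (of_real s * t)) C1_differentiable_on S"
    and "s \<in> S \<Longrightarrow> ((\<lambda>s. h (of_real s * t)) has_vector_derivative t * deriv h (of_real s * t)) (at s)"
proof -
  have *: "((\<lambda>s. h (of_real s * t)) has_vector_derivative t * deriv h (of_real s * t)) (at s)" if "s \<in> S" for s
  proof -
    have "((\<lambda>z. h (z * t)) has_field_derivative deriv h (of_real s * t) * t) (at (of_real s))"
      by (rule DERIV_chain2[OF holomorphic_derivI[OF h A(1) A(2)[OF that]] DERIV_cmult_right[OF DERIV_ident, simplified]])
    from has_vector_derivative_real_field[OF this] show ?thesis by (simp add: mult.commute)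
  qed
  have "continuous_on S (\<lambda>s. t * deriv h (of_real s * t))"
    by (rule continuous_on_mult_left, rule continuous_on_compose2[OF
          holomorphic_on_imp_continuous_on[OF holomorphic_deriv[OF h A(1)]]])
      (use A(2) in \<open>auto intro!: continuous_on_mult_right continuous_on_of_real continuous_on_id\<close>)
  with * show "(\<lambda>s. h (of_real s * t)) C1_differentiable_on S"
    unfolding C1_differentiable_on_def by (intro exI[of _ "\<lambda>s. t * deriv h (of_real s * t)"]) simp
  show "s \<in> S \<Longrightarrow> ((\<lambda>s. h (of_real s * t)) has_vector_derivative t * deriv h (of_real s * t)) (at s)"
    by (rule *)
qed

lemma W_vector_derivative:
  assumes "of_real s * t \<in> ball 0 \<rho>"
  shows "((\<lambda>s. W (of_real s * t)) has_vector_derivative t *s du_germ Y (of_real s * t)) (at s)"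
proof -
  have "((\<lambda>s. W (of_real s * t) $ i) has_vector_derivative t * du_germ Y (of_real s * t) $ i) (at s)" for i
  proof -
    have "((\<lambda>z. W (z * t) $ i) has_field_derivative du_germ Y (of_real s * t) $ i * t) (at (of_real s))"
      by (rule DERIV_chain2[OF W_deriv[OF assms] DERIV_cmult_right[OF DERIV_ident, simplified]])
    from has_vector_derivative_real_field[OF this] show ?thesis by (simp add: mult.commute)
  qed
  then have "((\<lambda>s. W (of_real s * t) $ i) has_derivative
      (\<lambda>h. (h *\<^sub>R (t *s du_germ Y (of_real s * t))) $ i)) (at s)" for i
    unfolding has_vector_derivative_def by simp
  then show ?thesis
    unfolding has_vector_derivative_def by (rule has_derivative_componentsI)
qed

lemma cx_deriv: "t \<noteq> 0 \<Longrightarrow> deriv cx t = - 3 / t^4"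
proof (rule DERIV_imp_deriv)
  assume t: "t \<noteq> 0"
  have "((\<lambda>t. 1 / t^3) has_field_derivative (0 * t^3 - 1 * (3 * t^2)) / (t^3 * t^3)) (at t)"
    using t by (auto intro!: derivative_eq_intros)
  moreover have "(0 * t^3 - 1 * (3 * t^2)) / (t^3 * t^3) = - 3 / t^4"
    using t by (simp add: divide_simps eval_nat_numeral)
  ultimately show "(cx has_field_derivative - 3 / t^4) (at t)" by (simp add: cx_def[abs_def])
qed

text \<open>The radial path \<open>s * t\<close> in the chart starts at infinity as \<open>s\<close>
  tends to 0. By the fundamental theorem its integral over the part from \<open>a\<close> to 1 is
  \<open>W t - W (a * t)\<close>, which tends to \<open>W t\<close> because \<open>W 0 = 0\<close>.
  The path meets no branch point, as \<open>Y\<close> has no zeros on the disc.\<close>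

lemma W_abel:
  assumes t: "t \<in> ball 0 \<rho>" "t \<noteq> 0"
  shows "W t \<in> abel_values lam (Some (cx t, cy t))"
proof -
  let ?X = "\<lambda>s. cx (of_real s * t)" and ?Y = "\<lambda>s. cy (of_real s * t)"
  let ?A = "ball 0 \<rho> - {0} :: complex set"
  have A: "open ?A" by auto
  have st: "of_real s * t \<in> ?A" if "s \<in> {a..1}" "a > 0" for s a :: real
  proof -
    have "norm (of_real s * t) \<le> norm t"
      using that by (simp add: norm_mult mult_left_le_one_le)
    then show ?thesis using that t by auto
  qed
  have hx: "cx holomorphic_on ?A" unfolding cx_def by (intro holomorphic_intros) auto
  have hy: "cy holomorphic_on ?A" unfolding cy_def
    by (intro holomorphic_intros holomorphic_on_subset[OF holY]) auto
  have ap: "affine_path lam a ?X ?Y" if "a > 0" for a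
    unfolding affine_path_def affine_curve_def
  proof (intro conjI ballI)
    show "?X piecewise_C1_differentiable_on {a..1}"
      by (rule C1_differentiable_imp_piecewise[OF C1_along_line(1)[OF hx A]]) (rule st[OF _ that])
    show "?Y piecewise_C1_differentiable_on {a..1}"
      by (rule C1_differentiable_imp_piecewise[OF C1_along_line(1)[OF hy A]]) (rule st[OF _ that])
    show "(?X s, ?Y s) \<in> {(x, y). y ^ 3 = poly (quartic lam) x}" if "s \<in> {a..1}" for s
      using on_curve st[OF that \<open>a > 0\<close>] by simp
  qed
  have du: "du_along lam ?X ?Y s = t *s du_germ Y (of_real s * t)" if "s \<in> {a..1}" "a > 0" for s a
  proof -
    define z where "z = of_real s * t"
    have z: "z \<in> ball 0 \<rho>" "z \<noteq> 0" using st[OF that] by (auto simp: z_def)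
    have "vector_derivative ?X (at s) = t * deriv cx z"
      using vector_derivative_at[OF C1_along_line(2)[OF hx A st[OF _ that(2)] that(1)]] by (simp add: z_def)
    then have vd: "vector_derivative ?X (at s) = - 3 * t / z^4" using cx_deriv[OF z(2)] by simp
    define y where "y = Y z"
    have y: "y \<noteq> 0" using Y_nonzero[OF z(1)] by (simp add: y_def)
    have "cy z \<noteq> 0" using y z(2) by (simp add: cy_def y_def)
    moreover have c0: "- 3 * t / z^4 / (3 * (y / z^4)^2) = - (t * (z^4 / y^2))"
    proof -
      have "- 3 * t / w / (3 * (y / w)^2) = - (t * (w / y^2))" if "w \<noteq> 0" for w
        using that y by (simp add: power2_eq_square)
      then show ?thesis using z(2) by simp
    qed
    moreover have "z^4 = z * z^3" by (simp add: eval_nat_numeral)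
    then have "z^4 / y^2 * (1 / z^3) = z / y^2" "z^4 / y^2 * (y / z^4) = 1 / y"
      using z(2) y by (simp_all add: power2_eq_square)
    ultimately show ?thesis
      unfolding du_along_def vd z_def[symmetric] cy_def y_def[symmetric]
      by (simp only: not_False_eq_True if_True c0 vec_eq_iff forall_3 varphi_def cx_def vector_3 vector_scalar_mult_def
          vec_lambda_beta du_germ_nth y_def[symmetric] mult.assoc minus_mult_left mult_1_right mult_minus_right)
  qed
  have int: "integral {a..1} (du_along lam ?X ?Y) = W t - W (of_real a * t)" if "a \<in> {0<..1}" for a
  proof -
    have "(du_along lam ?X ?Y has_integral W (of_real 1 * t) - W (of_real a * t)) {a..1}"
    proof (rule fundamental_theorem_of_calculus)
      fix s assume s: "s \<in> {a..1}"
      show "((\<lambda>s. W (of_real s * t)) has_vector_derivative du_along lam ?X ?Y s) (at s within {a..1})"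
        using W_vector_derivative[of s t] st[OF s] that du[OF s]
        by (auto intro: has_vector_derivative_at_within)
    qed (use that in auto)
    then show ?thesis by (simp add: integral_unique)
  qed
  have "((\<lambda>a. W t - W (of_real a * t)) \<longlongrightarrow> W t - W (of_real 0 * t)) (at_right 0)"
  proof (rule tendsto_diff[OF tendsto_const])
    have "isCont (\<lambda>s. W (of_real s * t)) 0"
      using has_vector_derivative_continuous[OF W_vector_derivative[of 0 t]] \<rho> by simp
    then show "((\<lambda>a. W (of_real a * t)) \<longlongrightarrow> W (of_real 0 * t)) (at_right 0)"
      unfolding continuous_at by (auto intro: tendsto_mono[OF at_le])
  qed
  then have lim0: "((\<lambda>a. W t - W (of_real a * t)) \<longlongrightarrow> W t) (at_right 0)" by (simp add: W_0)
  have lim: "((\<lambda>a. integral {a..1} (du_along lam ?X ?Y)) \<longlongrightarrow> W t) (at_right 0)"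
  proof (rule Lim_transform_eventually[OF lim0])
    have "\<forall>\<^sub>F a in at_right (0::real). a \<in> {0<..<1}"
      by (rule eventually_at_right_real) simp
    then show "\<forall>\<^sub>F a in at_right 0. W t - W (of_real a * t) = integral {a..1} (du_along lam ?X ?Y)"
      by eventually_elim (simp add: int)
  qed
  have inf: "filterlim ?X at_infinity (at_right 0)"
  proof -
    have "((\<lambda>s::real. (of_real s * t)^3) \<longlongrightarrow> (of_real 0 * t)^3) (at_right 0)"
      by (intro tendsto_intros)
    then have "filterlim (\<lambda>s::real. (of_real s * t)^3) (at 0) (at_right 0)"
      using t(2) by (auto simp: filterlim_at eventually_at_filter)
    from filterlim_compose[OF filterlim_inverse_at_infinity this]
    show ?thesis by (simp add: cx_def divide_inverse)
  qed
  show ?thesis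
    unfolding abel_values.simps mem_Collect_eq
    by (rule exI[of _ ?X], rule exI[of _ ?Y]) (use ap inf lim in auto)
qed

section \<open>The Abel map of three points near infinity\<close>

definition W3 :: "complex^3 \<Rightarrow> complex^3" where
  "W3 \<tau> = (\<Sum>k\<in>UNIV. W (\<tau> $ k))"

definition dW3 :: "complex^3 \<Rightarrow> complex^3^3" where
  "dW3 \<tau> = (\<chi> i k. du_germ Y (\<tau> $ k) $ i)"

text \<open>The nonzero determinant serves twice: it makes \<open>W3\<close> an open map, and it
  expresses that 1, x, y are linearly independent on the three points.\<close>

definition good :: "(complex^3) set" where
  "good = {\<tau>. (\<forall>k. \<tau> $ k \<in> ball 0 \<rho> - {0}) \<and> det (dW3 \<tau>) \<noteq> 0}"

lemma continuous_du_germ: "continuous_on (ball 0 \<rho>) (\<lambda>t. du_germ Y t $ i)"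
proof -
  have Y: "continuous_on (ball 0 \<rho>) Y" by (rule holomorphic_on_imp_continuous_on[OF holY])
  have "continuous_on (ball 0 \<rho>) (\<lambda>t. - (t^4 / (Y t)^2))" "continuous_on (ball 0 \<rho>) (\<lambda>t. - (t / (Y t)^2))"
    "continuous_on (ball 0 \<rho>) (\<lambda>t. - (1 / Y t))"
    using Y_nonzero by (auto intro!: continuous_on_minus continuous_on_divide continuous_on_power
        continuous_on_id continuous_on_const Y)
  then show ?thesis using exhaust_3[of i] by (elim disjE) (simp_all only: du_germ_nth)
qed

lemma W3_deriv:
  assumes "\<And>k. \<tau> $ k \<in> ball 0 \<rho>"
  shows "(W3 has_derivative ((*v) (dW3 \<tau>))) (at \<tau>)"
proof -
  have "((\<lambda>\<tau>. W3 \<tau> $ i) has_derivative (\<lambda>h. (dW3 \<tau> *v h) $ i)) (at \<tau>)" for i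
  proof -
    have "((\<lambda>\<tau>::complex^3. W (\<tau> $ k) $ i) has_derivative (\<lambda>h. du_germ Y (\<tau> $ k) $ i * h $ k)) (at \<tau>)" for k
    proof -
      have "((\<lambda>\<tau>::complex^3. \<tau> $ k) has_derivative (\<lambda>h. h $ k)) (at \<tau>)"
        by (intro bounded_linear_imp_has_derivative bounded_linear_vec_nth)
      from has_derivative_compose[OF this W_deriv[OF assms, of i k, unfolded has_field_derivative_def]]
      show ?thesis by simp
    qed
    then have "((\<lambda>\<tau>::complex^3. \<Sum>k\<in>UNIV. W (\<tau> $ k) $ i) has_derivative
        (\<lambda>h. \<Sum>k\<in>UNIV. du_germ Y (\<tau> $ k) $ i * h $ k)) (at \<tau>)"
      by (rule has_derivative_sum)
    then show ?thesis by (simp add: W3_def dW3_def matrix_vector_mult_def)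
  qed
  then show ?thesis by (rule has_derivative_componentsI)
qed

lemma open_good: "open good"
proof -
  let ?B = "{\<tau>::complex^3. \<forall>k. \<tau> $ k \<in> ball 0 \<rho> - {0}}"
  have eq: "?B = (\<Inter>k. (\<lambda>\<tau>. \<tau> $ k) -` (ball 0 \<rho> - {0}))" by auto
  have B: "open ?B" unfolding eq
    by (intro open_INT ballI finite open_vimage open_delete open_ball
        linear_continuous_on bounded_linear_vec_nth)
  have c: "continuous_on ?B (\<lambda>\<tau>. du_germ Y (\<tau> $ k) $ i)" for i k
    by (rule continuous_on_compose2[OF continuous_du_germ[of i], of ?B "\<lambda>\<tau>. \<tau> $ k"])
      (auto intro: linear_continuous_on bounded_linear_vec_nth)
  have "continuous_on ?B (\<lambda>\<tau>. det (dW3 \<tau>))"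
    unfolding det_3 dW3_def vec_lambda_beta
    by (intro c continuous_on_add continuous_on_diff continuous_on_mult)
  from continuous_open_preimage[OF this B, of "- {0}"]
  have "open (?B \<inter> (\<lambda>\<tau>. det (dW3 \<tau>)) -` (- {0}))" by (simp add: open_Compl)
  also have "?B \<inter> (\<lambda>\<tau>. det (dW3 \<tau>)) -` (- {0}) = good" by (auto simp: good_def)
  finally show ?thesis .
qed

text \<open>Up to a scalar, the determinant at the parameters \<open>\<epsilon>, 2\<epsilon>, 3\<epsilon>\<close> tends to the
  determinant of the rows \<open>(1, 16, 81), (1, 2, 3), (1, 1, 1)\<close>.\<close>

lemma good_nonempty: "good \<noteq> {}"
proof -
  define d where "d = (\<lambda>\<epsilon>. let p = Y \<epsilon>; q = Y (2 * \<epsilon>); r = Y (3 * \<epsilon>) in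
     1 / p^2 * (2 / q^2) * (1 / r) + 16 / q^2 * (3 / r^2) * (1 / p) + 81 / r^2 * (1 / p^2) * (1 / q)
     - 1 / p^2 * (3 / r^2) * (1 / q) - 16 / q^2 * (1 / p^2) * (1 / r) - 81 / r^2 * (2 / q^2) * (1 / p))"
  have "isCont Y 0" using holomorphic_on_imp_continuous_on[OF holY] \<rho>
    by (simp add: continuous_on_eq_continuous_at)
  then have Yl: "(Y \<longlongrightarrow> 1) (nhds 0)" using Y_0 tendsto_at_iff_tendsto_nhds[of Y 0] by (simp add: continuous_at)
  have Yk: "((\<lambda>\<epsilon>. Y (c * \<epsilon>)) \<longlongrightarrow> 1) (nhds 0)" for c
  proof -
    have "((\<lambda>\<epsilon>. c * \<epsilon>) \<longlongrightarrow> c * 0) (nhds 0)" by (intro tendsto_mult tendsto_const filterlim_ident)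
    then have "filterlim (\<lambda>\<epsilon>. c * \<epsilon>) (nhds 0) (nhds 0)" by simp
    from filterlim_compose[OF Yl this] show ?thesis .
  qed
  have "(d \<longlongrightarrow> 1 / 1^2 * (2 / 1^2) * (1 / 1) + 16 / 1^2 * (3 / 1^2) * (1 / 1) + 81 / 1^2 * (1 / 1^2) * (1 / 1)
     - 1 / 1^2 * (3 / 1^2) * (1 / 1) - 16 / 1^2 * (1 / 1^2) * (1 / 1) - 81 / 1^2 * (2 / 1^2) * (1 / 1)) (nhds 0)"
    unfolding d_def Let_def by (intro tendsto_intros Yl Yk) auto
  then have "(d \<longlongrightarrow> - 50) (nhds 0)" by simp
  then have "\<forall>\<^sub>F \<epsilon> in nhds 0. d \<epsilon> \<in> - {0}"
    by (rule topological_tendstoD) (auto simp: open_Compl)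
  then obtain e where e: "e > 0" "\<And>\<epsilon>. norm \<epsilon> < e \<Longrightarrow> d \<epsilon> \<noteq> 0"
    by (auto simp: eventually_nhds_metric dist_norm)
  define \<epsilon> where "\<epsilon> = (of_real (min (e / 2) (\<rho> / 4)) :: complex)"
  have \<epsilon>: "\<epsilon> \<noteq> 0" "norm \<epsilon> < e" "norm \<epsilon> \<le> \<rho> / 4" using e \<rho> by (auto simp: \<epsilon>_def min_def)
  define \<tau> where "\<tau> = (vector [\<epsilon>, 2 * \<epsilon>, 3 * \<epsilon>] :: complex^3)"
  have nz: "Y \<epsilon> \<noteq> 0" "Y (2 * \<epsilon>) \<noteq> 0" "Y (3 * \<epsilon>) \<noteq> 0"
    using \<epsilon> \<rho> by (auto intro!: Y_nonzero simp: norm_mult)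
  \<comment> \<open>The three rows of the Jacobian carry the factors \<open>- \<epsilon>^4\<close>,
    \<open>- \<epsilon>\<close> and -1; what remains is \<open>d \<epsilon>\<close>, with limit
    -50.\<close>
  have "det (dW3 \<tau>) = - (\<epsilon> ^ 5) * d \<epsilon>"
  proof -
    define p q r where pqr: "p = inverse (Y \<epsilon>)" "q = inverse (Y (2 * \<epsilon>))" "r = inverse (Y (3 * \<epsilon>))"
    have c: "\<tau> $ 1 = \<epsilon>" "\<tau> $ 2 = 2 * \<epsilon>" "\<tau> $ 3 = 3 * \<epsilon>" by (simp_all add: \<tau>_def)
    have "d \<epsilon> = p^2 * (2 * q^2) * r + 16 * q^2 * (3 * r^2) * p + 81 * r^2 * p^2 * q
     - p^2 * (3 * r^2) * q - 16 * q^2 * p^2 * r - 81 * r^2 * (2 * q^2) * p"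
      by (simp add: d_def Let_def pqr divide_inverse power_inverse)
    moreover have "det (dW3 \<tau>) =
        (- (\<epsilon>^4 * p^2)) * (- (2 * \<epsilon> * q^2)) * (- r) + (- ((2 * \<epsilon>)^4 * q^2)) * (- (3 * \<epsilon> * r^2)) * (- p)
        + (- ((3 * \<epsilon>)^4 * r^2)) * (- (\<epsilon> * p^2)) * (- q) - (- (\<epsilon>^4 * p^2)) * (- (3 * \<epsilon> * r^2)) * (- q)
        - (- ((2 * \<epsilon>)^4 * q^2)) * (- (\<epsilon> * p^2)) * (- r) - (- ((3 * \<epsilon>)^4 * r^2)) * (- (2 * \<epsilon> * q^2)) * (- p)"
      unfolding det_3 dW3_def vec_lambda_beta c du_germ_nth
      by (simp only: pqr divide_inverse power_inverse mult_1)
    ultimately show ?thesis by algebra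
  qed
  then have "\<tau> \<in> good"
    using \<epsilon> e(2)[OF \<epsilon>(2)] \<rho> by (auto simp: good_def \<tau>_def forall_3 norm_mult)
  then show ?thesis by blast
qed

text \<open>The inverse of the Jacobian supplies the right inverse of the derivative that Sussmann's
  open mapping theorem asks for.\<close>

lemma open_W3_image:
  assumes "open T" "T \<subseteq> good"
  shows "open (W3 ` T)"
proof -
  have "W3 \<tau> \<in> interior (W3 ` T)" if \<tau>: "\<tau> \<in> T" for \<tau>
  proof -
    have "invertible (dW3 \<tau>)" using assms \<tau> by (auto simp: good_def invertible_det_nz)
    then obtain B where B: "dW3 \<tau> ** B = mat 1" unfolding invertible_def by blast
    have tb: "\<tau>' $ k \<in> ball 0 \<rho>" if "\<tau>' \<in> T" for \<tau>' k
      using assms that by (auto simp: good_def)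
    have c: "continuous_on T W3"
      by (rule continuous_at_imp_continuous_on) (use W3_deriv[OF tb] has_derivative_continuous in blast)
    have d: "(W3 has_derivative ((*v) (dW3 \<tau>))) (at \<tau>)" by (rule W3_deriv[OF tb[OF \<tau>]])
    have i: "(*v) (dW3 \<tau>) \<circ> (*v) B = id"
      by (simp add: fun_eq_iff matrix_vector_mul_assoc B)
    have t: "\<tau> \<in> interior T" using assms(1) \<tau> by (simp add: interior_open)
    show ?thesis
      by (rule sussmann_open_mapping[OF assms(1) c \<tau> d matrix_vector_mul_bounded_linear i order_refl t])
  qed
  then have "W3 ` T \<subseteq> interior (W3 ` T)" by blast
  then show ?thesis by (metis interior_subset open_interior subset_antisym)
qed

text \<open>The form du is (1, x, y) times a scalar form, which in the chart is
  \<open>- t^4 / (Y t)^2\<close>. Row \<open>k\<close> of the transposed Jacobian applied to (A, B,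
  C) is therefore this nonzero scalar times A + B x + C y at the k-th point, and an invertible
  matrix has trivial kernel.\<close>

lemma good_independent:
  assumes "\<tau> \<in> good"
    and "\<And>k. A * 1 + B * cx (\<tau> $ k) + C * cy (\<tau> $ k) = 0"
  shows "A = 0 \<and> B = 0 \<and> C = 0"
proof -
  define v where "v = (vector [A, B, C] :: complex^3)"
  have "(transpose (dW3 \<tau>) *v v) $ k = 0" for k
  proof -
    define t where "t = \<tau> $ k"
    have t: "t \<noteq> 0" "Y t \<noteq> 0" using assms(1) Y_nonzero by (auto simp: good_def t_def)
    have "(transpose (dW3 \<tau>) *v v) $ k = - (t^4 / (Y t)^2) * (A * 1 + B * cx t + C * cy t)"
    proof -
      have "t^4 = t * t^3" by (simp add: eval_nat_numeral)
      define D where "D = t^4 / (Y t)^2"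
      have D: "t / (Y t)^2 = D * cx t" "1 / Y t = D * cy t"
        using t \<open>t^4 = t * t^3\<close> by (simp_all add: D_def cx_def cy_def power2_eq_square)
      have "(transpose (dW3 \<tau>) *v v) $ k = - D * A + - (t / (Y t)^2) * B + - (1 / Y t) * C"
        by (simp add: matrix_vector_mult_def sum_3 transpose_def dW3_def v_def t_def[symmetric] D_def)
      then show ?thesis unfolding D D_def[symmetric] by (simp add: algebra_simps)
    qed
    then show ?thesis using assms(2)[of k] by (simp add: t_def)
  qed
  then have z: "transpose (dW3 \<tau>) *v v = 0" by (simp add: vec_eq_iff)
  have "invertible (transpose (dW3 \<tau>))"
    using assms(1) by (simp add: good_def invertible_det_nz det_transpose)
  then obtain B' where "B' ** transpose (dW3 \<tau>) = mat 1" unfolding invertible_def by blast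
  then have "v = 0" using z by (metis matrix_vector_mul_assoc matrix_vector_mul_lid matrix_vector_mult_0_right)
  then show ?thesis by (simp add: v_def vec_eq_iff forall_3)
qed

end

section \<open>Expansion of Klein's formula\<close>

lemma eventually_at_if_nhds: "eventually P (nhds a) \<Longrightarrow> eventually P (at a)"
  by (simp add: eventually_nhds_conv_at)

text \<open>Agreement is asked for only away from 0, since Klein's formula is evaluated at finite
  points and \<open>t = 0\<close> is the point at infinity. Continuity supplies the missing
  value.\<close>

lemma has_fps_expansion_unique_at:
  fixes f g :: "complex \<Rightarrow> complex"
  assumes f: "f has_fps_expansion F" and g: "g has_fps_expansion G"
    and ev: "\<forall>\<^sub>F t in at 0. f t = g t"
  shows "F = G"
proof -
  have "f \<midarrow>0\<rightarrow> f 0" "g \<midarrow>0\<rightarrow> g 0"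
    using has_fps_expansion_imp_continuous[OF f, of UNIV] has_fps_expansion_imp_continuous[OF g, of UNIV]
    by (simp_all add: continuous_at)
  then have "g \<midarrow>0\<rightarrow> f 0" "g \<midarrow>0\<rightarrow> g 0"
    using tendsto_cong[OF ev, of "f 0"] by auto
  then have "f 0 = g 0" by (rule LIM_unique)
  then have "\<forall>\<^sub>F t in nhds 0. f t = g t"
    using ev by (simp add: eventually_nhds_conv_at)
  then have "g has_fps_expansion F"
    using f has_fps_expansion_cong[OF _ refl] by blast
  then show ?thesis using g fps_expansion_unique_complex by blast
qed

locale klein_chart = chart lam \<rho> Y W + odd_entire \<sigma> for lam \<rho> Y W \<sigma> +
  assumes klein: "sigma_klein_formula lam \<sigma>"
    and sigma_nonzero: "\<exists>u. \<sigma> u \<noteq> 0"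
begin

section \<open>Power series of the chart\<close>

definition Yf :: "complex fps" where "Yf = fps_expansion Y 0"
definition Zf :: "complex fps" where "Zf = fps_expansion (\<lambda>t. 1 / Y t) 0"

lemma Yf: "Y has_fps_expansion Yf"
  unfolding Yf_def using \<rho> by (intro has_fps_expansion_fps_expansion[OF open_ball _ holY]) auto

lemma Zf: "(\<lambda>t. 1 / Y t) has_fps_expansion Zf"
  unfolding Zf_def using \<rho> Y_nonzero
  by (intro has_fps_expansion_fps_expansion[OF open_ball]) (auto intro!: holomorphic_intros holY)

lemma eventually_ball: "\<forall>\<^sub>F t in nhds 0. t \<in> ball (0::complex) \<rho>"
  using \<rho> by (intro eventually_nhds_in_open) auto

lemma Yf_cube: "Yf ^ 3 = 1 + fps_const (lam 3) * fps_X ^ 3 + fps_const (lam 2) * fps_X ^ 6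
    + fps_const (lam 1) * fps_X ^ 9 + fps_const (lam 0) * fps_X ^ 12"
proof (rule has_fps_expansion_unique_at)
  show "(\<lambda>t. Y t ^ 3) has_fps_expansion Yf ^ 3" by (intro fps_expansion_intros Yf)
  show "curve_poly lam has_fps_expansion 1 + fps_const (lam 3) * fps_X ^ 3 + fps_const (lam 2) * fps_X ^ 6
    + fps_const (lam 1) * fps_X ^ 9 + fps_const (lam 0) * fps_X ^ 12"
    unfolding curve_poly_def by (intro fps_expansion_intros)
  show "\<forall>\<^sub>F t in at 0. Y t ^ 3 = curve_poly lam t"
    using eventually_at_if_nhds[OF eventually_ball] by (rule eventually_mono) (rule Y3)
qed

lemma Yf_Zf: "Yf * Zf = 1"
proof (rule has_fps_expansion_unique_at)
  show "(\<lambda>t. Y t * (1 / Y t)) has_fps_expansion Yf * Zf" by (intro fps_expansion_intros Yf Zf)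
  show "(\<lambda>_. 1::complex) has_fps_expansion 1" by simp
  show "\<forall>\<^sub>F t in at 0. Y t * (1 / Y t) = 1"
    using eventually_at_if_nhds[OF eventually_ball] by (rule eventually_mono) (simp add: Y_nonzero)
qed

lemmas low_order = fps_mult_nth numeral_eq_Suc fps_X_power_nth atLeast0_atMost_Suc

text \<open>Found one after another from the cube of the series. Order four is enough, because
  Klein's formula is compared through \<open>t^4\<close>.\<close>

lemma Yf_nth:
  "fps_nth Yf 0 = 1" "fps_nth Yf (Suc 0) = 0" "fps_nth Yf (Suc (Suc 0)) = 0"
  "fps_nth Yf (Suc (Suc (Suc 0))) = lam 3 / 3" "fps_nth Yf (Suc (Suc (Suc (Suc 0)))) = 0"
proof -
  show 0: "fps_nth Yf 0 = 1"
    using Yf Y_0 by (metis has_fps_expansion_imp_0_eq_fps_nth_0)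
  have c: "fps_nth (Yf * Yf * Yf) n = fps_nth (1 + fps_const (lam 3) * fps_X ^ 3 + fps_const (lam 2) * fps_X ^ 6
    + fps_const (lam 1) * fps_X ^ 9 + fps_const (lam 0) * fps_X ^ 12) n" for n
    using Yf_cube by (simp add: power3_eq_cube)
  show 1: "fps_nth Yf (Suc 0) = 0"
    using c[of 1] 0 by (simp add: low_order del: power_Suc)
  show 2: "fps_nth Yf (Suc (Suc 0)) = 0"
    using c[of 2] 0 1 by (simp add: low_order del: power_Suc)
  show 3: "fps_nth Yf (Suc (Suc (Suc 0))) = lam 3 / 3"
    using c[of 3] 0 1 2 by (simp add: low_order mult.commute del: power_Suc)
  show "fps_nth Yf (Suc (Suc (Suc (Suc 0)))) = 0"
    using c[of 4] 0 1 2 3 by (simp add: low_order del: power_Suc)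
qed

lemma Zf_nth:
  "fps_nth Zf 0 = 1" "fps_nth Zf (Suc 0) = 0" "fps_nth Zf (Suc (Suc 0)) = 0"
  "fps_nth Zf (Suc (Suc (Suc 0))) = - lam 3 / 3"
proof -
  have c: "fps_nth (Yf * Zf) n = fps_nth 1 n" for n using Yf_Zf by simp
  show 0: "fps_nth Zf 0 = 1" using c[of 0] by (simp add: Yf_nth)
  show 1: "fps_nth Zf (Suc 0) = 0" using c[of 1] 0 by (simp add: low_order Yf_nth del: power_Suc)
  show 2: "fps_nth Zf (Suc (Suc 0)) = 0" using c[of 2] 0 1 by (simp add: low_order Yf_nth del: power_Suc)
  show "fps_nth Zf (Suc (Suc (Suc 0))) = - lam 3 / 3"
    using c[of 3] 0 1 2 by (simp add: low_order Yf_nth eq_neg_iff_add_eq_0 add.commute del: power_Suc)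
qed

definition wpf :: "complex^3 \<Rightarrow> nat \<Rightarrow> nat \<Rightarrow> nat \<Rightarrow> complex fps" where
  "wpf v a b c = fps_expansion (\<lambda>t. wp a b c (v - W t)) 0"

lemma isCont_W: "t \<in> ball 0 \<rho> \<Longrightarrow> isCont W t"
proof -
  assume t: "t \<in> ball 0 \<rho>"
  have "(W has_derivative (\<lambda>h. h *s du_germ Y t)) (at t)"
    by (rule has_derivative_componentsI)
      (use W_deriv[OF t] in \<open>simp add: has_field_derivative_def mult_commute_abs\<close>)
  then show ?thesis by (rule has_derivative_continuous)
qed

lemma near_Om:
  assumes "v \<in> Om"
  shows "\<exists>r>0. r \<le> \<rho> \<and> (\<forall>t\<in>ball 0 r. v - W t \<in> Om)"
proof -
  have "((\<lambda>t. v - W t) \<longlongrightarrow> v - W 0) (nhds 0)"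
    using isCont_W[of 0] \<rho> tendsto_at_iff_tendsto_nhds[of W 0]
    by (intro tendsto_intros) (simp add: continuous_at)
  then have "\<forall>\<^sub>F t in nhds 0. v - W t \<in> Om"
    using assms open_Om by (simp add: tendsto_def W_0)
  then obtain e where "e > 0" "\<And>t. dist t 0 < e \<Longrightarrow> v - W t \<in> Om"
    by (auto simp: eventually_nhds_metric)
  then show ?thesis using \<rho> by (intro exI[of _ "min e \<rho>"]) (auto simp: dist_norm)
qed

text \<open>The factors in front of the three derivatives are the components of the velocity of
  \<open>v - W t\<close>, that is, of \<open>- du_germ Y t\<close>.\<close>

lemma wp_along_W:
  assumes "t \<in> ball 0 \<rho>" "v - W t \<in> Om" "0 < a + b + c"
  shows "((\<lambda>t. wp a b c (v - W t)) has_field_derivative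
     t^4 * (1 / Y t)^2 * wp (Suc a) b c (v - W t) + t * (1 / Y t)^2 * wp a (Suc b) c (v - W t)
     + 1 / Y t * wp a b (Suc c) (v - W t)) (at t)"
proof -
  have "((\<lambda>t. (v - W t) $ i) has_field_derivative (- du_germ Y t $ i)) (at t)" for i
    using DERIV_diff[OF DERIV_const W_deriv[OF assms(1)], of "v $ i" i] by simp
  from hol3_chain[OF open_Om hol_wp assms(2) this, of a b c] show ?thesis
    by (simp add: sum_3 pd1_wp[OF assms(3,2)] pd2_wp[OF assms(3,2)] pd3_wp[OF assms(3,2)] power_divide)
qed

lemma wpf:
  assumes "v \<in> Om"
  shows "(\<lambda>t. wp a b c (v - W t)) has_fps_expansion wpf v a b c"
proof -
  obtain r where r: "r > 0" "r \<le> \<rho>" "\<And>t. t \<in> ball 0 r \<Longrightarrow> v - W t \<in> Om"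
    using near_Om[OF assms] by blast
  have "(\<lambda>t. wp a b c (v - W t)) holomorphic_on ball 0 r"
    unfolding holomorphic_on_def
  proof
    fix t :: complex assume t: "t \<in> ball 0 r"
    have "((\<lambda>t. (v - W t) $ i) has_field_derivative (- du_germ Y t $ i)) (at t)" for i
      using DERIV_diff[OF DERIV_const W_deriv[of t i], of "v $ i"] t r(2) by simp
    from hol3_chain[OF open_Om hol_wp r(3)[OF t] this]
    show "(\<lambda>t. wp a b c (v - W t)) field_differentiable at t within ball 0 r"
      using field_differentiable_at_within field_differentiable_def by blast
  qed
  then show ?thesis
    unfolding wpf_def using r by (intro has_fps_expansion_fps_expansion[OF open_ball]) auto
qed

lemma wpf_nth_0: "v \<in> Om \<Longrightarrow> fps_nth (wpf v a b c) 0 = wp a b c v"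
  using has_fps_expansion_imp_0_eq_fps_nth_0[OF wpf, of v a b c] by (simp add: W_0)

lemma wpf_deriv:
  assumes v: "v \<in> Om" and n: "0 < a + b + c"
  shows "fps_deriv (wpf v a b c) =
     fps_X^4 * Zf^2 * wpf v (Suc a) b c + fps_X * Zf^2 * wpf v a (Suc b) c + Zf * wpf v a b (Suc c)"
proof (rule has_fps_expansion_unique_at)
  show "deriv (\<lambda>t. wp a b c (v - W t)) has_fps_expansion fps_deriv (wpf v a b c)"
    by (intro fps_expansion_intros wpf v)
  show "(\<lambda>t. t^4 * (1 / Y t)^2 * wp (Suc a) b c (v - W t) + t * (1 / Y t)^2 * wp a (Suc b) c (v - W t)
     + 1 / Y t * wp a b (Suc c) (v - W t)) has_fps_expansion
     fps_X^4 * Zf^2 * wpf v (Suc a) b c + fps_X * Zf^2 * wpf v a (Suc b) c + Zf * wpf v a b (Suc c)"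
    by (intro fps_expansion_intros wpf v Zf)
  obtain r where r: "r > 0" "r \<le> \<rho>" "\<And>t. t \<in> ball 0 r \<Longrightarrow> v - W t \<in> Om"
    using near_Om[OF v] by blast
  have "\<forall>\<^sub>F t in nhds 0. t \<in> ball (0::complex) r"
    using r by (intro eventually_nhds_in_open) auto
  from eventually_at_if_nhds[OF this]
  show "\<forall>\<^sub>F t in at 0. deriv (\<lambda>t. wp a b c (v - W t)) t =
     t^4 * (1 / Y t)^2 * wp (Suc a) b c (v - W t) + t * (1 / Y t)^2 * wp a (Suc b) c (v - W t)
     + 1 / Y t * wp a b (Suc c) (v - W t)"
    by (rule eventually_mono, intro DERIV_imp_deriv wp_along_W) (use r n in auto)
qed

text \<open>Obtained by solving \<open>wpf_deriv\<close> order by order. The derivative in direction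
  1 comes with \<open>t^4\<close> and would be felt only at order five; \<open>lam 3\<close> first
  appears at order four, through the cubic coefficient of \<open>1 / Y\<close>.\<close>

lemma wpf_nth_Suc:
  assumes v: "v \<in> Om" and n: "0 < a + b + c"
  shows "fps_nth (wpf v a b c) (Suc 0) = wp a b (Suc c) v"
    and "fps_nth (wpf v a b c) (Suc (Suc 0)) = (wp a b (Suc (Suc c)) v + wp a (Suc b) c v) / 2"
    and "fps_nth (wpf v a b c) (Suc (Suc (Suc 0))) =
      wp a b (Suc (Suc (Suc c))) v / 6 + wp a (Suc b) (Suc c) v / 2"
    and "fps_nth (wpf v a b c) (Suc (Suc (Suc (Suc 0)))) =
      wp a b (Suc (Suc (Suc (Suc c)))) v / 24 + wp a (Suc b) (Suc (Suc c)) v / 4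
      + wp a (Suc (Suc b)) c v / 8 - lam 3 / 12 * wp a b (Suc c) v"
proof -
  note z = wpf_nth_0[OF v]
  have c: "of_nat (Suc m) * fps_nth (wpf v a b c) (Suc m) = fps_nth (fps_X^4 * (Zf * Zf) * wpf v (Suc a) b c
      + fps_X^1 * (Zf * Zf) * wpf v a (Suc b) c + Zf * wpf v a b (Suc c)) m"
    if "0 < a + b + c" for a b c m
    using wpf_deriv[OF v that] by (metis fps_deriv_nth Suc_eq_plus1 power2_eq_square power_one_right)
  have 1: "fps_nth (wpf v a b c) (Suc 0) = wp a b (Suc c) v" if "0 < a + b + c" for a b c
    using c[OF that, of 0] by (simp add: low_order Zf_nth z del: power_Suc)
  have 2: "fps_nth (wpf v a b c) (Suc (Suc 0)) = (wp a b (Suc (Suc c)) v + wp a (Suc b) c v) / 2"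
    if "0 < a + b + c" for a b c
    using c[OF that, of "Suc 0"] by (simp add: low_order Zf_nth z 1 add.commute mult.commute del: power_Suc)
  have 3: "fps_nth (wpf v a b c) (Suc (Suc (Suc 0))) =
      wp a b (Suc (Suc (Suc c))) v / 6 + wp a (Suc b) (Suc c) v / 2" if "0 < a + b + c" for a b c
  proof -
    have "3 * fps_nth (wpf v a b c) (Suc (Suc (Suc 0))) =
      wp a (Suc b) (Suc c) v + (wp a b (Suc (Suc (Suc c))) v + wp a (Suc b) (Suc c) v) / 2"
      using c[OF that, of "Suc (Suc 0)"] by (simp add: low_order Zf_nth z 1 2 add.commute del: power_Suc)
    then show ?thesis by (simp add: field_simps)
  qed
  show "fps_nth (wpf v a b c) (Suc (Suc (Suc (Suc 0)))) =
      wp a b (Suc (Suc (Suc (Suc c)))) v / 24 + wp a (Suc b) (Suc (Suc c)) v / 4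
      + wp a (Suc (Suc b)) c v / 8 - lam 3 / 12 * wp a b (Suc c) v"
  proof -
    have "4 * fps_nth (wpf v a b c) (Suc (Suc (Suc (Suc 0)))) =
      (wp a (Suc b) (Suc (Suc c)) v + wp a (Suc (Suc b)) c v) / 2 +
      (wp a b (Suc (Suc (Suc (Suc c)))) v / 6 + wp a (Suc b) (Suc (Suc c)) v / 2
       - lam 3 / 3 * wp a b (Suc c) v)"
      using c[OF n, of "Suc (Suc (Suc 0))"]
      by (simp add: low_order Zf_nth z 1 2 3 add.commute del: power_Suc)
    then have "fps_nth (wpf v a b c) (Suc (Suc (Suc (Suc 0)))) =
      ((wp a (Suc b) (Suc (Suc c)) v + wp a (Suc (Suc b)) c v) / 2 +
      (wp a b (Suc (Suc (Suc (Suc c)))) v / 6 + wp a (Suc b) (Suc (Suc c)) v / 2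
       - lam 3 / 3 * wp a b (Suc c) v)) / 4"
      by (simp add: mult.commute)
    then show ?thesis by (simp add: add_divide_distrib diff_divide_distrib)
  qed
  show "fps_nth (wpf v a b c) (Suc 0) = wp a b (Suc c) v"
    and "fps_nth (wpf v a b c) (Suc (Suc 0)) = (wp a b (Suc (Suc c)) v + wp a (Suc b) c v) / 2"
    and "fps_nth (wpf v a b c) (Suc (Suc (Suc 0))) =
      wp a b (Suc (Suc (Suc c))) v / 6 + wp a (Suc b) (Suc c) v / 2"
    using 1 2 3 n by auto
qed

section \<open>Comparison of coefficients in Klein's formula\<close>

definition klein_row :: "complex \<Rightarrow> complex \<Rightarrow> complex^3 \<Rightarrow> 3 \<Rightarrow> complex" where
  "klein_row z w u = (\<lambda>i. if i = 1 then wp 2 0 0 u + wp 1 1 0 u * z + wp 1 0 1 u * w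
     else if i = 2 then wp 1 1 0 u + wp 0 2 0 u * z + wp 0 1 1 u * w
     else wp 1 0 1 u + wp 0 1 1 u * z + wp 0 0 2 u * w)"

text \<open>Klein's formula with the moving point at parameter \<open>t\<close>, multiplied by
  \<open>t^10 * (x - z)^2\<close> to clear all poles. The formula is evaluated at
  \<open>W t - W3 \<tau>\<close>, whereas the functions are wanted at its negative; both agree
  because two-index functions are even.\<close>

lemma klein_near_infinity:
  fixes \<tau> :: "complex^3" and k :: 3
  assumes \<tau>: "\<tau> \<in> good" and v: "W3 \<tau> \<in> Om"
  defines "z \<equiv> cx (\<tau> $ k)" and "w \<equiv> cy (\<tau> $ k)"
  shows "\<forall>\<^sub>F t in at 0.
    (1 - 2 * z * t^3 + z^2 * t^6) * (Y t * klein_row z w (W3 \<tau> - W t) 3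
       + t * klein_row z w (W3 \<tau> - W t) 2 + t^4 * klein_row z w (W3 \<tau> - W t) 1) =
    3 * t^2 * (Y t)^2 * w^2
    + w * (3 * lam 0 * t^10 + lam 1 * (z * t^10 + 2 * t^7) + lam 2 * (t^4 + 2 * z * t^7)
        + 3 * lam 3 * z * t^4 + z^2 * t^4 + 2 * z * t)
    + Y t * (3 * lam 0 * t^6 + lam 1 * (t^3 + 2 * z * t^6) + lam 2 * (z^2 * t^6 + 2 * z * t^3)
        + 3 * lam 3 * z^2 * t^3 + z^2 + 2 * z^3 * t^3)"
proof -
  obtain r where r: "r > 0" "r \<le> \<rho>" "\<And>t. t \<in> ball 0 r \<Longrightarrow> W3 \<tau> - W t \<in> Om"
    using near_Om[OF v] by blast
  have \<tau>0: "\<tau> $ j \<noteq> 0" "\<tau> $ j \<in> ball 0 \<rho>" for j using \<tau> by (auto simp: good_def)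
  \<comment> \<open>For \<open>norm t\<close> below the norm of the k-th parameter the cubes of the
    two parameters differ, so \<open>x \<noteq> z\<close>.\<close>
  define r' where "r' = min r (norm (\<tau> $ k))"
  have r': "r' > 0" using r \<tau>0[of k] by (simp add: r'_def)
  have main: "(1 - 2 * z * t^3 + z^2 * t^6) * (Y t * klein_row z w (W3 \<tau> - W t) 3
       + t * klein_row z w (W3 \<tau> - W t) 2 + t^4 * klein_row z w (W3 \<tau> - W t) 1) =
    3 * t^2 * (Y t)^2 * w^2
    + w * (3 * lam 0 * t^10 + lam 1 * (z * t^10 + 2 * t^7) + lam 2 * (t^4 + 2 * z * t^7)
        + 3 * lam 3 * z * t^4 + z^2 * t^4 + 2 * z * t)
    + Y t * (3 * lam 0 * t^6 + lam 1 * (t^3 + 2 * z * t^6) + lam 2 * (z^2 * t^6 + 2 * z * t^3)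
        + 3 * lam 3 * z^2 * t^3 + z^2 + 2 * z^3 * t^3)"
    if t: "t \<noteq> 0" "norm t < r'" for t
  proof -
    define u where "u = W3 \<tau> - W t"
    have u: "u \<in> Om" using r(3)[of t] t by (simp add: u_def r'_def)
    have tb: "t \<in> ball 0 \<rho>" using t r by (simp add: r'_def)
    define x where "x = cx t"
    define y where "y = cy t"
    have xz: "x \<noteq> z"
    proof
      assume "x = z"
      then have "t^3 = (\<tau> $ k)^3" using t \<tau>0[of k] by (simp add: x_def z_def cx_def)
      then have "norm t ^ 3 = norm (\<tau> $ k) ^ 3" by (metis norm_power)
      then show False using t by (simp add: r'_def power_eq_iff_eq_base)
    qed
    have neg: "W t - (\<Sum>k\<in>UNIV. W (\<tau> $ k)) = - u" by (simp add: u_def W3_def)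
    have "\<forall>k. x \<noteq> cx (\<tau> $ k) \<longrightarrow>
          (\<Sum>i\<in>UNIV. \<Sum>j\<in>UNIV. wp2 \<sigma> (W t - (\<Sum>k\<in>UNIV. W (\<tau> $ k))) i j
               * varphi x y $ i * varphi (cx (\<tau> $ k)) (cy (\<tau> $ k)) $ j)
          = (3 * y ^ 2 * cy (\<tau> $ k) ^ 2 + cy (\<tau> $ k) * klein_T lam x (cx (\<tau> $ k)) + y * klein_T lam (cx (\<tau> $ k)) x)
              / (x - cx (\<tau> $ k)) ^ 2"
      using klein[unfolded sigma_klein_formula_def, rule_format, of "W t" x y "\<lambda>k. W (\<tau> $ k)"
          "\<lambda>k. cx (\<tau> $ k)" "\<lambda>k. cy (\<tau> $ k)"] W_abel[OF tb t(1)] W_abel[OF \<tau>0(2,1)]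
        minus_Om[OF u] by (auto simp: x_def y_def neg Om_def)
    then have K: "(\<Sum>i\<in>UNIV. \<Sum>j\<in>UNIV. wp2 \<sigma> (- u) i j * varphi x y $ i * varphi z w $ j)
          = (3 * y ^ 2 * w ^ 2 + w * klein_T lam x z + y * klein_T lam z x) / (x - z) ^ 2"
      using xz by (simp add: neg z_def w_def)
    have S: "(\<Sum>i\<in>UNIV. \<Sum>j\<in>UNIV. wp2 \<sigma> (- u) i j * varphi x y $ i * varphi z w $ j) =
        klein_row z w u 1 + x * klein_row z w u 2 + y * klein_row z w u 3"
      by (simp add: sum_3 varphi_def wp2_eq[OF minus_Om[OF u]] wp_reflect[OF u] klein_row_def
          numeral_2_eq_2 algebra_simps)
    have "(x - z)^2 * (klein_row z w u 1 + x * klein_row z w u 2 + y * klein_row z w u 3) =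
        3 * y ^ 2 * w ^ 2 + w * klein_T lam x z + y * klein_T lam z x"
      using K S xz by simp
    moreover have "x = 1 / t^3" "y = Y t / t^4" by (simp_all add: x_def y_def cx_def cy_def)
    \<comment> \<open>Replacing \<open>1 / t\<close> by a variable \<open>s\<close> with
      \<open>s * t = 1\<close> leaves a polynomial identity that follows from polynomial
      hypotheses.\<close>
    moreover define s where "s = inverse t"
    moreover have "s * t = 1" using t by (simp add: s_def)
    ultimately have e: "(s^3 - z)^2 * (klein_row z w u 1 + s^3 * klein_row z w u 2 + Y t * s^4 * klein_row z w u 3) =
        3 * (Y t * s^4) ^ 2 * w ^ 2 + w * klein_T lam (s^3) z + Y t * s^4 * klein_T lam z (s^3)" "s * t = 1"
      by (simp_all add: divide_inverse power_inverse)
    show ?thesis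
      using e unfolding u_def[symmetric] klein_T_def by algebra
  qed
  have "\<forall>\<^sub>F t in nhds 0. norm (t::complex) < r'"
    using eventually_nhds_in_open[of "ball (0::complex) r'" 0] r' by simp
  from eventually_at_if_nhds[OF this]
  have "\<forall>\<^sub>F t in at 0. norm (t::complex) < r' \<and> t \<noteq> 0"
    by (intro eventually_conj) (simp_all add: eventually_at_filter)
  then show ?thesis by (rule eventually_mono) (use main in blast)
qed

lemma klein_series:
  fixes \<tau> :: "complex^3" and k :: 3
  assumes \<tau>: "\<tau> \<in> good" and v: "W3 \<tau> \<in> Om"
  defines "z \<equiv> cx (\<tau> $ k)" and "w \<equiv> cy (\<tau> $ k)" and "P \<equiv> \<lambda>a b c. wpf (W3 \<tau>) a b c"
  shows "(1 - fps_const (2 * z) * fps_X^3 + fps_const (z^2) * fps_X^6) *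
     (Yf * (P 1 0 1 + P 0 1 1 * fps_const z + P 0 0 2 * fps_const w)
       + fps_X * (P 1 1 0 + P 0 2 0 * fps_const z + P 0 1 1 * fps_const w)
       + fps_X^4 * (P 2 0 0 + P 1 1 0 * fps_const z + P 1 0 1 * fps_const w)) =
    fps_const 3 * fps_X^2 * Yf^2 * fps_const (w^2)
    + fps_const w * (fps_const (3 * lam 0) * fps_X^10 + fps_const (lam 1) * (fps_const z * fps_X^10 + fps_const 2 * fps_X^7)
        + fps_const (lam 2) * (fps_X^4 + fps_const (2 * z) * fps_X^7)
        + fps_const (3 * lam 3 * z) * fps_X^4 + fps_const (z^2) * fps_X^4 + fps_const (2 * z) * fps_X)
    + Yf * (fps_const (3 * lam 0) * fps_X^6 + fps_const (lam 1) * (fps_X^3 + fps_const (2 * z) * fps_X^6)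
        + fps_const (lam 2) * (fps_const (z^2) * fps_X^6 + fps_const (2 * z) * fps_X^3)
        + fps_const (3 * lam 3 * z^2) * fps_X^3 + fps_const (z^2) + fps_const (2 * z^3) * fps_X^3)"
  unfolding P_def
proof (rule has_fps_expansion_unique_at)
  show "(\<lambda>t. (1 - 2 * z * t^3 + z^2 * t^6) *
      (Y t * (wp 1 0 1 (W3 \<tau> - W t) + wp 0 1 1 (W3 \<tau> - W t) * z + wp 0 0 2 (W3 \<tau> - W t) * w)
       + t * (wp 1 1 0 (W3 \<tau> - W t) + wp 0 2 0 (W3 \<tau> - W t) * z + wp 0 1 1 (W3 \<tau> - W t) * w)
       + t^4 * (wp 2 0 0 (W3 \<tau> - W t) + wp 1 1 0 (W3 \<tau> - W t) * z + wp 1 0 1 (W3 \<tau> - W t) * w)))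
    has_fps_expansion (1 - fps_const (2 * z) * fps_X^3 + fps_const (z^2) * fps_X^6) *
     (Yf * (wpf (W3 \<tau>) 1 0 1 + wpf (W3 \<tau>) 0 1 1 * fps_const z + wpf (W3 \<tau>) 0 0 2 * fps_const w)
       + fps_X * (wpf (W3 \<tau>) 1 1 0 + wpf (W3 \<tau>) 0 2 0 * fps_const z + wpf (W3 \<tau>) 0 1 1 * fps_const w)
       + fps_X^4 * (wpf (W3 \<tau>) 2 0 0 + wpf (W3 \<tau>) 1 1 0 * fps_const z + wpf (W3 \<tau>) 1 0 1 * fps_const w))"
    by (intro fps_expansion_intros wpf[OF v] Yf)
  show "(\<lambda>t. 3 * t^2 * (Y t)^2 * w^2
    + w * (3 * lam 0 * t^10 + lam 1 * (z * t^10 + 2 * t^7) + lam 2 * (t^4 + 2 * z * t^7)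
        + 3 * lam 3 * z * t^4 + z^2 * t^4 + 2 * z * t)
    + Y t * (3 * lam 0 * t^6 + lam 1 * (t^3 + 2 * z * t^6) + lam 2 * (z^2 * t^6 + 2 * z * t^3)
        + 3 * lam 3 * z^2 * t^3 + z^2 + 2 * z^3 * t^3)) has_fps_expansion
    fps_const 3 * fps_X^2 * Yf^2 * fps_const (w^2)
    + fps_const w * (fps_const (3 * lam 0) * fps_X^10 + fps_const (lam 1) * (fps_const z * fps_X^10 + fps_const 2 * fps_X^7)
        + fps_const (lam 2) * (fps_X^4 + fps_const (2 * z) * fps_X^7)
        + fps_const (3 * lam 3 * z) * fps_X^4 + fps_const (z^2) * fps_X^4 + fps_const (2 * z) * fps_X)
    + Yf * (fps_const (3 * lam 0) * fps_X^6 + fps_const (lam 1) * (fps_X^3 + fps_const (2 * z) * fps_X^6)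
        + fps_const (lam 2) * (fps_const (z^2) * fps_X^6 + fps_const (2 * z) * fps_X^3)
        + fps_const (3 * lam 3 * z^2) * fps_X^3 + fps_const (z^2) + fps_const (2 * z^3) * fps_X^3)"
    by (intro fps_expansion_intros Yf)
  show "\<forall>\<^sub>F t in at 0. (1 - 2 * z * t^3 + z^2 * t^6) *
      (Y t * (wp 1 0 1 (W3 \<tau> - W t) + wp 0 1 1 (W3 \<tau> - W t) * z + wp 0 0 2 (W3 \<tau> - W t) * w)
       + t * (wp 1 1 0 (W3 \<tau> - W t) + wp 0 2 0 (W3 \<tau> - W t) * z + wp 0 1 1 (W3 \<tau> - W t) * w)
       + t^4 * (wp 2 0 0 (W3 \<tau> - W t) + wp 1 1 0 (W3 \<tau> - W t) * z + wp 1 0 1 (W3 \<tau> - W t) * w)) =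
    3 * t^2 * (Y t)^2 * w^2
    + w * (3 * lam 0 * t^10 + lam 1 * (z * t^10 + 2 * t^7) + lam 2 * (t^4 + 2 * z * t^7)
        + 3 * lam 3 * z * t^4 + z^2 * t^4 + 2 * z * t)
    + Y t * (3 * lam 0 * t^6 + lam 1 * (t^3 + 2 * z * t^6) + lam 2 * (z^2 * t^6 + 2 * z * t^3)
        + 3 * lam 3 * z^2 * t^3 + z^2 + 2 * z^3 * t^3)"
    using klein_near_infinity[OF \<tau> v, of k] by (simp add: klein_row_def z_def w_def)
qed

text \<open>The coefficients of \<open>t^0\<close> to \<open>t^4\<close>. The first three reduce
  x^2, x y and y^2 to the basis 1, x, y. The last two reduce the derivative of the quartic and an
  expression led by x^2 y, which the first three reduce as well; comparing the two gives new
  equations. From \<open>t^3\<close> on, the factor coming from \<open>(x - z)^2\<close> mixes lower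
  coefficients in, hence the use of \<open>c0\<close> and \<open>c1\<close>.\<close>

lemma klein_coefficients:
  fixes \<tau> :: "complex^3" and k :: 3
  assumes \<tau>: "\<tau> \<in> good" and v: "W3 \<tau> \<in> Om"
  defines "z \<equiv> cx (\<tau> $ k)" and "w \<equiv> cy (\<tau> $ k)" and "p \<equiv> \<lambda>a b c. wp a b c (W3 \<tau>)"
  shows "p 1 0 1 + p 0 1 1 * z + p 0 0 2 * w = z^2"
    and "(p 1 1 0 + p 1 0 2) + (p 0 2 0 + p 0 1 2) * z + (p 0 1 1 + p 0 0 3) * w = 2 * z * w"
    and "(p 1 0 3 / 2 + 3 / 2 * p 1 1 1) + (p 0 1 3 / 2 + 3 / 2 * p 0 2 1) * z
       + (p 0 0 4 / 2 + 3 / 2 * p 0 1 2) * w = 3 * w^2"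
    and "(p 1 0 4 / 6 + p 1 1 2 + p 1 2 0 / 2) + (p 0 1 4 / 6 + p 0 2 2 + p 0 3 0 / 2) * z
       + (p 0 0 5 / 6 + p 0 1 3 + p 0 2 1 / 2) * w = 4 * z^3 + 3 * lam 3 * z^2 + 2 * lam 2 * z + lam 1"
    and "(p 2 0 0 + p 1 0 5 / 24 + 5 / 12 * p 1 1 3 + 5 / 8 * p 1 2 1 + lam 3 / 4 * p 1 0 2)
       + (p 1 1 0 + p 0 1 5 / 24 + 5 / 12 * p 0 2 3 + 5 / 8 * p 0 3 1 + lam 3 / 4 * p 0 1 2) * z
       + (p 1 0 1 + p 0 0 6 / 24 + 5 / 12 * p 0 1 4 + 5 / 8 * p 0 2 2 + lam 3 / 4 * p 0 0 3) * w
       = 5 * z^2 * w + 3 * lam 3 * z * w + lam 2 * w"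
proof -
  note S = klein_series[OF \<tau> v, of k, folded z_def w_def, unfolded power2_eq_square[of Yf]]
  note simps = low_order Yf_nth wpf_nth_0[OF v] wpf_nth_Suc[OF v] p_def
  note S0 = arg_cong[OF S, of "\<lambda>F. fps_nth F 0"]
  note S1 = arg_cong[OF S, of "\<lambda>F. fps_nth F (Suc 0)"]
  note S2 = arg_cong[OF S, of "\<lambda>F. fps_nth F (Suc (Suc 0))"]
  note S3 = arg_cong[OF S, of "\<lambda>F. fps_nth F (Suc (Suc (Suc 0)))"]
  note S4 = arg_cong[OF S, of "\<lambda>F. fps_nth F (Suc (Suc (Suc (Suc 0))))"]
  show c0: "p 1 0 1 + p 0 1 1 * z + p 0 0 2 * w = z^2"
    using S0 by (simp add: simps del: power_Suc)
  show c1: "(p 1 1 0 + p 1 0 2) + (p 0 2 0 + p 0 1 2) * z + (p 0 1 1 + p 0 0 3) * w = 2 * z * w"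
    using S1 by (simp add: simps algebra_simps del: power_Suc)
  show "(p 1 0 3 / 2 + 3 / 2 * p 1 1 1) + (p 0 1 3 / 2 + 3 / 2 * p 0 2 1) * z
       + (p 0 0 4 / 2 + 3 / 2 * p 0 1 2) * w = 3 * w^2"
    using S2 by (simp add: simps field_simps del: power_Suc)
  show "(p 1 0 4 / 6 + p 1 1 2 + p 1 2 0 / 2) + (p 0 1 4 / 6 + p 0 2 2 + p 0 3 0 / 2) * z
       + (p 0 0 5 / 6 + p 0 1 3 + p 0 2 1 / 2) * w = 4 * z^3 + 3 * lam 3 * z^2 + 2 * lam 2 * z + lam 1"
    using S3 c0 by (simp add: simps del: power_Suc) (simp add: field_simps, algebra)
  show "(p 2 0 0 + p 1 0 5 / 24 + 5 / 12 * p 1 1 3 + 5 / 8 * p 1 2 1 + lam 3 / 4 * p 1 0 2)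
       + (p 1 1 0 + p 0 1 5 / 24 + 5 / 12 * p 0 2 3 + 5 / 8 * p 0 3 1 + lam 3 / 4 * p 0 1 2) * z
       + (p 1 0 1 + p 0 0 6 / 24 + 5 / 12 * p 0 1 4 + 5 / 8 * p 0 2 2 + lam 3 / 4 * p 0 0 3) * w
       = 5 * z^2 * w + 3 * lam 3 * z * w + lam 2 * w"
    using S4 c0 c1 by (simp add: simps del: power_Suc) (simp add: field_simps, algebra)
qed

end

section \<open>The multiplication table of a divisor\<close>

text \<open>If \<open>1, x, y\<close> are independent on a divisor of the curve, the reductions of \<open>x\<^sup>2, xy, y\<^sup>2\<close> satisfy
  the associativity of multiplication and the equation of the curve.\<close>

lemma multiplication_table:
  fixes z w :: "'i \<Rightarrow> complex"
  assumes ind: "\<And>A B C. (\<And>k. A * 1 + B * z k + C * w k = 0) \<Longrightarrow> A = 0 \<and> B = 0 \<and> C = 0"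
    and h0: "\<And>k. c + b * z k + a * w k = z k ^ 2"
    and h1: "\<And>k. ga + be * z k + al * w k = z k * w k"
    and h2: "\<And>k. rr + qq * z k + pp * w k = w k ^ 2"
    and h3: "\<And>k. A1 + A2 * z k + A3 * w k = 4 * z k ^ 3 + 3 * l3 * z k ^ 2 + 2 * l2 * z k + l1"
    and h4: "\<And>k. B1 + B2 * z k + B3 * w k = 5 * z k ^ 2 * w k + 3 * l3 * z k * w k + l2 * w k"
    and h5: "\<And>k. w k ^ 3 = z k ^ 4 + l3 * z k ^ 3 + l2 * z k ^ 2 + l1 * z k + l0"
  shows "al * ga + be * c - (a * rr + b * ga) = 0 \<and> al * be + be * b + ga - (a * qq + b * be) = 0 \<and>
      al ^ 2 + be * a - (a * pp + b * al + c) = 0" (is ?assoc1)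
    and "al * rr + be * ga - (pp * ga + qq * c) = 0 \<and> al * qq + be ^ 2 - (pp * be + qq * b + rr) = 0 \<and>
      al * pp + be * al + ga - (pp * al + qq * a) = 0" (is ?assoc2)
    and "pp * rr + qq * ga - (a * (al * ga + be * c) + (b + l3) * (a * ga + b * c) + (c + l2) * c + l0) = 0 \<and>
      pp * qq + qq * be + rr * 0 - (a * (al * be + be * b + ga) + (b + l3) * (a * be + b ^ 2 + c) + (c + l2) * b + l1) = 0 \<and>
      pp ^ 2 + qq * al + rr - (a * (al ^ 2 + be * a) + (b + l3) * (a * al + b * a) + (c + l2) * a) = 0" (is ?curve)
    and "A1 - (4 * (a * ga + b * c) + 3 * l3 * c + l1) = 0 \<and>
      A2 - (4 * (a * be + b ^ 2 + c) + 3 * l3 * b + 2 * l2) = 0 \<and>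
      A3 - (4 * (a * al + b * a) + 3 * l3 * a) = 0" (is ?third)
    and "B1 - (5 * (al * ga + be * c) + 3 * l3 * ga) = 0 \<and>
      B2 - (5 * (al * be + be * b + ga) + 3 * l3 * be) = 0 \<and>
      B3 - (5 * (al ^ 2 + be * a) + 3 * l3 * al + l2) = 0" (is ?fourth)
proof -
  \<comment> \<open>Higher monomials are reduced by multiplying the reductions of x^2 and x y by x.
    Every claim compares two reductions of one function on the divisor, and \<open>ind\<close> then
    equates their coefficients.\<close>
  have x3: "z k ^ 3 = (a * ga + b * c) + (a * be + b ^ 2 + c) * z k + (a * al + b * a) * w k" for k
    using h0[of k] h1[of k] by algebra
  have x2y: "z k ^ 2 * w k = (al * ga + be * c) + (al * be + be * b + ga) * z k + (al ^ 2 + be * a) * w k" for k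
    using h0[of k] h1[of k] by algebra
  show ?assoc1
  proof (rule ind, goal_cases)
    case (1 k)
    show ?case using x2y[of k] h0[of k] h1[of k] h2[of k] by algebra
  qed
  show ?assoc2
  proof (rule ind, goal_cases)
    case (1 k)
    show ?case using h0[of k] h1[of k] h2[of k] by algebra
  qed
  show ?third
  proof (rule ind, goal_cases)
    case (1 k)
    show ?case using x3[of k] h0[of k] h3[of k] by algebra
  qed
  show ?fourth
  proof (rule ind, goal_cases)
    case (1 k)
    show ?case using x2y[of k] h1[of k] h4[of k] by algebra
  qed
  have x4: "z k ^ 4 = (a * (al * ga + be * c) + b * (a * ga + b * c) + c * c)
      + (a * (al * be + be * b + ga) + b * (a * be + b ^ 2 + c) + c * b) * z k
      + (a * (al ^ 2 + be * a) + b * (a * al + b * a) + c * a) * w k" for k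
  proof -
    have "z k ^ 4 = a * (z k ^ 2 * w k) + b * z k ^ 3 + c * z k ^ 2" using h0[of k] by algebra
    then show ?thesis unfolding x2y x3 using h0[of k] by algebra
  qed
  have y3: "w k ^ 3 = (pp * rr + qq * ga) + (pp * qq + qq * be + rr * 0) * z k
      + (pp ^ 2 + qq * al + rr) * w k" for k
    using h1[of k] h2[of k] by algebra
  show ?curve
  proof (rule ind, goal_cases)
    case (1 k)
    show ?case using x4[of k] x3[of k] y3[of k] h0[of k] h5[of k] by algebra
  qed
qed

context klein_chart
begin

section \<open>From identities on divisors to identities in \<open>u\<close>\<close>

lemma sigma_nonzero_on_open:
  assumes "open G" "G \<noteq> {}"
  shows "G \<inter> Om \<noteq> {}"
proof
  assume "G \<inter> Om = {}"
  then have "\<sigma> v = 0" if "v \<in> G" for v using that by (auto simp: Om_def)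
  then have "\<sigma> u = 0" for u
    using hol3_identity[of "\<lambda>_. 1" \<sigma> G u] hol_sigma assms by (simp add: hol3_const)
  then show False using sigma_nonzero by blast
qed

text \<open>Sums of Abelian integrals over good triples cover a nonempty open set, part of which
  avoids the zeros of \<sigma>. A holomorphic identity in \<open>u\<close> need therefore be checked
  only at such sums.\<close>

lemma klein_identity:
  assumes "hol3 Om F" "\<And>\<tau>. \<tau> \<in> good \<Longrightarrow> W3 \<tau> \<in> Om \<Longrightarrow> F (W3 \<tau>) = 0"
  shows "\<forall>u\<in>Om. F u = 0"
proof (rule ballI, rule Om_identity[OF assms(1)])
  show "open (W3 ` good \<inter> Om)" using open_W3_image[OF open_good order_refl] open_Om by blast
  show "W3 ` good \<inter> Om \<noteq> {}"
    using sigma_nonzero_on_open[OF open_W3_image[OF open_good order_refl]] good_nonempty by blast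
  show "\<And>u. u \<in> W3 ` good \<inter> Om \<Longrightarrow> F u = 0" using assms(2) by blast
qed auto

lemma hol3_divide_const: "hol3 S f \<Longrightarrow> hol3 S (\<lambda>u. f u / c)"
  unfolding divide_inverse by (intro hol3_mult hol3_const)

text \<open>The products \<open>xy\<close> and \<open>y\<^sup>2\<close>, reduced to the basis \<open>1, x, y\<close> of the functions on the divisor
  \<open>P\<^sub>1 + P\<^sub>2 + P\<^sub>3\<close>, are \<open>ga + be x + al y\<close> and \<open>rr + qq x + pp y\<close>; for \<open>x\<^sup>2\<close> the coefficients are
  \<open>\<wp>\<^sub>1\<^sub>3, \<wp>\<^sub>2\<^sub>3, \<wp>\<^sub>3\<^sub>3\<close>.\<close>

definition "al u = (wp 0 1 1 u + wp 0 0 3 u) / 2"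
definition "be u = (wp 0 2 0 u + wp 0 1 2 u) / 2"
definition "ga u = (wp 1 1 0 u + wp 1 0 2 u) / 2"
definition "pp u = wp 0 0 4 u / 6 + wp 0 1 2 u / 2"
definition "qq u = wp 0 1 3 u / 6 + wp 0 2 1 u / 2"
definition "rr u = wp 1 0 3 u / 6 + wp 1 1 1 u / 2"

lemmas table_defs = al_def be_def ga_def pp_def qq_def rr_def

lemma hol_table: "hol3 Om al" "hol3 Om be" "hol3 Om ga" "hol3 Om pp" "hol3 Om qq" "hol3 Om rr"
  unfolding table_defs[abs_def] by (intro hol3_intros hol3_divide_const hol_wp)+

lemmas hol_rules = hol3_intros hol3_divide_const hol_table hol_wp

text \<open>\<open>klein_coefficients\<close> supplies the facts at the three points,
  \<open>good_independent\<close> makes coefficients comparable, and \<open>klein_identity\<close>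
  removes the reference to the points. From here on the derivation of the relations needs only
  identities between functions of \<open>u\<close>.\<close>

lemma multiplication_relations:
  shows assoc_1: "\<forall>u\<in>Om. al u * ga u + be u * wp 1 0 1 u - (wp 0 0 2 u * rr u + wp 0 1 1 u * ga u) = 0"
  and assoc_x: "\<forall>u\<in>Om. al u * be u + be u * wp 0 1 1 u + ga u - (wp 0 0 2 u * qq u + wp 0 1 1 u * be u) = 0"
  and assoc_y: "\<forall>u\<in>Om. al u ^ 2 + be u * wp 0 0 2 u - (wp 0 0 2 u * pp u + wp 0 1 1 u * al u + wp 1 0 1 u) = 0"
  and assoc2_1: "\<forall>u\<in>Om. al u * rr u + be u * ga u - (pp u * ga u + qq u * wp 1 0 1 u) = 0"
  and assoc2_x: "\<forall>u\<in>Om. al u * qq u + be u ^ 2 - (pp u * be u + qq u * wp 0 1 1 u + rr u) = 0"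
  and curve_1: "\<forall>u\<in>Om. pp u * rr u + qq u * ga u - (wp 0 0 2 u * (al u * ga u + be u * wp 1 0 1 u) + (wp 0 1 1 u + lam 3) * (wp 0 0 2 u * ga u + wp 0 1 1 u * wp 1 0 1 u)
      + (wp 1 0 1 u + lam 2) * wp 1 0 1 u + lam 0) = 0"
  and curve_x: "\<forall>u\<in>Om. pp u * qq u + qq u * be u + rr u * 0 - (wp 0 0 2 u * (al u * be u + be u * wp 0 1 1 u + ga u)
      + (wp 0 1 1 u + lam 3) * (wp 0 0 2 u * be u + wp 0 1 1 u ^ 2 + wp 1 0 1 u) + (wp 1 0 1 u + lam 2) * wp 0 1 1 u + lam 1) = 0"
  and curve_y: "\<forall>u\<in>Om. pp u ^ 2 + qq u * al u + rr u - (wp 0 0 2 u * (al u ^ 2 + be u * wp 0 0 2 u) + (wp 0 1 1 u + lam 3) * (wp 0 0 2 u * al u + wp 0 1 1 u * wp 0 0 2 u)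
      + (wp 1 0 1 u + lam 2) * wp 0 0 2 u) = 0"
  and third_1: "\<forall>u\<in>Om. wp 1 0 4 u / 6 + wp 1 1 2 u + wp 1 2 0 u / 2 - (4 * (wp 0 0 2 u * ga u + wp 0 1 1 u * wp 1 0 1 u) + 3 * lam 3 * wp 1 0 1 u + lam 1) = 0"
  and third_x: "\<forall>u\<in>Om. wp 0 1 4 u / 6 + wp 0 2 2 u + wp 0 3 0 u / 2 - (4 * (wp 0 0 2 u * be u + wp 0 1 1 u ^ 2 + wp 1 0 1 u) + 3 * lam 3 * wp 0 1 1 u + 2 * lam 2) = 0"
  and third_y: "\<forall>u\<in>Om. wp 0 0 5 u / 6 + wp 0 1 3 u + wp 0 2 1 u / 2 - (4 * (wp 0 0 2 u * al u + wp 0 1 1 u * wp 0 0 2 u) + 3 * lam 3 * wp 0 0 2 u) = 0"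
  and fourth_1: "\<forall>u\<in>Om. wp 2 0 0 u + wp 1 0 5 u / 24 + 5 / 12 * wp 1 1 3 u + 5 / 8 * wp 1 2 1 u + lam 3 / 4 * wp 1 0 2 u
      - (5 * (al u * ga u + be u * wp 1 0 1 u) + 3 * lam 3 * ga u) = 0"
  and fourth_x: "\<forall>u\<in>Om. wp 1 1 0 u + wp 0 1 5 u / 24 + 5 / 12 * wp 0 2 3 u + 5 / 8 * wp 0 3 1 u + lam 3 / 4 * wp 0 1 2 u
      - (5 * (al u * be u + be u * wp 0 1 1 u + ga u) + 3 * lam 3 * be u) = 0"
proof -
  {
    fix \<tau> assume \<tau>: "\<tau> \<in> good" and v: "W3 \<tau> \<in> Om"
    have h1: "ga (W3 \<tau>) + be (W3 \<tau>) * cx (\<tau> $ k) + al (W3 \<tau>) * cy (\<tau> $ k) = cx (\<tau> $ k) * cy (\<tau> $ k)" for k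
      using klein_coefficients(2)[OF \<tau> v, of k] unfolding table_defs by algebra
    have h2: "rr (W3 \<tau>) + qq (W3 \<tau>) * cx (\<tau> $ k) + pp (W3 \<tau>) * cy (\<tau> $ k) = cy (\<tau> $ k) ^ 2" for k
      using klein_coefficients(3)[OF \<tau> v, of k] unfolding table_defs by (simp add: field_simps, algebra)
    have h5: "cy (\<tau> $ k) ^ 3 = cx (\<tau> $ k) ^ 4 + lam 3 * cx (\<tau> $ k) ^ 3 + lam 2 * cx (\<tau> $ k) ^ 2
        + lam 1 * cx (\<tau> $ k) + lam 0" for k
      using on_curve[of "\<tau> $ k"] \<tau> by (simp add: good_def quartic_def algebra_simps eval_nat_numeral)
    note multiplication_table[OF good_independent[OF \<tau>] klein_coefficients(1)[OF \<tau> v] h1 h2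
        klein_coefficients(4,5)[OF \<tau> v] h5]
  } note X = this
  show "\<forall>u\<in>Om. al u * ga u + be u * wp 1 0 1 u - (wp 0 0 2 u * rr u + wp 0 1 1 u * ga u) = 0"
    by (rule klein_identity, (intro hol_rules)[1], rule X(1)[THEN conjunct1])
  show "\<forall>u\<in>Om. al u * be u + be u * wp 0 1 1 u + ga u - (wp 0 0 2 u * qq u + wp 0 1 1 u * be u) = 0"
    by (rule klein_identity, (intro hol_rules)[1], rule X(1)[THEN conjunct2, THEN conjunct1])
  show "\<forall>u\<in>Om. al u ^ 2 + be u * wp 0 0 2 u - (wp 0 0 2 u * pp u + wp 0 1 1 u * al u + wp 1 0 1 u) = 0"
    by (rule klein_identity, (intro hol_rules)[1], rule X(1)[THEN conjunct2, THEN conjunct2])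
  show "\<forall>u\<in>Om. al u * rr u + be u * ga u - (pp u * ga u + qq u * wp 1 0 1 u) = 0"
    by (rule klein_identity, (intro hol_rules)[1], rule X(2)[THEN conjunct1])
  show "\<forall>u\<in>Om. al u * qq u + be u ^ 2 - (pp u * be u + qq u * wp 0 1 1 u + rr u) = 0"
    by (rule klein_identity, (intro hol_rules)[1], rule X(2)[THEN conjunct2, THEN conjunct1])
  show "\<forall>u\<in>Om. pp u * rr u + qq u * ga u - (wp 0 0 2 u * (al u * ga u + be u * wp 1 0 1 u) + (wp 0 1 1 u + lam 3) * (wp 0 0 2 u * ga u + wp 0 1 1 u * wp 1 0 1 u)
      + (wp 1 0 1 u + lam 2) * wp 1 0 1 u + lam 0) = 0"
    by (rule klein_identity, (intro hol_rules)[1], rule X(3)[THEN conjunct1])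
  show "\<forall>u\<in>Om. pp u * qq u + qq u * be u + rr u * 0 - (wp 0 0 2 u * (al u * be u + be u * wp 0 1 1 u + ga u)
      + (wp 0 1 1 u + lam 3) * (wp 0 0 2 u * be u + wp 0 1 1 u ^ 2 + wp 1 0 1 u) + (wp 1 0 1 u + lam 2) * wp 0 1 1 u + lam 1) = 0"
    by (rule klein_identity, (intro hol_rules)[1], rule X(3)[THEN conjunct2, THEN conjunct1])
  show "\<forall>u\<in>Om. pp u ^ 2 + qq u * al u + rr u - (wp 0 0 2 u * (al u ^ 2 + be u * wp 0 0 2 u) + (wp 0 1 1 u + lam 3) * (wp 0 0 2 u * al u + wp 0 1 1 u * wp 0 0 2 u)
      + (wp 1 0 1 u + lam 2) * wp 0 0 2 u) = 0"
    by (rule klein_identity, (intro hol_rules)[1], rule X(3)[THEN conjunct2, THEN conjunct2])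
  show "\<forall>u\<in>Om. wp 1 0 4 u / 6 + wp 1 1 2 u + wp 1 2 0 u / 2 - (4 * (wp 0 0 2 u * ga u + wp 0 1 1 u * wp 1 0 1 u) + 3 * lam 3 * wp 1 0 1 u + lam 1) = 0"
    by (rule klein_identity, (intro hol_rules)[1], rule X(4)[THEN conjunct1])
  show "\<forall>u\<in>Om. wp 0 1 4 u / 6 + wp 0 2 2 u + wp 0 3 0 u / 2 - (4 * (wp 0 0 2 u * be u + wp 0 1 1 u ^ 2 + wp 1 0 1 u) + 3 * lam 3 * wp 0 1 1 u + 2 * lam 2) = 0"
    by (rule klein_identity, (intro hol_rules)[1], rule X(4)[THEN conjunct2, THEN conjunct1])
  show "\<forall>u\<in>Om. wp 0 0 5 u / 6 + wp 0 1 3 u + wp 0 2 1 u / 2 - (4 * (wp 0 0 2 u * al u + wp 0 1 1 u * wp 0 0 2 u) + 3 * lam 3 * wp 0 0 2 u) = 0"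
    by (rule klein_identity, (intro hol_rules)[1], rule X(4)[THEN conjunct2, THEN conjunct2])
  show "\<forall>u\<in>Om. wp 2 0 0 u + wp 1 0 5 u / 24 + 5 / 12 * wp 1 1 3 u + 5 / 8 * wp 1 2 1 u + lam 3 / 4 * wp 1 0 2 u
      - (5 * (al u * ga u + be u * wp 1 0 1 u) + 3 * lam 3 * ga u) = 0"
    by (rule klein_identity, (intro hol_rules)[1], rule X(5)[THEN conjunct1])
  show "\<forall>u\<in>Om. wp 1 1 0 u + wp 0 1 5 u / 24 + 5 / 12 * wp 0 2 3 u + 5 / 8 * wp 0 3 1 u + lam 3 / 4 * wp 0 1 2 u
      - (5 * (al u * be u + be u * wp 0 1 1 u + ga u) + 3 * lam 3 * be u) = 0"
    by (rule klein_identity, (intro hol_rules)[1], rule X(5)[THEN conjunct2, THEN conjunct1])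
qed

end

section \<open>The relations\<close>

text \<open>The assumption allows \<open>p333\<close> to be cancelled in \<open>N3333\<close>; it is
  derived from the leading part of \<sigma> in \<open>exists_wp333_nonzero\<close>.\<close>

locale klein_curve = klein_chart +
  assumes wp333_nonzero: "\<exists>v\<in>Om. wp 0 0 3 v \<noteq> 0"
begin

abbreviation p11 where "p11 \<equiv> wp 2 0 0"
abbreviation p12 where "p12 \<equiv> wp 1 1 0"
abbreviation p13 where "p13 \<equiv> wp 1 0 1"
abbreviation p22 where "p22 \<equiv> wp 0 2 0"
abbreviation p23 where "p23 \<equiv> wp 0 1 1"
abbreviation p33 where "p33 \<equiv> wp 0 0 2"
abbreviation p111 where "p111 \<equiv> wp 3 0 0"
abbreviation p112 where "p112 \<equiv> wp 2 1 0"
abbreviation p113 where "p113 \<equiv> wp 2 0 1"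
abbreviation p122 where "p122 \<equiv> wp 1 2 0"
abbreviation p123 where "p123 \<equiv> wp 1 1 1"
abbreviation p133 where "p133 \<equiv> wp 1 0 2"
abbreviation p222 where "p222 \<equiv> wp 0 3 0"
abbreviation p223 where "p223 \<equiv> wp 0 2 1"
abbreviation p233 where "p233 \<equiv> wp 0 1 2"
abbreviation p333 where "p333 \<equiv> wp 0 0 3"
abbreviation p1111 where "p1111 \<equiv> wp 4 0 0"
abbreviation p1112 where "p1112 \<equiv> wp 3 1 0"
abbreviation p1113 where "p1113 \<equiv> wp 3 0 1"
abbreviation p1122 where "p1122 \<equiv> wp 2 2 0"
abbreviation p1123 where "p1123 \<equiv> wp 2 1 1"
abbreviation p1133 where "p1133 \<equiv> wp 2 0 2"
abbreviation p1222 where "p1222 \<equiv> wp 1 3 0"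
abbreviation p1223 where "p1223 \<equiv> wp 1 2 1"
abbreviation p1233 where "p1233 \<equiv> wp 1 1 2"
abbreviation p1333 where "p1333 \<equiv> wp 1 0 3"
abbreviation p2222 where "p2222 \<equiv> wp 0 4 0"
abbreviation p2223 where "p2223 \<equiv> wp 0 3 1"
abbreviation p2233 where "p2233 \<equiv> wp 0 2 2"
abbreviation p2333 where "p2333 \<equiv> wp 0 1 3"
abbreviation p3333 where "p3333 \<equiv> wp 0 0 4"
abbreviation p11112 where "p11112 \<equiv> wp 4 1 0"
abbreviation p11113 where "p11113 \<equiv> wp 4 0 1"
abbreviation p11122 where "p11122 \<equiv> wp 3 2 0"
abbreviation p11123 where "p11123 \<equiv> wp 3 1 1"
abbreviation p11133 where "p11133 \<equiv> wp 3 0 2"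
abbreviation p11222 where "p11222 \<equiv> wp 2 3 0"
abbreviation p11223 where "p11223 \<equiv> wp 2 2 1"
abbreviation p11233 where "p11233 \<equiv> wp 2 1 2"
abbreviation p11333 where "p11333 \<equiv> wp 2 0 3"
abbreviation p12222 where "p12222 \<equiv> wp 1 4 0"
abbreviation p12223 where "p12223 \<equiv> wp 1 3 1"
abbreviation p12233 where "p12233 \<equiv> wp 1 2 2"
abbreviation p12333 where "p12333 \<equiv> wp 1 1 3"
abbreviation p13333 where "p13333 \<equiv> wp 1 0 4"
abbreviation p22233 where "p22233 \<equiv> wp 0 3 2"
abbreviation p22333 where "p22333 \<equiv> wp 0 2 3"
abbreviation p23333 where "p23333 \<equiv> wp 0 1 4"
abbreviation p33333 where "p33333 \<equiv> wp 0 0 5"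
abbreviation p133333 where "p133333 \<equiv> wp 1 0 5"
abbreviation p233333 where "p233333 \<equiv> wp 0 1 5"

lemma p333_nonzero: "\<exists>v\<in>Om. p333 v \<noteq> 0" by (rule wp333_nonzero)

lemma wp_d:
  "u \<in> Om \<Longrightarrow> ((\<lambda>z. p11 (u + z *s axis 1 1)) has_field_derivative p111 u) (at 0)"
  "u \<in> Om \<Longrightarrow> ((\<lambda>z. p11 (u + z *s axis 2 1)) has_field_derivative p112 u) (at 0)"
  "u \<in> Om \<Longrightarrow> ((\<lambda>z. p11 (u + z *s axis 3 1)) has_field_derivative p113 u) (at 0)"
  "u \<in> Om \<Longrightarrow> ((\<lambda>z. p12 (u + z *s axis 1 1)) has_field_derivative p112 u) (at 0)"
  "u \<in> Om \<Longrightarrow> ((\<lambda>z. p12 (u + z *s axis 2 1)) has_field_derivative p122 u) (at 0)"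
  "u \<in> Om \<Longrightarrow> ((\<lambda>z. p12 (u + z *s axis 3 1)) has_field_derivative p123 u) (at 0)"
  "u \<in> Om \<Longrightarrow> ((\<lambda>z. p13 (u + z *s axis 1 1)) has_field_derivative p113 u) (at 0)"
  "u \<in> Om \<Longrightarrow> ((\<lambda>z. p13 (u + z *s axis 2 1)) has_field_derivative p123 u) (at 0)"
  "u \<in> Om \<Longrightarrow> ((\<lambda>z. p13 (u + z *s axis 3 1)) has_field_derivative p133 u) (at 0)"
  "u \<in> Om \<Longrightarrow> ((\<lambda>z. p22 (u + z *s axis 1 1)) has_field_derivative p122 u) (at 0)"
  "u \<in> Om \<Longrightarrow> ((\<lambda>z. p22 (u + z *s axis 2 1)) has_field_derivative p222 u) (at 0)"
  "u \<in> Om \<Longrightarrow> ((\<lambda>z. p22 (u + z *s axis 3 1)) has_field_derivative p223 u) (at 0)"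
  "u \<in> Om \<Longrightarrow> ((\<lambda>z. p23 (u + z *s axis 1 1)) has_field_derivative p123 u) (at 0)"
  "u \<in> Om \<Longrightarrow> ((\<lambda>z. p23 (u + z *s axis 2 1)) has_field_derivative p223 u) (at 0)"
  "u \<in> Om \<Longrightarrow> ((\<lambda>z. p23 (u + z *s axis 3 1)) has_field_derivative p233 u) (at 0)"
  "u \<in> Om \<Longrightarrow> ((\<lambda>z. p33 (u + z *s axis 1 1)) has_field_derivative p133 u) (at 0)"
  "u \<in> Om \<Longrightarrow> ((\<lambda>z. p33 (u + z *s axis 2 1)) has_field_derivative p233 u) (at 0)"
  "u \<in> Om \<Longrightarrow> ((\<lambda>z. p33 (u + z *s axis 3 1)) has_field_derivative p333 u) (at 0)"
  "u \<in> Om \<Longrightarrow> ((\<lambda>z. p111 (u + z *s axis 1 1)) has_field_derivative p1111 u) (at 0)"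
  "u \<in> Om \<Longrightarrow> ((\<lambda>z. p111 (u + z *s axis 2 1)) has_field_derivative p1112 u) (at 0)"
  "u \<in> Om \<Longrightarrow> ((\<lambda>z. p111 (u + z *s axis 3 1)) has_field_derivative p1113 u) (at 0)"
  "u \<in> Om \<Longrightarrow> ((\<lambda>z. p112 (u + z *s axis 1 1)) has_field_derivative p1112 u) (at 0)"
  "u \<in> Om \<Longrightarrow> ((\<lambda>z. p112 (u + z *s axis 2 1)) has_field_derivative p1122 u) (at 0)"
  "u \<in> Om \<Longrightarrow> ((\<lambda>z. p112 (u + z *s axis 3 1)) has_field_derivative p1123 u) (at 0)"
  "u \<in> Om \<Longrightarrow> ((\<lambda>z. p113 (u + z *s axis 1 1)) has_field_derivative p1113 u) (at 0)"
  "u \<in> Om \<Longrightarrow> ((\<lambda>z. p113 (u + z *s axis 2 1)) has_field_derivative p1123 u) (at 0)"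
  "u \<in> Om \<Longrightarrow> ((\<lambda>z. p113 (u + z *s axis 3 1)) has_field_derivative p1133 u) (at 0)"
  "u \<in> Om \<Longrightarrow> ((\<lambda>z. p122 (u + z *s axis 1 1)) has_field_derivative p1122 u) (at 0)"
  "u \<in> Om \<Longrightarrow> ((\<lambda>z. p122 (u + z *s axis 2 1)) has_field_derivative p1222 u) (at 0)"
  "u \<in> Om \<Longrightarrow> ((\<lambda>z. p122 (u + z *s axis 3 1)) has_field_derivative p1223 u) (at 0)"
  "u \<in> Om \<Longrightarrow> ((\<lambda>z. p123 (u + z *s axis 1 1)) has_field_derivative p1123 u) (at 0)"
  "u \<in> Om \<Longrightarrow> ((\<lambda>z. p123 (u + z *s axis 2 1)) has_field_derivative p1223 u) (at 0)"
  "u \<in> Om \<Longrightarrow> ((\<lambda>z. p123 (u + z *s axis 3 1)) has_field_derivative p1233 u) (at 0)"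
  "u \<in> Om \<Longrightarrow> ((\<lambda>z. p133 (u + z *s axis 1 1)) has_field_derivative p1133 u) (at 0)"
  "u \<in> Om \<Longrightarrow> ((\<lambda>z. p133 (u + z *s axis 2 1)) has_field_derivative p1233 u) (at 0)"
  "u \<in> Om \<Longrightarrow> ((\<lambda>z. p133 (u + z *s axis 3 1)) has_field_derivative p1333 u) (at 0)"
  "u \<in> Om \<Longrightarrow> ((\<lambda>z. p222 (u + z *s axis 1 1)) has_field_derivative p1222 u) (at 0)"
  "u \<in> Om \<Longrightarrow> ((\<lambda>z. p222 (u + z *s axis 2 1)) has_field_derivative p2222 u) (at 0)"
  "u \<in> Om \<Longrightarrow> ((\<lambda>z. p222 (u + z *s axis 3 1)) has_field_derivative p2223 u) (at 0)"
  "u \<in> Om \<Longrightarrow> ((\<lambda>z. p223 (u + z *s axis 1 1)) has_field_derivative p1223 u) (at 0)"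
  "u \<in> Om \<Longrightarrow> ((\<lambda>z. p223 (u + z *s axis 2 1)) has_field_derivative p2223 u) (at 0)"
  "u \<in> Om \<Longrightarrow> ((\<lambda>z. p223 (u + z *s axis 3 1)) has_field_derivative p2233 u) (at 0)"
  "u \<in> Om \<Longrightarrow> ((\<lambda>z. p233 (u + z *s axis 1 1)) has_field_derivative p1233 u) (at 0)"
  "u \<in> Om \<Longrightarrow> ((\<lambda>z. p233 (u + z *s axis 2 1)) has_field_derivative p2233 u) (at 0)"
  "u \<in> Om \<Longrightarrow> ((\<lambda>z. p233 (u + z *s axis 3 1)) has_field_derivative p2333 u) (at 0)"
  "u \<in> Om \<Longrightarrow> ((\<lambda>z. p333 (u + z *s axis 1 1)) has_field_derivative p1333 u) (at 0)"
  "u \<in> Om \<Longrightarrow> ((\<lambda>z. p333 (u + z *s axis 2 1)) has_field_derivative p2333 u) (at 0)"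
  "u \<in> Om \<Longrightarrow> ((\<lambda>z. p333 (u + z *s axis 3 1)) has_field_derivative p3333 u) (at 0)"
  "u \<in> Om \<Longrightarrow> ((\<lambda>z. p1111 (u + z *s axis 2 1)) has_field_derivative p11112 u) (at 0)"
  "u \<in> Om \<Longrightarrow> ((\<lambda>z. p1111 (u + z *s axis 3 1)) has_field_derivative p11113 u) (at 0)"
  "u \<in> Om \<Longrightarrow> ((\<lambda>z. p1112 (u + z *s axis 1 1)) has_field_derivative p11112 u) (at 0)"
  "u \<in> Om \<Longrightarrow> ((\<lambda>z. p1112 (u + z *s axis 2 1)) has_field_derivative p11122 u) (at 0)"
  "u \<in> Om \<Longrightarrow> ((\<lambda>z. p1112 (u + z *s axis 3 1)) has_field_derivative p11123 u) (at 0)"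
  "u \<in> Om \<Longrightarrow> ((\<lambda>z. p1113 (u + z *s axis 1 1)) has_field_derivative p11113 u) (at 0)"
  "u \<in> Om \<Longrightarrow> ((\<lambda>z. p1113 (u + z *s axis 2 1)) has_field_derivative p11123 u) (at 0)"
  "u \<in> Om \<Longrightarrow> ((\<lambda>z. p1113 (u + z *s axis 3 1)) has_field_derivative p11133 u) (at 0)"
  "u \<in> Om \<Longrightarrow> ((\<lambda>z. p1122 (u + z *s axis 1 1)) has_field_derivative p11122 u) (at 0)"
  "u \<in> Om \<Longrightarrow> ((\<lambda>z. p1122 (u + z *s axis 2 1)) has_field_derivative p11222 u) (at 0)"
  "u \<in> Om \<Longrightarrow> ((\<lambda>z. p1122 (u + z *s axis 3 1)) has_field_derivative p11223 u) (at 0)"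
  "u \<in> Om \<Longrightarrow> ((\<lambda>z. p1123 (u + z *s axis 1 1)) has_field_derivative p11123 u) (at 0)"
  "u \<in> Om \<Longrightarrow> ((\<lambda>z. p1123 (u + z *s axis 2 1)) has_field_derivative p11223 u) (at 0)"
  "u \<in> Om \<Longrightarrow> ((\<lambda>z. p1123 (u + z *s axis 3 1)) has_field_derivative p11233 u) (at 0)"
  "u \<in> Om \<Longrightarrow> ((\<lambda>z. p1133 (u + z *s axis 1 1)) has_field_derivative p11133 u) (at 0)"
  "u \<in> Om \<Longrightarrow> ((\<lambda>z. p1133 (u + z *s axis 2 1)) has_field_derivative p11233 u) (at 0)"
  "u \<in> Om \<Longrightarrow> ((\<lambda>z. p1133 (u + z *s axis 3 1)) has_field_derivative p11333 u) (at 0)"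
  "u \<in> Om \<Longrightarrow> ((\<lambda>z. p1222 (u + z *s axis 1 1)) has_field_derivative p11222 u) (at 0)"
  "u \<in> Om \<Longrightarrow> ((\<lambda>z. p1222 (u + z *s axis 2 1)) has_field_derivative p12222 u) (at 0)"
  "u \<in> Om \<Longrightarrow> ((\<lambda>z. p1222 (u + z *s axis 3 1)) has_field_derivative p12223 u) (at 0)"
  "u \<in> Om \<Longrightarrow> ((\<lambda>z. p1223 (u + z *s axis 1 1)) has_field_derivative p11223 u) (at 0)"
  "u \<in> Om \<Longrightarrow> ((\<lambda>z. p1223 (u + z *s axis 2 1)) has_field_derivative p12223 u) (at 0)"
  "u \<in> Om \<Longrightarrow> ((\<lambda>z. p1223 (u + z *s axis 3 1)) has_field_derivative p12233 u) (at 0)"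
  "u \<in> Om \<Longrightarrow> ((\<lambda>z. p1233 (u + z *s axis 1 1)) has_field_derivative p11233 u) (at 0)"
  "u \<in> Om \<Longrightarrow> ((\<lambda>z. p1233 (u + z *s axis 2 1)) has_field_derivative p12233 u) (at 0)"
  "u \<in> Om \<Longrightarrow> ((\<lambda>z. p1233 (u + z *s axis 3 1)) has_field_derivative p12333 u) (at 0)"
  "u \<in> Om \<Longrightarrow> ((\<lambda>z. p1333 (u + z *s axis 1 1)) has_field_derivative p11333 u) (at 0)"
  "u \<in> Om \<Longrightarrow> ((\<lambda>z. p1333 (u + z *s axis 2 1)) has_field_derivative p12333 u) (at 0)"
  "u \<in> Om \<Longrightarrow> ((\<lambda>z. p1333 (u + z *s axis 3 1)) has_field_derivative p13333 u) (at 0)"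
  "u \<in> Om \<Longrightarrow> ((\<lambda>z. p2222 (u + z *s axis 1 1)) has_field_derivative p12222 u) (at 0)"
  "u \<in> Om \<Longrightarrow> ((\<lambda>z. p2223 (u + z *s axis 1 1)) has_field_derivative p12223 u) (at 0)"
  "u \<in> Om \<Longrightarrow> ((\<lambda>z. p2223 (u + z *s axis 3 1)) has_field_derivative p22233 u) (at 0)"
  "u \<in> Om \<Longrightarrow> ((\<lambda>z. p2233 (u + z *s axis 1 1)) has_field_derivative p12233 u) (at 0)"
  "u \<in> Om \<Longrightarrow> ((\<lambda>z. p2233 (u + z *s axis 2 1)) has_field_derivative p22233 u) (at 0)"
  "u \<in> Om \<Longrightarrow> ((\<lambda>z. p2233 (u + z *s axis 3 1)) has_field_derivative p22333 u) (at 0)"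
  "u \<in> Om \<Longrightarrow> ((\<lambda>z. p2333 (u + z *s axis 1 1)) has_field_derivative p12333 u) (at 0)"
  "u \<in> Om \<Longrightarrow> ((\<lambda>z. p2333 (u + z *s axis 2 1)) has_field_derivative p22333 u) (at 0)"
  "u \<in> Om \<Longrightarrow> ((\<lambda>z. p2333 (u + z *s axis 3 1)) has_field_derivative p23333 u) (at 0)"
  "u \<in> Om \<Longrightarrow> ((\<lambda>z. p3333 (u + z *s axis 1 1)) has_field_derivative p13333 u) (at 0)"
  "u \<in> Om \<Longrightarrow> ((\<lambda>z. p3333 (u + z *s axis 2 1)) has_field_derivative p23333 u) (at 0)"
  "u \<in> Om \<Longrightarrow> ((\<lambda>z. p3333 (u + z *s axis 3 1)) has_field_derivative p33333 u) (at 0)"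
  "u \<in> Om \<Longrightarrow> ((\<lambda>z. p13333 (u + z *s axis 3 1)) has_field_derivative p133333 u) (at 0)"
  "u \<in> Om \<Longrightarrow> ((\<lambda>z. p23333 (u + z *s axis 3 1)) has_field_derivative p233333 u) (at 0)"
  "u \<in> Om \<Longrightarrow> ((\<lambda>z. p33333 (u + z *s axis 1 1)) has_field_derivative p133333 u) (at 0)"
  "u \<in> Om \<Longrightarrow> ((\<lambda>z. p33333 (u + z *s axis 2 1)) has_field_derivative p233333 u) (at 0)"
  using wp_deriv[of u] by (simp_all add: eval_nat_numeral)

section \<open>Even and odd parts of the multiplication table\<close>

lemma N1233: "u \<in> Om \<Longrightarrow> p1233 u - 3 * lam 3 * p13 u - 2 * p12 u * p33 u - 4 * p13 u * p23 u - lam 1 = 0"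
proof -
  assume u: "u \<in> Om"
  show ?thesis
    \<comment> \<open>Half the sum of the identity at \<open>u\<close> and at \<open>- u\<close>
      keeps the terms of even parity, half the difference those of odd parity. Each lemma down to
      \<open>curve_1_odd\<close> is one such half.\<close>
    using third_1[rule_format, OF u]
      third_1[rule_format, OF minus_Om[OF u]]
    unfolding table_defs by (simp add: wp_reflect[OF u]) (simp add: field_simps, algebra)
qed

lemma N2233: "u \<in> Om \<Longrightarrow> p2233 u - 4 * p13 u - 3 * lam 3 * p23 u - 2 * p22 u * p33 u - 4 * p23 u ^ 2 - 2 * lam 2 = 0"
proof -
  assume u: "u \<in> Om"
  show ?thesis
    using third_x[rule_format, OF u]
      third_x[rule_format, OF minus_Om[OF u]]
    unfolding table_defs by (simp add: wp_reflect[OF u]) (simp add: field_simps, algebra)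
qed

lemma N2333: "u \<in> Om \<Longrightarrow> p2333 u - 3 * lam 3 * p33 u - 6 * p23 u * p33 u = 0"
proof -
  assume u: "u \<in> Om"
  show ?thesis
    using third_y[rule_format, OF u]
      third_y[rule_format, OF minus_Om[OF u]]
    unfolding table_defs by (simp add: wp_reflect[OF u]) (simp add: field_simps, algebra)
qed

lemma third_y_odd: "u \<in> Om \<Longrightarrow> p33333 u + 3 * p223 u - 12 * p33 u * p333 u = 0"
proof -
  assume u: "u \<in> Om"
  show ?thesis
    using third_y[rule_format, OF u]
      third_y[rule_format, OF minus_Om[OF u]]
    unfolding table_defs by (simp add: wp_reflect[OF u]) (simp add: field_simps, algebra)
qed

lemma fourth_1_even: "u \<in> Om \<Longrightarrow> p133333 u + 15 * p1223 u - 30 * p133 u * p333 u + 24 * p11 u - 36 * lam 3 * p12 u - 30 * p12 u * p23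
      u - 60 * p13 u * p22 u = 0"
proof -
  assume u: "u \<in> Om"
  show ?thesis
    using fourth_1[rule_format, OF u]
      fourth_1[rule_format, OF minus_Om[OF u]]
    unfolding table_defs by (simp add: wp_reflect[OF u]) (simp add: field_simps, algebra)
qed

lemma fourth_x_even: "u \<in> Om \<Longrightarrow> p233333 u + 15 * p2223 u - 30 * p233 u * p333 u - 36 * p12 u - 36 * lam 3 * p22 u - 90 * p22 u * p23
      u = 0"
proof -
  assume u: "u \<in> Om"
  show ?thesis
    using fourth_x[rule_format, OF u]
      fourth_x[rule_format, OF minus_Om[OF u]]
    unfolding table_defs by (simp add: wp_reflect[OF u]) (simp add: field_simps, algebra)
qed

lemma assoc_1_even: "u \<in> Om \<Longrightarrow> - 2 * p33 u * p1333 u + 3 * p133 u * p333 u - 3 * p12 u * p23 u + 6 * p13 u * p22 u = 0"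
proof -
  assume u: "u \<in> Om"
  show ?thesis
    using assoc_1[rule_format, OF u]
      assoc_1[rule_format, OF minus_Om[OF u]]
    unfolding table_defs by (simp add: wp_reflect[OF u]) (simp add: field_simps, algebra)
qed

lemma assoc_x_even: "u \<in> Om \<Longrightarrow> - 2 * p33 u * p2333 u + 3 * p233 u * p333 u + 6 * p12 u + 3 * p22 u * p23 u = 0"
proof -
  assume u: "u \<in> Om"
  show ?thesis
    using assoc_x[rule_format, OF u]
      assoc_x[rule_format, OF minus_Om[OF u]]
    unfolding table_defs by (simp add: wp_reflect[OF u]) (simp add: field_simps, algebra)
qed

lemma assoc_y_even: "u \<in> Om \<Longrightarrow> - 2 * p33 u * p3333 u + 3 * p333 u ^ 2 - 12 * p13 u + 6 * p22 u * p33 u - 3 * p23 u ^ 2 = 0"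
proof -
  assume u: "u \<in> Om"
  show ?thesis
    using assoc_y[rule_format, OF u]
      assoc_y[rule_format, OF minus_Om[OF u]]
    unfolding table_defs by (simp add: wp_reflect[OF u]) (simp add: field_simps, algebra)
qed

lemma curve_1_even: "u \<in> Om \<Longrightarrow> 3 * p12 u * p2333 u + p1333 u * p3333 u + 9 * p123 u * p233 u + 9 * p133 u * p223 u - 9 * p33 u *
      p133 u * p333 u - 36 * lam 2 * p13 u - 36 * p13 u ^ 2 - 18 * lam 3 * p12 u * p33 u - 36 * lam 3 *
      p13 u * p23 u - 27 * p12 u * p23 u * p33 u - 18 * p13 u * p22 u * p33 u - 36 * p13 u * p23 u ^ 2 -
      36 * lam 0 = 0"
proof -
  assume u: "u \<in> Om"
  show ?thesis
    using curve_1[rule_format, OF u]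
      curve_1[rule_format, OF minus_Om[OF u]]
    unfolding table_defs by (simp add: wp_reflect[OF u]) (simp add: field_simps, algebra)
qed

lemma curve_1_odd: "u \<in> Om \<Longrightarrow> p123 u * p3333 u + p133 u * p2333 u + p233 u * p1333 u + 3 * p12 u * p223 u - 6 * lam 3 * p33 u *
      p133 u - 3 * p12 u * p33 u * p333 u - 6 * p13 u * p33 u * p233 u - 9 * p23 u * p33 u * p133 u = 0"
proof -
  assume u: "u \<in> Om"
  show ?thesis
    using curve_1[rule_format, OF u]
      curve_1[rule_format, OF minus_Om[OF u]]
    unfolding table_defs by (simp add: wp_reflect[OF u]) (simp add: field_simps, algebra)
qed

section \<open>Elimination: bilinear relations and four-index equations in alternation\<close>

lemma rel2: "u \<in> Om \<Longrightarrow> 2 * p133 u + p22 u * p333 u + p23 u * p233 u - 2 * p33 u * p223 u = 0"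
proof -
  assume u: "u \<in> Om"
  \<comment> \<open>Two expressions for the same function \<open>p22333\<close>, one from
    \<open>N2333\<close> and one from \<open>N2233\<close>; their difference is bilinear. This
    pattern recurs throughout.\<close>
  have d1: "p22333 u - 3 * lam 3 * p233 u - 6 * p23 u * p233 u - 6 * p33 u * p223 u = 0"
    by (rule Om_differentiate[where i = 2, OF N2333 u])
      (auto intro!: derivative_eq_intros wp_d u simp: algebra_simps power2_eq_square simp del: One_nat_def)
  have d2: "p22333 u - 4 * p133 u - 3 * lam 3 * p233 u - 2 * p22 u * p333 u - 8 * p23 u * p233 u - 2 * p33 u *
      p223 u = 0"
    by (rule Om_differentiate[where i = 3, OF N2233 u])
      (auto intro!: derivative_eq_intros wp_d u simp: algebra_simps power2_eq_square simp del: One_nat_def)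
  show ?thesis
    using d1 d2
    by algebra
qed

text \<open>The derivative of \<open>assoc_y_even\<close> in direction 3 contains
  \<open>p33333\<close>, which \<open>third_y_odd\<close> removes. After \<open>rel2\<close> has
  absorbed the other bilinear terms, \<open>p333\<close> is a common factor.\<close>

lemma N3333_times: "u \<in> Om \<Longrightarrow> p333 u * p3333 u + 3 * p22 u * p333 u - 6 * p33 u ^ 2 * p333 u = 0"
proof -
  assume u: "u \<in> Om"
  have d1: "- 2 * p33 u * p33333 u + 4 * p333 u * p3333 u - 12 * p133 u + 6 * p22 u * p333 u - 6 * p23 u * p233
      u + 6 * p33 u * p223 u = 0"
    by (rule Om_differentiate[where i = 3, OF assoc_y_even u])
      (auto intro!: derivative_eq_intros wp_d u simp: algebra_simps power2_eq_square simp del: One_nat_def)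
  show ?thesis
    using third_y_odd[OF u] d1 rel2[OF u]
    by algebra
qed

lemma N3333: "u \<in> Om \<Longrightarrow> p3333 u + 3 * p22 u - 6 * p33 u ^ 2 = 0"
proof -
  assume u: "u \<in> Om"
  obtain v where v: "v \<in> Om" "p333 v \<noteq> 0" using p333_nonzero by blast
  show ?thesis
    by (rule Om_no_zero_divisors[where F = p333 and H = "\<lambda>u. p3333 u + 3 * p22 u - 6 * p33 u ^ 2", OF hol_wp _ _ v u])
      ((intro hol_rules)[1], use N3333_times in \<open>simp add: algebra_simps\<close>)
qed

lemma rel1: "u \<in> Om \<Longrightarrow> p222 u + lam 3 * p333 u + 2 * p23 u * p333 u - 2 * p33 u * p233 u = 0"
proof -
  assume u: "u \<in> Om"
  have d1: "p23333 u + 3 * p222 u - 12 * p33 u * p233 u = 0"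
    by (rule Om_differentiate[where i = 2, OF N3333 u])
      (auto intro!: derivative_eq_intros wp_d u simp: algebra_simps power2_eq_square simp del: One_nat_def)
  have d2: "p23333 u - 3 * lam 3 * p333 u - 6 * p23 u * p333 u - 6 * p33 u * p233 u = 0"
    by (rule Om_differentiate[where i = 3, OF N2333 u])
      (auto intro!: derivative_eq_intros wp_d u simp: algebra_simps power2_eq_square simp del: One_nat_def)
  show ?thesis
    using d1 d2
    by algebra
qed

lemma S13333: "u \<in> Om \<Longrightarrow> p13333 u + 3 * p122 u - 12 * p33 u * p133 u = 0"
  by (rule Om_differentiate[where i = 1, OF N3333], assumption, assumption)
    (auto intro!: derivative_eq_intros wp_d simp: algebra_simps power2_eq_square simp del: One_nat_def)

lemma S23333: "u \<in> Om \<Longrightarrow> p23333 u + 3 * p222 u - 12 * p33 u * p233 u = 0"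
  by (rule Om_differentiate[where i = 2, OF N3333], assumption, assumption)
    (auto intro!: derivative_eq_intros wp_d simp: algebra_simps power2_eq_square simp del: One_nat_def)

text \<open>The six-index function \<open>p233333\<close> has two expressions:
  \<open>fourth_x_even\<close> and the second derivative of \<open>N3333\<close> in directions 2 and
  3. In their difference \<open>assoc_x_even\<close> removes the products \<open>p33 * p2333\<close>
  and \<open>p233 * p333\<close>. The equation for \<open>p1223\<close> arises in the same
  way.\<close>

lemma N2223: "u \<in> Om \<Longrightarrow> p2223 u - 3 * lam 3 * p22 u - 6 * p22 u * p23 u = 0"
proof -
  assume u: "u \<in> Om"
  have d1: "p233333 u + 3 * p2223 u - 12 * p33 u * p2333 u - 12 * p233 u * p333 u = 0"
    by (rule Om_differentiate[where i = 3, OF S23333 u])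
      (auto intro!: derivative_eq_intros wp_d u simp: algebra_simps power2_eq_square simp del: One_nat_def)
  show ?thesis
    using fourth_x_even[OF u] assoc_x_even[OF u] d1
    by algebra
qed

lemma N1223: "u \<in> Om \<Longrightarrow> p1223 u + 2 * p11 u - 3 * lam 3 * p12 u - 4 * p12 u * p23 u - 2 * p13 u * p22 u = 0"
proof -
  assume u: "u \<in> Om"
  have d1: "p133333 u + 3 * p1223 u - 12 * p33 u * p1333 u - 12 * p133 u * p333 u = 0"
    by (rule Om_differentiate[where i = 3, OF S13333 u])
      (auto intro!: derivative_eq_intros wp_d u simp: algebra_simps power2_eq_square simp del: One_nat_def)
  show ?thesis
    using d1 fourth_1_even[OF u] assoc_1_even[OF u]
    by algebra
qed

lemma rel3: "u \<in> Om \<Longrightarrow> - 2 * p123 u + 2 * p22 u * p233 u - p23 u * p223 u - p33 u * p222 u = 0"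
proof -
  assume u: "u \<in> Om"
  have d1: "p22233 u - 4 * p123 u - 3 * lam 3 * p223 u - 2 * p22 u * p233 u - 8 * p23 u * p223 u - 2 * p33 u *
      p222 u = 0"
    by (rule Om_differentiate[where i = 2, OF N2233 u])
      (auto intro!: derivative_eq_intros wp_d u simp: algebra_simps power2_eq_square simp del: One_nat_def)
  have d2: "p22233 u - 3 * lam 3 * p223 u - 6 * p22 u * p233 u - 6 * p23 u * p223 u = 0"
    by (rule Om_differentiate[where i = 3, OF N2223 u])
      (auto intro!: derivative_eq_intros wp_d u simp: algebra_simps power2_eq_square simp del: One_nat_def)
  show ?thesis
    using d1 d2
    by algebra
qed

lemma rel5: "u \<in> Om \<Longrightarrow> - p12 u * p333 u - 2 * p13 u * p233 u + p23 u * p133 u + 2 * p33 u * p123 u = 0"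
proof -
  assume u: "u \<in> Om"
  have d1: "p12333 u - 3 * lam 3 * p133 u - 2 * p12 u * p333 u - 4 * p13 u * p233 u - 4 * p23 u * p133 u - 2 *
      p33 u * p123 u = 0"
    by (rule Om_differentiate[where i = 3, OF N1233 u])
      (auto intro!: derivative_eq_intros wp_d u simp: algebra_simps power2_eq_square simp del: One_nat_def)
  have d2: "p12333 u - 3 * lam 3 * p133 u - 6 * p23 u * p133 u - 6 * p33 u * p123 u = 0"
    by (rule Om_differentiate[where i = 1, OF N2333 u])
      (auto intro!: derivative_eq_intros wp_d u simp: algebra_simps power2_eq_square simp del: One_nat_def)
  show ?thesis
    using d1 d2
    by algebra
qed

text \<open>There are three expressions for \<open>p12233\<close>, from \<open>N1233\<close>,
  \<open>N1223\<close> and \<open>N2233\<close>. Their differences account for this relation and for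
  \<open>rel7\<close>.\<close>

lemma rel6: "u \<in> Om \<Longrightarrow> 4 * p113 u - 3 * p12 u * p233 u - p22 u * p133 u + 2 * p23 u * p123 u + 2 * p33 u * p122 u = 0"
proof -
  assume u: "u \<in> Om"
  have d1: "p12233 u - 3 * lam 3 * p123 u - 2 * p12 u * p233 u - 4 * p13 u * p223 u - 4 * p23 u * p123 u - 2 *
      p33 u * p122 u = 0"
    by (rule Om_differentiate[where i = 2, OF N1233 u])
      (auto intro!: derivative_eq_intros wp_d u simp: algebra_simps power2_eq_square simp del: One_nat_def)
  have d2: "p12233 u + 2 * p113 u - 3 * lam 3 * p123 u - 4 * p12 u * p233 u - 2 * p13 u * p223 u - 2 * p22 u *
      p133 u - 4 * p23 u * p123 u = 0"
    by (rule Om_differentiate[where i = 3, OF N1223 u])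
      (auto intro!: derivative_eq_intros wp_d u simp: algebra_simps power2_eq_square simp del: One_nat_def)
  have d3: "p12233 u - 4 * p113 u - 3 * lam 3 * p123 u - 2 * p22 u * p133 u - 8 * p23 u * p123 u - 2 * p33 u *
      p122 u = 0"
    by (rule Om_differentiate[where i = 1, OF N2233 u])
      (auto intro!: derivative_eq_intros wp_d u simp: algebra_simps power2_eq_square simp del: One_nat_def)
  show ?thesis
    using d1 d2 d3
    by algebra
qed

lemma rel7: "u \<in> Om \<Longrightarrow> p113 u - 3 * p13 u * p223 u + 2 * p22 u * p133 u + 2 * p23 u * p123 u - p33 u * p122 u = 0"
proof -
  assume u: "u \<in> Om"
  have d1: "p12233 u - 3 * lam 3 * p123 u - 2 * p12 u * p233 u - 4 * p13 u * p223 u - 4 * p23 u * p123 u - 2 *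
      p33 u * p122 u = 0"
    by (rule Om_differentiate[where i = 2, OF N1233 u])
      (auto intro!: derivative_eq_intros wp_d u simp: algebra_simps power2_eq_square simp del: One_nat_def)
  have d2: "p12233 u + 2 * p113 u - 3 * lam 3 * p123 u - 4 * p12 u * p233 u - 2 * p13 u * p223 u - 2 * p22 u *
      p133 u - 4 * p23 u * p123 u = 0"
    by (rule Om_differentiate[where i = 3, OF N1223 u])
      (auto intro!: derivative_eq_intros wp_d u simp: algebra_simps power2_eq_square simp del: One_nat_def)
  have d3: "p12233 u - 4 * p113 u - 3 * lam 3 * p123 u - 2 * p22 u * p133 u - 8 * p23 u * p123 u - 2 * p33 u *
      p122 u = 0"
    by (rule Om_differentiate[where i = 1, OF N2233 u])
      (auto intro!: derivative_eq_intros wp_d u simp: algebra_simps power2_eq_square simp del: One_nat_def)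
  show ?thesis
    using d1 d2 d3
    by algebra
qed

lemma rel9_2rel8: "u \<in> Om \<Longrightarrow> - p112 u + 2 * p12 u * p223 u + p13 u * p222 u - 2 * p22 u * p123 u - p23 u * p122 u = 0"
proof -
  assume u: "u \<in> Om"
  have d1: "p12223 u - 3 * lam 3 * p122 u - 6 * p22 u * p123 u - 6 * p23 u * p122 u = 0"
    by (rule Om_differentiate[where i = 1, OF N2223 u])
      (auto intro!: derivative_eq_intros wp_d u simp: algebra_simps power2_eq_square simp del: One_nat_def)
  have d2: "p12223 u + 2 * p112 u - 3 * lam 3 * p122 u - 4 * p12 u * p223 u - 2 * p13 u * p222 u - 2 * p22 u *
      p123 u - 4 * p23 u * p122 u = 0"
    by (rule Om_differentiate[where i = 2, OF N1223 u])
      (auto intro!: derivative_eq_intros wp_d u simp: algebra_simps power2_eq_square simp del: One_nat_def)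
  show ?thesis
    using d1 d2
    by algebra
qed

text \<open>The source is a differentiated associativity law. Substituting the four-index equations
  leaves trilinear terms, which are multiples of \<open>rel2\<close> by \<open>p33\<close> and of
  \<open>rel1\<close> by \<open>p23\<close>.\<close>

lemma rel4: "u \<in> Om \<Longrightarrow> 4 * p122 u + 4 * lam 2 * p333 u - lam 3 * p222 u + 8 * p13 u * p333 u + 2 * p22 u * p223 u - 2 * p23
      u * p222 u - 8 * p33 u * p133 u - lam 3 ^ 2 * p333 u = 0"
proof -
  assume u: "u \<in> Om"
  have d1: "- 2 * p33 u * p22333 u + p233 u * p2333 u + 3 * p333 u * p2233 u + 6 * p122 u + 3 * p22 u * p223 u +
      3 * p23 u * p222 u = 0"
    by (rule Om_differentiate[where i = 2, OF assoc_x_even u])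
      (auto intro!: derivative_eq_intros wp_d u simp: algebra_simps power2_eq_square simp del: One_nat_def)
  have d2: "p22333 u - 3 * lam 3 * p233 u - 6 * p23 u * p233 u - 6 * p33 u * p223 u = 0"
    by (rule Om_differentiate[where i = 2, OF N2333 u])
      (auto intro!: derivative_eq_intros wp_d u simp: algebra_simps power2_eq_square simp del: One_nat_def)
  show ?thesis
    using rel1[OF u] rel2[OF u] d1 d2 N2233[OF u] N2333[OF u]
    by algebra
qed

text \<open>Mixed derivatives have so far produced only the combination in
  \<open>rel9_2rel8\<close>. The curve equation, through \<open>curve_1_odd\<close>, separates its
  two constituents.\<close>

lemma rel8: "u \<in> Om \<Longrightarrow> lam 1 * p333 u + p12 u * p223 u - p23 u * p122 u + lam 3 * p13 u * p333 u - lam 3 * p33 u * p133 u = 0"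
proof -
  assume u: "u \<in> Om"
  have d1: "- 2 * p33 u * p12333 u + 3 * p133 u * p2333 u - 2 * p233 u * p1333 u + 3 * p333 u * p1233 u - 3 *
      p12 u * p223 u + 6 * p13 u * p222 u + 6 * p22 u * p123 u - 3 * p23 u * p122 u = 0"
    by (rule Om_differentiate[where i = 2, OF assoc_1_even u])
      (auto intro!: derivative_eq_intros wp_d u simp: algebra_simps power2_eq_square simp del: One_nat_def)
  have d2: "p12333 u - 3 * lam 3 * p133 u - 6 * p23 u * p133 u - 6 * p33 u * p123 u = 0"
    by (rule Om_differentiate[where i = 1, OF N2333 u])
      (auto intro!: derivative_eq_intros wp_d u simp: algebra_simps power2_eq_square simp del: One_nat_def)
  show ?thesis
    using rel1[OF u] curve_1_odd[OF u] d1 d2 N1233[OF u] N2333[OF u] N3333[OF u]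
    by algebra
qed

lemma rel9: "u \<in> Om \<Longrightarrow> - p112 u - 2 * lam 1 * p333 u + p13 u * p222 u - 2 * p22 u * p123 u + p23 u * p122 u - 2 * lam 3 *
      p13 u * p333 u + 2 * lam 3 * p33 u * p133 u = 0"
proof -
  assume u: "u \<in> Om"
  show ?thesis
    using rel8[OF u] rel9_2rel8[OF u]
    by algebra
qed

text \<open>In \<open>2 * d1 + d2\<close> the products of two three-index functions cancel. The
  remaining four-index functions are eliminated by earlier equations, except \<open>p1333\<close>,
  which stays.\<close>

lemma N2222: "u \<in> Om \<Longrightarrow> 4 * p1333 u + p2222 u - 12 * lam 2 * p33 u - 24 * p13 u * p33 u - 6 * p22 u ^ 2 + 3 * lam 3 ^ 2 *
      p33 u = 0"
proof -
  assume u: "u \<in> Om"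
  have d1: "2 * p1333 u + p22 u * p3333 u + p23 u * p2333 u - 2 * p33 u * p2233 u - p223 u * p333 u + p233 u ^ 2 = 0"
    by (rule Om_differentiate[where i = 3, OF rel2 u])
      (auto intro!: derivative_eq_intros wp_d u simp: algebra_simps power2_eq_square simp del: One_nat_def)
  have d2: "p2222 u + lam 3 * p2333 u + 2 * p23 u * p2333 u - 2 * p33 u * p2233 u + 2 * p223 u * p333 u - 2 *
      p233 u ^ 2 = 0"
    by (rule Om_differentiate[where i = 2, OF rel1 u])
      (auto intro!: derivative_eq_intros wp_d u simp: algebra_simps power2_eq_square simp del: One_nat_def)
  show ?thesis
    using d1 d2 N2233[OF u] N2333[OF u] N3333[OF u]
    by algebra
qed

lemma N1222: "u \<in> Om \<Longrightarrow> p1222 u + lam 3 * p1333 u - 6 * lam 1 * p33 u - 6 * p12 u * p22 u - 6 * lam 3 * p13 u * p33 u = 0"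
proof -
  assume u: "u \<in> Om"
  have d1: "- p12 u * p3333 u - 2 * p13 u * p2333 u + p23 u * p1333 u + 2 * p33 u * p1233 u + p123 u * p333 u -
      p133 u * p233 u = 0"
    by (rule Om_differentiate[where i = 3, OF rel5 u])
      (auto intro!: derivative_eq_intros wp_d u simp: algebra_simps power2_eq_square simp del: One_nat_def)
  have d2: "p1222 u + lam 3 * p1333 u + 2 * p23 u * p1333 u - 2 * p33 u * p1233 u + 2 * p123 u * p333 u - 2 *
      p133 u * p233 u = 0"
    by (rule Om_differentiate[where i = 1, OF rel1 u])
      (auto intro!: derivative_eq_intros wp_d u simp: algebra_simps power2_eq_square simp del: One_nat_def)
  show ?thesis
    using d1 d2 N1233[OF u] N2333[OF u] N3333[OF u]
    by algebra
qed

lemma N1133: "u \<in> Om \<Longrightarrow> p1133 u + lam 1 * p23 u - 2 * lam 2 * p13 u - 2 * p11 u * p33 u - 4 * p13 u ^ 2 = 0"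
proof -
  assume u: "u \<in> Om"
  have d1: "- p12 u * p2333 u - 2 * p13 u * p2233 u + p23 u * p1233 u + 2 * p33 u * p1223 u - p122 u * p333 u +
      p133 u * p223 u = 0"
    by (rule Om_differentiate[where i = 2, OF rel5 u])
      (auto intro!: derivative_eq_intros wp_d u simp: algebra_simps power2_eq_square simp del: One_nat_def)
  have d2: "2 * p1133 u + p22 u * p1333 u + p23 u * p1233 u - 2 * p33 u * p1223 u + p122 u * p333 u + p123 u *
      p233 u - 2 * p133 u * p223 u = 0"
    by (rule Om_differentiate[where i = 1, OF rel2 u])
      (auto intro!: derivative_eq_intros wp_d u simp: algebra_simps power2_eq_square simp del: One_nat_def)
  have d3: "4 * p1133 u - 3 * p12 u * p2333 u - p22 u * p1333 u + 2 * p23 u * p1233 u + 2 * p33 u * p1223 u + 2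
      * p122 u * p333 u - p123 u * p233 u - p133 u * p223 u = 0"
    by (rule Om_differentiate[where i = 3, OF rel6 u])
      (auto intro!: derivative_eq_intros wp_d u simp: algebra_simps power2_eq_square simp del: One_nat_def)
  show ?thesis
    using d1 d2 d3 N1233[OF u] N2233[OF u] N2333[OF u] N1223[OF u]
    by algebra
qed

lemma N1123: "u \<in> Om \<Longrightarrow> p1123 u + lam 1 * p22 u - 2 * lam 2 * p12 u - 2 * p11 u * p23 u - 4 * p12 u * p13 u = 0"
proof -
  assume u: "u \<in> Om"
  have d1: "4 * p1123 u - 3 * p12 u * p2233 u - p22 u * p1233 u + 2 * p23 u * p1223 u + 2 * p33 u * p1222 u -
      p122 u * p233 u + 2 * p123 u * p223 u - p133 u * p222 u = 0"
    by (rule Om_differentiate[where i = 2, OF rel6 u])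
      (auto intro!: derivative_eq_intros wp_d u simp: algebra_simps power2_eq_square simp del: One_nat_def)
  have d2: "p1123 u - 3 * p13 u * p2223 u + 2 * p22 u * p1233 u + 2 * p23 u * p1223 u - p33 u * p1222 u - p122 u
      * p233 u - p123 u * p223 u + 2 * p133 u * p222 u = 0"
    by (rule Om_differentiate[where i = 2, OF rel7 u])
      (auto intro!: derivative_eq_intros wp_d u simp: algebra_simps power2_eq_square simp del: One_nat_def)
  have d3: "- 2 * p1123 u + 2 * p22 u * p1233 u - p23 u * p1223 u - p33 u * p1222 u + 2 * p122 u * p233 u - p123
      u * p223 u - p133 u * p222 u = 0"
    by (rule Om_differentiate[where i = 1, OF rel3 u])
      (auto intro!: derivative_eq_intros wp_d u simp: algebra_simps power2_eq_square simp del: One_nat_def)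
  show ?thesis
    using d1 d2 d3 N1233[OF u] N2233[OF u] N2223[OF u] N1223[OF u]
    by algebra
qed

text \<open>Two expressions for \<open>p12222\<close>, from \<open>N2222\<close> and
  \<open>N1222\<close>, both involving derivatives of \<open>p1333\<close>. These come from
  elsewhere: \<open>p11333\<close> from \<open>N1133\<close> and \<open>p12333\<close> from
  \<open>N2333\<close>.\<close>

lemma rel10: "u \<in> Om \<Longrightarrow> lam 1 * p233 u - 2 * lam 2 * p133 u + 4 * p11 u * p333 u + 3 * p12 u * p222 u + 4 * p13 u * p133 u -
      3 * p22 u * p122 u - 8 * p33 u * p113 u + 3 * lam 3 * p13 u * p233 u - 3 * lam 3 * p23 u * p133 u = 0"
proof -
  assume u: "u \<in> Om"
  have d1: "4 * p11333 u + p12222 u - 12 * lam 2 * p133 u - 24 * p13 u * p133 u - 12 * p22 u * p122 u - 24 * p33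
      u * p113 u + 3 * lam 3 ^ 2 * p133 u = 0"
    by (rule Om_differentiate[where i = 1, OF N2222 u])
      (auto intro!: derivative_eq_intros wp_d u simp: algebra_simps power2_eq_square simp del: One_nat_def)
  have d2: "p12222 u + lam 3 * p12333 u - 6 * lam 1 * p233 u - 6 * p12 u * p222 u - 6 * p22 u * p122 u - 6 * lam
      3 * p13 u * p233 u - 6 * lam 3 * p33 u * p123 u = 0"
    by (rule Om_differentiate[where i = 2, OF N1222 u])
      (auto intro!: derivative_eq_intros wp_d u simp: algebra_simps power2_eq_square simp del: One_nat_def)
  have d3: "p12333 u - 3 * lam 3 * p133 u - 6 * p23 u * p133 u - 6 * p33 u * p123 u = 0"
    by (rule Om_differentiate[where i = 1, OF N2333 u])
      (auto intro!: derivative_eq_intros wp_d u simp: algebra_simps power2_eq_square simp del: One_nat_def)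
  have d4: "p11333 u + lam 1 * p233 u - 2 * lam 2 * p133 u - 2 * p11 u * p333 u - 8 * p13 u * p133 u - 2 * p33 u
      * p113 u = 0"
    by (rule Om_differentiate[where i = 3, OF N1133 u])
      (auto intro!: derivative_eq_intros wp_d u simp: algebra_simps power2_eq_square simp del: One_nat_def)
  show ?thesis
    using d1 d2 d3 d4
    by algebra
qed

lemma rel11: "u \<in> Om \<Longrightarrow> - 2 * p12 u * p133 u + 2 * p13 u * p123 u - p23 u * p113 u + p33 u * p112 u = 0"
proof -
  assume u: "u \<in> Om"
  have d1: "p11233 u + lam 1 * p223 u - 2 * lam 2 * p123 u - 2 * p11 u * p233 u - 8 * p13 u * p123 u - 2 * p33 u
      * p112 u = 0"
    by (rule Om_differentiate[where i = 2, OF N1133 u])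
      (auto intro!: derivative_eq_intros wp_d u simp: algebra_simps power2_eq_square simp del: One_nat_def)
  have d2: "p11233 u + lam 1 * p223 u - 2 * lam 2 * p123 u - 2 * p11 u * p233 u - 4 * p12 u * p133 u - 4 * p13 u
      * p123 u - 2 * p23 u * p113 u = 0"
    by (rule Om_differentiate[where i = 3, OF N1123 u])
      (auto intro!: derivative_eq_intros wp_d u simp: algebra_simps power2_eq_square simp del: One_nat_def)
  show ?thesis
    using d1 d2
    by algebra
qed

lemma rel12: "u \<in> Om \<Longrightarrow> 3 * lam 1 * p223 u - 6 * lam 2 * p123 u + 9 * lam 3 * p113 u - 6 * p11 u * p233 u - 2 * p12 u * p133
      u - 4 * p13 u * p123 u + 8 * p23 u * p113 u + 4 * p33 u * p112 u = 0"
proof -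
  assume u: "u \<in> Om"
  have d1: "p11233 u - 3 * lam 3 * p113 u - 2 * p12 u * p133 u - 4 * p13 u * p123 u - 4 * p23 u * p113 u - 2 *
      p33 u * p112 u = 0"
    by (rule Om_differentiate[where i = 1, OF N1233 u])
      (auto intro!: derivative_eq_intros wp_d u simp: algebra_simps power2_eq_square simp del: One_nat_def)
  have d2: "p11233 u + lam 1 * p223 u - 2 * lam 2 * p123 u - 2 * p11 u * p233 u - 4 * p12 u * p133 u - 4 * p13 u
      * p123 u - 2 * p23 u * p113 u = 0"
    by (rule Om_differentiate[where i = 3, OF N1123 u])
      (auto intro!: derivative_eq_intros wp_d u simp: algebra_simps power2_eq_square simp del: One_nat_def)
  have d3: "p11233 u + lam 1 * p223 u - 2 * lam 2 * p123 u - 2 * p11 u * p233 u - 8 * p13 u * p123 u - 2 * p33 u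
      * p112 u = 0"
    by (rule Om_differentiate[where i = 2, OF N1133 u])
      (auto intro!: derivative_eq_intros wp_d u simp: algebra_simps power2_eq_square simp del: One_nat_def)
  show ?thesis
    using d1 d2 d3
    by algebra
qed

text \<open>The constant \<open>lam 0\<close> enters the four-index equations here, through
  \<open>curve_1_even\<close>. That identity is of higher degree and also contains products of
  three-index functions; removing all of these is what requires so many earlier relations and their
  derivatives.\<close>

lemma N1122: "u \<in> Om \<Longrightarrow> 3 * p1122 u + 2 * lam 2 * p1333 u - 24 * lam 0 * p33 u - 6 * p11 u * p22 u - 12 * p12 u ^ 2 - 3 *
      lam 1 * lam 3 * p33 u - 12 * lam 2 * p13 u * p33 u = 0"
proof -
  assume u: "u \<in> Om"
  have d1: "p2222 u + lam 3 * p2333 u + 2 * p23 u * p2333 u - 2 * p33 u * p2233 u + 2 * p223 u * p333 u - 2 *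
      p233 u ^ 2 = 0"
    by (rule Om_differentiate[where i = 2, OF rel1 u])
      (auto intro!: derivative_eq_intros wp_d u simp: algebra_simps power2_eq_square simp del: One_nat_def)
  have d2: "4 * p1133 u - 3 * p12 u * p2333 u - p22 u * p1333 u + 2 * p23 u * p1233 u + 2 * p33 u * p1223 u + 2
      * p122 u * p333 u - p123 u * p233 u - p133 u * p223 u = 0"
    by (rule Om_differentiate[where i = 3, OF rel6 u])
      (auto intro!: derivative_eq_intros wp_d u simp: algebra_simps power2_eq_square simp del: One_nat_def)
  have d3: "lam 1 * p2333 u - 2 * lam 2 * p1333 u + 4 * p11 u * p3333 u + 3 * p12 u * p2223 u + 4 * p13 u *
      p1333 u - 3 * p22 u * p1223 u - 8 * p33 u * p1133 u + 3 * lam 3 * p13 u * p2333 u - 3 * lam 3 * p23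
      u * p1333 u - 4 * p113 u * p333 u - 3 * p122 u * p223 u + 3 * p123 u * p222 u + 4 * p133 u ^ 2 = 0"
    by (rule Om_differentiate[where i = 3, OF rel10 u])
      (auto intro!: derivative_eq_intros wp_d u simp: algebra_simps power2_eq_square simp del: One_nat_def)
  have d4: "- p1122 u - 2 * lam 1 * p2333 u + p13 u * p2222 u - 2 * p22 u * p1223 u + p23 u * p1222 u - 2 * lam
      3 * p13 u * p2333 u + 2 * lam 3 * p33 u * p1233 u + p122 u * p223 u - p123 u * p222 u - 2 * lam 3 *
      p123 u * p333 u + 2 * lam 3 * p133 u * p233 u = 0"
    by (rule Om_differentiate[where i = 2, OF rel9 u])
      (auto intro!: derivative_eq_intros wp_d u simp: algebra_simps power2_eq_square simp del: One_nat_def)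
  have d5: "lam 1 * p2333 u + p12 u * p2223 u - p23 u * p1222 u + lam 3 * p13 u * p2333 u - lam 3 * p33 u *
      p1233 u + lam 3 * p123 u * p333 u - lam 3 * p133 u * p233 u = 0"
    by (rule Om_differentiate[where i = 2, OF rel8 u])
      (auto intro!: derivative_eq_intros wp_d u simp: algebra_simps power2_eq_square simp del: One_nat_def)
  show ?thesis
    using assoc_1_even[OF u] curve_1_even[OF u] d1 d2 assoc_x_even[OF u] rel2[OF u] rel5[OF u] rel7[OF u] rel6[OF u] d3 d4 d5 N1233[OF u] N2233[OF u] N2333[OF u] N3333[OF u] N2223[OF u] N1223[OF u] N2222[OF u] N1222[OF u] N1133[OF u]
    by algebra
qed

text \<open>Three expressions for \<open>p11223\<close>, from \<open>N1123\<close>,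
  \<open>N1122\<close> and \<open>N1223\<close>, with \<open>p13333\<close> taken from
  \<open>N3333\<close>. The first two alone give \<open>rel14\<close>.\<close>

lemma rel13: "u \<in> Om \<Longrightarrow> - 6 * p111 u - 8 * lam 0 * p333 u + 2 * lam 1 * p222 u - 6 * lam 2 * p122 u + 9 * lam 3 * p112 u - 6
      * p11 u * p223 u - 4 * p12 u * p123 u - 2 * p13 u * p122 u + 4 * p22 u * p113 u + 8 * p23 u * p112 u
      - lam 1 * lam 3 * p333 u - 4 * lam 2 * p13 u * p333 u + 4 * lam 2 * p33 u * p133 u = 0"
proof -
  assume u: "u \<in> Om"
  have d1: "p11223 u + lam 1 * p222 u - 2 * lam 2 * p122 u - 2 * p11 u * p223 u - 4 * p12 u * p123 u - 4 * p13 u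
      * p122 u - 2 * p23 u * p112 u = 0"
    by (rule Om_differentiate[where i = 2, OF N1123 u])
      (auto intro!: derivative_eq_intros wp_d u simp: algebra_simps power2_eq_square simp del: One_nat_def)
  have d2: "3 * p11223 u + 2 * lam 2 * p13333 u - 24 * lam 0 * p333 u - 6 * p11 u * p223 u - 24 * p12 u * p123 u
      - 6 * p22 u * p113 u - 3 * lam 1 * lam 3 * p333 u - 12 * lam 2 * p13 u * p333 u - 12 * lam 2 * p33 u
      * p133 u = 0"
    by (rule Om_differentiate[where i = 3, OF N1122 u])
      (auto intro!: derivative_eq_intros wp_d u simp: algebra_simps power2_eq_square simp del: One_nat_def)
  have d3: "p11223 u + 2 * p111 u - 3 * lam 3 * p112 u - 4 * p12 u * p123 u - 2 * p13 u * p122 u - 2 * p22 u *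
      p113 u - 4 * p23 u * p112 u = 0"
    by (rule Om_differentiate[where i = 1, OF N1223 u])
      (auto intro!: derivative_eq_intros wp_d u simp: algebra_simps power2_eq_square simp del: One_nat_def)
  have d4: "p13333 u + 3 * p122 u - 12 * p33 u * p133 u = 0"
    by (rule Om_differentiate[where i = 1, OF N3333 u])
      (auto intro!: derivative_eq_intros wp_d u simp: algebra_simps power2_eq_square simp del: One_nat_def)
  show ?thesis
    using d1 d2 d3 d4
    by algebra
qed

lemma rel14: "u \<in> Om \<Longrightarrow> - 8 * lam 0 * p333 u - lam 1 * p222 u - 4 * p12 u * p123 u + 4 * p13 u * p122 u - 2 * p22 u * p113 u
      + 2 * p23 u * p112 u - lam 1 * lam 3 * p333 u - 4 * lam 2 * p13 u * p333 u + 4 * lam 2 * p33 u *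
      p133 u = 0"
proof -
  assume u: "u \<in> Om"
  have d1: "p11223 u + lam 1 * p222 u - 2 * lam 2 * p122 u - 2 * p11 u * p223 u - 4 * p12 u * p123 u - 4 * p13 u
      * p122 u - 2 * p23 u * p112 u = 0"
    by (rule Om_differentiate[where i = 2, OF N1123 u])
      (auto intro!: derivative_eq_intros wp_d u simp: algebra_simps power2_eq_square simp del: One_nat_def)
  have d2: "3 * p11223 u + 2 * lam 2 * p13333 u - 24 * lam 0 * p333 u - 6 * p11 u * p223 u - 24 * p12 u * p123 u
      - 6 * p22 u * p113 u - 3 * lam 1 * lam 3 * p333 u - 12 * lam 2 * p13 u * p333 u - 12 * lam 2 * p33 u
      * p133 u = 0"
    by (rule Om_differentiate[where i = 3, OF N1122 u])
      (auto intro!: derivative_eq_intros wp_d u simp: algebra_simps power2_eq_square simp del: One_nat_def)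
  have d3: "p13333 u + 3 * p122 u - 12 * p33 u * p133 u = 0"
    by (rule Om_differentiate[where i = 1, OF N3333 u])
      (auto intro!: derivative_eq_intros wp_d u simp: algebra_simps power2_eq_square simp del: One_nat_def)
  show ?thesis
    using d1 d2 d3
    by algebra
qed

lemma rel15: "u \<in> Om \<Longrightarrow> - 4 * lam 0 * p233 u + 3 * lam 1 * p133 u - p11 u * p222 u - p12 u * p122 u + 2 * p22 u * p112 u - 2
      * lam 2 * p13 u * p233 u + 2 * lam 2 * p23 u * p133 u - lam 3 * p11 u * p333 u - lam 3 * p13 u *
      p133 u + 2 * lam 3 * p33 u * p113 u = 0"
proof -
  assume u: "u \<in> Om"
  have d1: "p11222 u + lam 3 * p11333 u - 6 * lam 1 * p133 u - 6 * p12 u * p122 u - 6 * p22 u * p112 u - 6 * lam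
      3 * p13 u * p133 u - 6 * lam 3 * p33 u * p113 u = 0"
    by (rule Om_differentiate[where i = 1, OF N1222 u])
      (auto intro!: derivative_eq_intros wp_d u simp: algebra_simps power2_eq_square simp del: One_nat_def)
  have d2: "3 * p11222 u + 2 * lam 2 * p12333 u - 24 * lam 0 * p233 u - 6 * p11 u * p222 u - 24 * p12 u * p122 u
      - 6 * p22 u * p112 u - 3 * lam 1 * lam 3 * p233 u - 12 * lam 2 * p13 u * p233 u - 12 * lam 2 * p33 u
      * p123 u = 0"
    by (rule Om_differentiate[where i = 2, OF N1122 u])
      (auto intro!: derivative_eq_intros wp_d u simp: algebra_simps power2_eq_square simp del: One_nat_def)
  have d3: "p12333 u - 3 * lam 3 * p133 u - 6 * p23 u * p133 u - 6 * p33 u * p123 u = 0"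
    by (rule Om_differentiate[where i = 1, OF N2333 u])
      (auto intro!: derivative_eq_intros wp_d u simp: algebra_simps power2_eq_square simp del: One_nat_def)
  have d4: "p11333 u + lam 1 * p233 u - 2 * lam 2 * p133 u - 2 * p11 u * p333 u - 8 * p13 u * p133 u - 2 * p33 u
      * p113 u = 0"
    by (rule Om_differentiate[where i = 3, OF N1133 u])
      (auto intro!: derivative_eq_intros wp_d u simp: algebra_simps power2_eq_square simp del: One_nat_def)
  show ?thesis
    using d1 d2 d3 d4
    by algebra
qed

text \<open>All products of two three-index functions cancel in
  \<open>- 2 * d1 + 8 * d2 + 3 * d3\<close>, which leaves \<open>12 * p1113\<close> and terms known
  from earlier equations.\<close>

lemma N1113: "u \<in> Om \<Longrightarrow> p1113 u + 6 * lam 0 * p22 u - 3 * lam 1 * p12 u - 6 * p11 u * p13 u = 0"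
proof -
  assume u: "u \<in> Om"
  have d1: "p1113 u - 3 * p13 u * p1223 u + 2 * p22 u * p1133 u + 2 * p23 u * p1123 u - p33 u * p1122 u - 3 *
      p113 u * p223 u + p122 u * p133 u + 2 * p123 u ^ 2 = 0"
    by (rule Om_differentiate[where i = 1, OF rel7 u])
      (auto intro!: derivative_eq_intros wp_d u simp: algebra_simps power2_eq_square simp del: One_nat_def)
  have d2: "4 * p1113 u - 3 * p12 u * p1233 u - p22 u * p1133 u + 2 * p23 u * p1123 u + 2 * p33 u * p1122 u - 3
      * p112 u * p233 u + p122 u * p133 u + 2 * p123 u ^ 2 = 0"
    by (rule Om_differentiate[where i = 1, OF rel6 u])
      (auto intro!: derivative_eq_intros wp_d u simp: algebra_simps power2_eq_square simp del: One_nat_def)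
  have d3: "- 6 * p1113 u - 8 * lam 0 * p3333 u + 2 * lam 1 * p2223 u - 6 * lam 2 * p1223 u + 9 * lam 3 * p1123
      u - 6 * p11 u * p2233 u - 4 * p12 u * p1233 u - 2 * p13 u * p1223 u + 4 * p22 u * p1133 u + 8 * p23
      u * p1123 u - lam 1 * lam 3 * p3333 u - 4 * lam 2 * p13 u * p3333 u + 4 * lam 2 * p33 u * p1333 u +
      8 * p112 u * p233 u - 2 * p113 u * p223 u - 2 * p122 u * p133 u - 4 * p123 u ^ 2 = 0"
    by (rule Om_differentiate[where i = 3, OF rel13 u])
      (auto intro!: derivative_eq_intros wp_d u simp: algebra_simps power2_eq_square simp del: One_nat_def)
  show ?thesis
    using d1 d2 d3 N1233[OF u] N2233[OF u] N3333[OF u] N2223[OF u] N1223[OF u] N1123[OF u] N1122[OF u]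
    by algebra
qed

lemma rel16: "u \<in> Om \<Longrightarrow> 3 * lam 0 * p223 u - 2 * lam 1 * p123 u + lam 2 * p113 u - 2 * p11 u * p133 u + p13 u * p113 u + p33
      u * p111 u = 0"
proof -
  assume u: "u \<in> Om"
  have d1: "p11133 u + lam 1 * p123 u - 2 * lam 2 * p113 u - 2 * p11 u * p133 u - 8 * p13 u * p113 u - 2 * p33 u
      * p111 u = 0"
    by (rule Om_differentiate[where i = 1, OF N1133 u])
      (auto intro!: derivative_eq_intros wp_d u simp: algebra_simps power2_eq_square simp del: One_nat_def)
  have d2: "p11133 u + 6 * lam 0 * p223 u - 3 * lam 1 * p123 u - 6 * p11 u * p133 u - 6 * p13 u * p113 u = 0"
    by (rule Om_differentiate[where i = 3, OF N1113 u])
      (auto intro!: derivative_eq_intros wp_d u simp: algebra_simps power2_eq_square simp del: One_nat_def)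
  show ?thesis
    using d1 d2
    by algebra
qed

lemma N1112: "u \<in> Om \<Longrightarrow> p1112 u + lam 1 * p1333 u - 6 * p11 u * p12 u - 6 * lam 0 * lam 3 * p33 u - 6 * lam 1 * p13 u * p33
      u = 0"
proof -
  assume u: "u \<in> Om"
  have d1: "lam 1 * p2333 u - 2 * lam 2 * p1333 u + 4 * p11 u * p3333 u + 3 * p12 u * p2223 u + 4 * p13 u *
      p1333 u - 3 * p22 u * p1223 u - 8 * p33 u * p1133 u + 3 * lam 3 * p13 u * p2333 u - 3 * lam 3 * p23
      u * p1333 u - 4 * p113 u * p333 u - 3 * p122 u * p223 u + 3 * p123 u * p222 u + 4 * p133 u ^ 2 = 0"
    by (rule Om_differentiate[where i = 3, OF rel10 u])
      (auto intro!: derivative_eq_intros wp_d u simp: algebra_simps power2_eq_square simp del: One_nat_def)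
  have d2: "4 * p1122 u + 4 * lam 2 * p1333 u - lam 3 * p1222 u + 8 * p13 u * p1333 u + 2 * p22 u * p1223 u - 2
      * p23 u * p1222 u - 8 * p33 u * p1133 u - lam 3 ^ 2 * p1333 u + 8 * p113 u * p333 u + 2 * p122 u *
      p223 u - 2 * p123 u * p222 u - 8 * p133 u ^ 2 = 0"
    by (rule Om_differentiate[where i = 1, OF rel4 u])
      (auto intro!: derivative_eq_intros wp_d u simp: algebra_simps power2_eq_square simp del: One_nat_def)
  have d3: "- p1112 u - 2 * lam 1 * p1333 u + p13 u * p1222 u - 2 * p22 u * p1123 u + p23 u * p1122 u - 2 * lam
      3 * p13 u * p1333 u + 2 * lam 3 * p33 u * p1133 u + p113 u * p222 u - p122 u * p123 u - 2 * lam 3 *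
      p113 u * p333 u + 2 * lam 3 * p133 u ^ 2 = 0"
    by (rule Om_differentiate[where i = 1, OF rel9 u])
      (auto intro!: derivative_eq_intros wp_d u simp: algebra_simps power2_eq_square simp del: One_nat_def)
  have d4: "lam 1 * p1333 u + p12 u * p1223 u - p23 u * p1122 u + lam 3 * p13 u * p1333 u - lam 3 * p33 u *
      p1133 u + p112 u * p223 u - p122 u * p123 u + lam 3 * p113 u * p333 u - lam 3 * p133 u ^ 2 = 0"
    by (rule Om_differentiate[where i = 1, OF rel8 u])
      (auto intro!: derivative_eq_intros wp_d u simp: algebra_simps power2_eq_square simp del: One_nat_def)
  have d5: "4 * p1222 u + 4 * lam 2 * p2333 u - lam 3 * p2222 u + 8 * p13 u * p2333 u + 2 * p22 u * p2223 u - 2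
      * p23 u * p2222 u - 8 * p33 u * p1233 u - lam 3 ^ 2 * p2333 u + 8 * p123 u * p333 u - 8 * p133 u *
      p233 u = 0"
    by (rule Om_differentiate[where i = 2, OF rel4 u])
      (auto intro!: derivative_eq_intros wp_d u simp: algebra_simps power2_eq_square simp del: One_nat_def)
  have d6: "- 8 * lam 0 * p2333 u - lam 1 * p2222 u - 4 * p12 u * p1223 u + 4 * p13 u * p1222 u - 2 * p22 u *
      p1123 u + 2 * p23 u * p1122 u - lam 1 * lam 3 * p2333 u - 4 * lam 2 * p13 u * p2333 u + 4 * lam 2 *
      p33 u * p1233 u + 2 * p112 u * p223 u - 2 * p113 u * p222 u - 4 * lam 2 * p123 u * p333 u + 4 * lam
      2 * p133 u * p233 u = 0"
    by (rule Om_differentiate[where i = 2, OF rel14 u])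
      (auto intro!: derivative_eq_intros wp_d u simp: algebra_simps power2_eq_square simp del: One_nat_def)
  show ?thesis
    using d1 d2 d3 d4 d5 d6 N2333[OF u] N3333[OF u] N2223[OF u] N1223[OF u] N2222[OF u] N1222[OF u] N1133[OF u] N1123[OF u] N1122[OF u]
    by algebra
qed

text \<open>Three expressions for \<open>p11123\<close>, from \<open>N1113\<close>,
  \<open>N1112\<close> and \<open>N1123\<close>, account for this relation and for
  \<open>rel18\<close>.\<close>

lemma rel17: "u \<in> Om \<Longrightarrow> 3 * lam 0 * p222 u - 4 * lam 1 * p122 u + 2 * lam 2 * p112 u - 4 * p11 u * p123 u + p12 u * p113 u +
      p13 u * p112 u + 2 * p23 u * p111 u - 3 * lam 0 * lam 3 * p333 u - 3 * lam 1 * p13 u * p333 u + 3 *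
      lam 1 * p33 u * p133 u = 0"
proof -
  assume u: "u \<in> Om"
  have d1: "p11123 u + 6 * lam 0 * p222 u - 3 * lam 1 * p122 u - 6 * p11 u * p123 u - 6 * p13 u * p112 u = 0"
    by (rule Om_differentiate[where i = 2, OF N1113 u])
      (auto intro!: derivative_eq_intros wp_d u simp: algebra_simps power2_eq_square simp del: One_nat_def)
  have d2: "p11123 u + lam 1 * p13333 u - 6 * p11 u * p123 u - 6 * p12 u * p113 u - 6 * lam 0 * lam 3 * p333 u -
      6 * lam 1 * p13 u * p333 u - 6 * lam 1 * p33 u * p133 u = 0"
    by (rule Om_differentiate[where i = 3, OF N1112 u])
      (auto intro!: derivative_eq_intros wp_d u simp: algebra_simps power2_eq_square simp del: One_nat_def)
  have d3: "p11123 u + lam 1 * p122 u - 2 * lam 2 * p112 u - 2 * p11 u * p123 u - 4 * p12 u * p113 u - 4 * p13 u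
      * p112 u - 2 * p23 u * p111 u = 0"
    by (rule Om_differentiate[where i = 1, OF N1123 u])
      (auto intro!: derivative_eq_intros wp_d u simp: algebra_simps power2_eq_square simp del: One_nat_def)
  have d4: "p13333 u + 3 * p122 u - 12 * p33 u * p133 u = 0"
    by (rule Om_differentiate[where i = 1, OF N3333 u])
      (auto intro!: derivative_eq_intros wp_d u simp: algebra_simps power2_eq_square simp del: One_nat_def)
  show ?thesis
    using d1 d2 d3 d4
    by algebra
qed

lemma rel18: "u \<in> Om \<Longrightarrow> - 6 * lam 0 * p222 u + 2 * lam 1 * p122 u - lam 2 * p112 u + 2 * p11 u * p123 u - 5 * p12 u * p113 u
      + 4 * p13 u * p112 u - p23 u * p111 u - 3 * lam 0 * lam 3 * p333 u - 3 * lam 1 * p13 u * p333 u + 3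
      * lam 1 * p33 u * p133 u = 0"
proof -
  assume u: "u \<in> Om"
  have d1: "p11123 u + 6 * lam 0 * p222 u - 3 * lam 1 * p122 u - 6 * p11 u * p123 u - 6 * p13 u * p112 u = 0"
    by (rule Om_differentiate[where i = 2, OF N1113 u])
      (auto intro!: derivative_eq_intros wp_d u simp: algebra_simps power2_eq_square simp del: One_nat_def)
  have d2: "p11123 u + lam 1 * p13333 u - 6 * p11 u * p123 u - 6 * p12 u * p113 u - 6 * lam 0 * lam 3 * p333 u -
      6 * lam 1 * p13 u * p333 u - 6 * lam 1 * p33 u * p133 u = 0"
    by (rule Om_differentiate[where i = 3, OF N1112 u])
      (auto intro!: derivative_eq_intros wp_d u simp: algebra_simps power2_eq_square simp del: One_nat_def)
  have d3: "p11123 u + lam 1 * p122 u - 2 * lam 2 * p112 u - 2 * p11 u * p123 u - 4 * p12 u * p113 u - 4 * p13 u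
      * p112 u - 2 * p23 u * p111 u = 0"
    by (rule Om_differentiate[where i = 1, OF N1123 u])
      (auto intro!: derivative_eq_intros wp_d u simp: algebra_simps power2_eq_square simp del: One_nat_def)
  have d4: "p13333 u + 3 * p122 u - 12 * p33 u * p133 u = 0"
    by (rule Om_differentiate[where i = 1, OF N3333 u])
      (auto intro!: derivative_eq_intros wp_d u simp: algebra_simps power2_eq_square simp del: One_nat_def)
  show ?thesis
    using d1 d2 d3 d4
    by algebra
qed

lemma rel19: "u \<in> Om \<Longrightarrow> 12 * lam 0 * p133 u - 6 * p11 u * p122 u + 3 * p12 u * p112 u + 3 * p22 u * p111 u - 9 * lam 0 * lam
      3 * p233 u + lam 1 * lam 2 * p233 u + 6 * lam 1 * lam 3 * p133 u - 9 * lam 1 * p13 u * p233 u + 9 *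
      lam 1 * p23 u * p133 u - 2 * lam 2 ^ 2 * p133 u - 2 * lam 2 * p11 u * p333 u - 2 * lam 2 * p13 u *
      p133 u + 4 * lam 2 * p33 u * p113 u = 0"
proof -
  assume u: "u \<in> Om"
  have d1: "3 * p11122 u + 2 * lam 2 * p11333 u - 24 * lam 0 * p133 u - 6 * p11 u * p122 u - 24 * p12 u * p112 u
      - 6 * p22 u * p111 u - 3 * lam 1 * lam 3 * p133 u - 12 * lam 2 * p13 u * p133 u - 12 * lam 2 * p33 u
      * p113 u = 0"
    by (rule Om_differentiate[where i = 1, OF N1122 u])
      (auto intro!: derivative_eq_intros wp_d u simp: algebra_simps power2_eq_square simp del: One_nat_def)
  have d2: "p11122 u + lam 1 * p12333 u - 6 * p11 u * p122 u - 6 * p12 u * p112 u - 6 * lam 0 * lam 3 * p233 u -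
      6 * lam 1 * p13 u * p233 u - 6 * lam 1 * p33 u * p123 u = 0"
    by (rule Om_differentiate[where i = 2, OF N1112 u])
      (auto intro!: derivative_eq_intros wp_d u simp: algebra_simps power2_eq_square simp del: One_nat_def)
  have d3: "p12333 u - 3 * lam 3 * p133 u - 6 * p23 u * p133 u - 6 * p33 u * p123 u = 0"
    by (rule Om_differentiate[where i = 1, OF N2333 u])
      (auto intro!: derivative_eq_intros wp_d u simp: algebra_simps power2_eq_square simp del: One_nat_def)
  have d4: "p11333 u + lam 1 * p233 u - 2 * lam 2 * p133 u - 2 * p11 u * p333 u - 8 * p13 u * p133 u - 2 * p33 u
      * p113 u = 0"
    by (rule Om_differentiate[where i = 3, OF N1133 u])
      (auto intro!: derivative_eq_intros wp_d u simp: algebra_simps power2_eq_square simp del: One_nat_def)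
  show ?thesis
    using d1 d2 d3 d4
    by algebra
qed

text \<open>With this equation every four-index function is expressed by two-index functions and
  \<open>p1333\<close>.\<close>

lemma N1111: "u \<in> Om \<Longrightarrow> p1111 u + 4 * lam 0 * p1333 u - 6 * p11 u ^ 2 - 12 * lam 0 * lam 2 * p33 u - 24 * lam 0 * p13 u *
      p33 u + 3 * lam 1 ^ 2 * p33 u = 0"
proof -
  assume u: "u \<in> Om"
  have d1: "12 * lam 0 * p1333 u - 6 * p11 u * p1223 u + 3 * p12 u * p1123 u + 3 * p22 u * p1113 u - 9 * lam 0 *
      lam 3 * p2333 u + lam 1 * lam 2 * p2333 u + 6 * lam 1 * lam 3 * p1333 u - 9 * lam 1 * p13 u * p2333
      u + 9 * lam 1 * p23 u * p1333 u - 2 * lam 2 ^ 2 * p1333 u - 2 * lam 2 * p11 u * p3333 u - 2 * lam 2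
      * p13 u * p1333 u + 4 * lam 2 * p33 u * p1133 u + 3 * p111 u * p223 u + 3 * p112 u * p123 u - 6 *
      p113 u * p122 u + 2 * lam 2 * p113 u * p333 u - 2 * lam 2 * p133 u ^ 2 = 0"
    by (rule Om_differentiate[where i = 3, OF rel19 u])
      (auto intro!: derivative_eq_intros wp_d u simp: algebra_simps power2_eq_square simp del: One_nat_def)
  have d2: "- 6 * p1111 u - 8 * lam 0 * p1333 u + 2 * lam 1 * p1222 u - 6 * lam 2 * p1122 u + 9 * lam 3 * p1112
      u - 6 * p11 u * p1223 u - 4 * p12 u * p1123 u - 2 * p13 u * p1122 u + 4 * p22 u * p1113 u + 8 * p23
      u * p1112 u - lam 1 * lam 3 * p1333 u - 4 * lam 2 * p13 u * p1333 u + 4 * lam 2 * p33 u * p1133 u -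
      6 * p111 u * p223 u + 4 * p112 u * p123 u + 2 * p113 u * p122 u - 4 * lam 2 * p113 u * p333 u + 4 *
      lam 2 * p133 u ^ 2 = 0"
    by (rule Om_differentiate[where i = 1, OF rel13 u])
      (auto intro!: derivative_eq_intros wp_d u simp: algebra_simps power2_eq_square simp del: One_nat_def)
  have d3: "lam 1 * p2333 u - 2 * lam 2 * p1333 u + 4 * p11 u * p3333 u + 3 * p12 u * p2223 u + 4 * p13 u *
      p1333 u - 3 * p22 u * p1223 u - 8 * p33 u * p1133 u + 3 * lam 3 * p13 u * p2333 u - 3 * lam 3 * p23
      u * p1333 u - 4 * p113 u * p333 u - 3 * p122 u * p223 u + 3 * p123 u * p222 u + 4 * p133 u ^ 2 = 0"
    by (rule Om_differentiate[where i = 3, OF rel10 u])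
      (auto intro!: derivative_eq_intros wp_d u simp: algebra_simps power2_eq_square simp del: One_nat_def)
  have d4: "4 * p1122 u + 4 * lam 2 * p1333 u - lam 3 * p1222 u + 8 * p13 u * p1333 u + 2 * p22 u * p1223 u - 2
      * p23 u * p1222 u - 8 * p33 u * p1133 u - lam 3 ^ 2 * p1333 u + 8 * p113 u * p333 u + 2 * p122 u *
      p223 u - 2 * p123 u * p222 u - 8 * p133 u ^ 2 = 0"
    by (rule Om_differentiate[where i = 1, OF rel4 u])
      (auto intro!: derivative_eq_intros wp_d u simp: algebra_simps power2_eq_square simp del: One_nat_def)
  have d5: "- 8 * lam 0 * p1333 u - lam 1 * p1222 u - 4 * p12 u * p1123 u + 4 * p13 u * p1122 u - 2 * p22 u *
      p1113 u + 2 * p23 u * p1112 u - lam 1 * lam 3 * p1333 u - 4 * lam 2 * p13 u * p1333 u + 4 * lam 2 *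
      p33 u * p1133 u - 2 * p112 u * p123 u + 2 * p113 u * p122 u - 4 * lam 2 * p113 u * p333 u + 4 * lam
      2 * p133 u ^ 2 = 0"
    by (rule Om_differentiate[where i = 1, OF rel14 u])
      (auto intro!: derivative_eq_intros wp_d u simp: algebra_simps power2_eq_square simp del: One_nat_def)
  show ?thesis
    using d1 d2 d3 d4 d5 N2333[OF u] N3333[OF u] N2223[OF u] N1223[OF u] N1222[OF u] N1133[OF u] N1123[OF u] N1122[OF u] N1112[OF u]
    by algebra
qed

lemma rel20: "u \<in> Om \<Longrightarrow> - 6 * lam 0 * p122 u + lam 1 * p112 u - 2 * p11 u * p113 u + 2 * p13 u * p111 u - 4 * lam 0 * lam 2
      * p333 u - 8 * lam 0 * p13 u * p333 u + 8 * lam 0 * p33 u * p133 u + lam 1 ^ 2 * p333 u = 0"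
proof -
  assume u: "u \<in> Om"
  have d1: "p11113 u + 6 * lam 0 * p122 u - 3 * lam 1 * p112 u - 6 * p11 u * p113 u - 6 * p13 u * p111 u = 0"
    by (rule Om_differentiate[where i = 1, OF N1113 u])
      (auto intro!: derivative_eq_intros wp_d u simp: algebra_simps power2_eq_square simp del: One_nat_def)
  have d2: "p11113 u + 4 * lam 0 * p13333 u - 12 * p11 u * p113 u - 12 * lam 0 * lam 2 * p333 u - 24 * lam 0 *
      p13 u * p333 u - 24 * lam 0 * p33 u * p133 u + 3 * lam 1 ^ 2 * p333 u = 0"
    by (rule Om_differentiate[where i = 3, OF N1111 u])
      (auto intro!: derivative_eq_intros wp_d u simp: algebra_simps power2_eq_square simp del: One_nat_def)
  have d3: "p13333 u + 3 * p122 u - 12 * p33 u * p133 u = 0"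
    by (rule Om_differentiate[where i = 1, OF N3333 u])
      (auto intro!: derivative_eq_intros wp_d u simp: algebra_simps power2_eq_square simp del: One_nat_def)
  show ?thesis
    using d1 d2 d3
    by algebra
qed

lemma rel21: "u \<in> Om \<Longrightarrow> - 3 * p11 u * p112 u + 3 * p12 u * p111 u - 6 * lam 0 * lam 2 * p233 u + 9 * lam 0 * lam 3 * p133 u
      - 12 * lam 0 * p13 u * p233 u + 12 * lam 0 * p23 u * p133 u + 2 * lam 1 ^ 2 * p233 u - lam 1 * lam 2
      * p133 u - lam 1 * p11 u * p333 u - lam 1 * p13 u * p133 u + 2 * lam 1 * p33 u * p113 u = 0"
proof -
  assume u: "u \<in> Om"
  have d1: "p11112 u + lam 1 * p11333 u - 6 * p11 u * p112 u - 6 * p12 u * p111 u - 6 * lam 0 * lam 3 * p133 u -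
      6 * lam 1 * p13 u * p133 u - 6 * lam 1 * p33 u * p113 u = 0"
    by (rule Om_differentiate[where i = 1, OF N1112 u])
      (auto intro!: derivative_eq_intros wp_d u simp: algebra_simps power2_eq_square simp del: One_nat_def)
  have d2: "p11112 u + 4 * lam 0 * p12333 u - 12 * p11 u * p112 u - 12 * lam 0 * lam 2 * p233 u - 24 * lam 0 *
      p13 u * p233 u - 24 * lam 0 * p33 u * p123 u + 3 * lam 1 ^ 2 * p233 u = 0"
    by (rule Om_differentiate[where i = 2, OF N1111 u])
      (auto intro!: derivative_eq_intros wp_d u simp: algebra_simps power2_eq_square simp del: One_nat_def)
  have d3: "p12333 u - 3 * lam 3 * p133 u - 6 * p23 u * p133 u - 6 * p33 u * p123 u = 0"
    by (rule Om_differentiate[where i = 1, OF N2333 u])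
      (auto intro!: derivative_eq_intros wp_d u simp: algebra_simps power2_eq_square simp del: One_nat_def)
  have d4: "p11333 u + lam 1 * p233 u - 2 * lam 2 * p133 u - 2 * p11 u * p333 u - 8 * p13 u * p133 u - 2 * p33 u
      * p113 u = 0"
    by (rule Om_differentiate[where i = 3, OF N1133 u])
      (auto intro!: derivative_eq_intros wp_d u simp: algebra_simps power2_eq_square simp del: One_nat_def)
  show ?thesis
    using d1 d2 d3 d4
    by algebra
qed

end

section \<open>Leading terms\<close>

lemma tendsto_of_fps_expansion:
  fixes f :: "complex \<Rightarrow> complex"
  assumes f: "f has_fps_expansion F" and z: "\<And>k. k < m \<Longrightarrow> fps_nth F k = 0"
  shows "((\<lambda>x. f x / x ^ m) \<longlongrightarrow> fps_nth F m) (at 0)"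
proof (cases "F = 0")
  case True
  then have "\<forall>\<^sub>F x in nhds 0. f x = 0"
    using f by (simp add: has_fps_expansion_def)
  from eventually_at_if_nhds[OF this] have "\<forall>\<^sub>F x in at 0. 0 = f x / x ^ m"
    by (rule eventually_mono) simp
  from tendsto_cong[OF this] show ?thesis using True by auto
next
  case False
  have "(\<lambda>x. if x = 0 then fps_nth F m else f x / x ^ m) has_fps_expansion fps_shift m F"
    by (rule has_fps_expansion_shift[OF f _ refl]) (use False z in \<open>auto intro: subdegree_geI\<close>)
  from has_fps_expansion_imp_continuous[OF this, of UNIV]
  have "((\<lambda>x. if x = 0 then fps_nth F m else f x / x ^ m) \<longlongrightarrow> fps_nth F m) (at 0)"
    by (simp add: continuous_at)
  then show ?thesis
    by (rule Lim_transform_eventually) (simp add: eventually_at_filter)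
qed

text \<open>A logarithmic derivative is homogeneous of degree 0 in \<sigma>, so the common factor
  \<open>E\<close>, later \<open>\<epsilon>^5\<close>, cancels. \<open>A\<close> and
  \<open>B\<close> are the powers of \<open>\<epsilon>\<close> that belong to the two
  indices.\<close>

lemma rescale_second_log_derivative: fixes E s :: complex assumes "E \<noteq> 0" "s \<noteq> 0"
  shows "(A * x / E * (B * y / E) - s / E * (A * B * z / E)) / (s / E)^2 = A * B * ((x * y - s * z) / s^2)"
proof -
  have "A * x / E * (B * y / E) - s / E * (A * B * z / E) = A * B * (x * y - s * z) / E^2"
    by (simp add: power2_eq_square diff_divide_distrib algebra_simps)
  then show ?thesis using assms by (simp add: power_divide)
qed
lemma rescale_third_log_derivative: fixes E s :: complex assumes "E \<noteq> 0" "s \<noteq> 0"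
  shows "(A * B * xy / E * (C * z / E) + B * y / E * (A * C * xz / E) - A * x / E * (B * C * yz / E)
       - s / E * (A * (B * C) * w / E)) / (s / E)^2
      - 2 * (A * x / E) * (B * y / E * (C * z / E) - s / E * (B * C * yz / E)) / (s / E)^3 =
     A * (B * C) * ((xy * z + y * xz - x * yz - s * w) / s^2 - 2 * x * (y * z - s * yz) / s^3)"
proof -
  have 1: "A * B * xy / E * (C * z / E) + B * y / E * (A * C * xz / E) - A * x / E * (B * C * yz / E)
       - s / E * (A * (B * C) * w / E) = A * (B * C) * (xy * z + y * xz - x * yz - s * w) / E^2"
    by (simp add: power2_eq_square diff_divide_distrib add_divide_distrib algebra_simps)
  have 2: "2 * (A * x / E) * (B * y / E * (C * z / E) - s / E * (B * C * yz / E)) =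
      A * (B * C) * (2 * x * (y * z - s * yz)) / E^3"
    by (simp add: power3_eq_cube diff_divide_distrib add_divide_distrib algebra_simps)
  show ?thesis unfolding 1 2 using assms by (simp add: power_divide right_diff_distrib)
qed
lemma derivative_over_square: fixes s :: complex assumes "s \<noteq> 0"
  shows "(N' * s^2 - N * (2 * s * s')) / (s^2 * s^2) = N' / s^2 - 2 * s' * N / s^3"
  using assms by (simp add: diff_divide_distrib power2_eq_square power3_eq_cube mult_ac)

text \<open>The partial derivatives, of orders \<open>a, b, c\<close> in the three variables, of the lowest-weight part
  of \<open>\<sigma>\<close>.\<close>

definition schur :: "nat \<Rightarrow> nat \<Rightarrow> nat \<Rightarrow> complex^3 \<Rightarrow> complex" where
  "schur a b c u =
     (if (a, b, c) = (0, 0, 0) then u $ 1 - u $ 3 * (u $ 2)^2 + (u $ 3)^5 / 20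
      else if (a, b, c) = (0, 0, 1) then (u $ 3)^4 / 4 - (u $ 2)^2
      else if (a, b, c) = (0, 0, 2) then (u $ 3)^3
      else if (a, b, c) = (0, 0, 3) then 3 * (u $ 3)^2
      else if (a, b, c) = (0, 0, 4) then 6 * u $ 3
      else if (a, b, c) = (0, 0, 5) then 6
      else if (a, b, c) = (0, 1, 0) then - 2 * u $ 2 * u $ 3
      else if (a, b, c) = (0, 1, 1) then - 2 * u $ 2
      else if (a, b, c) = (0, 2, 0) then - 2 * u $ 3
      else if (a, b, c) = (0, 2, 1) then - 2
      else if (a, b, c) = (1, 0, 0) then 1
      else 0)"

definition schur1 :: "complex^3 \<Rightarrow> 3 \<Rightarrow> complex" where
  "schur1 u i = schur (of_bool (i = 1)) (of_bool (i = 2)) (of_bool (i = 3)) u"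

definition schur2 :: "complex^3 \<Rightarrow> 3 \<Rightarrow> 3 \<Rightarrow> complex" where
  "schur2 u i j = schur (of_bool (i = 1) + of_bool (j = 1)) (of_bool (i = 2) + of_bool (j = 2))
     (of_bool (i = 3) + of_bool (j = 3)) u"

definition schur3 :: "complex^3 \<Rightarrow> 3 \<Rightarrow> 3 \<Rightarrow> 3 \<Rightarrow> complex" where
  "schur3 u i j k = schur (of_bool (i = 1) + (of_bool (j = 1) + of_bool (k = 1)))
     (of_bool (i = 2) + (of_bool (j = 2) + of_bool (k = 2)))
     (of_bool (i = 3) + (of_bool (j = 3) + of_bool (k = 3))) u"

definition schur_wp2 :: "complex^3 \<Rightarrow> 3 \<Rightarrow> 3 \<Rightarrow> complex" where
  "schur_wp2 u i j = (schur1 u i * schur1 u j - schur 0 0 0 u * schur2 u i j) / schur 0 0 0 u ^ 2"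

definition schur_wp3 :: "complex^3 \<Rightarrow> 3 \<Rightarrow> 3 \<Rightarrow> 3 \<Rightarrow> complex" where
  "schur_wp3 u i j k = (schur2 u i j * schur1 u k + schur1 u j * schur2 u i k
     - schur1 u i * schur2 u j k - schur 0 0 0 u * schur3 u i j k) / schur 0 0 0 u ^ 2
     - 2 * schur1 u i * (schur1 u j * schur1 u k - schur 0 0 0 u * schur2 u j k) / schur 0 0 0 u ^ 3"

definition dilate :: "complex^3 \<Rightarrow> complex \<Rightarrow> complex^3" where
  "dilate u \<epsilon> = vector [\<epsilon>^5 * u $ 1, \<epsilon>^2 * u $ 2, \<epsilon> * u $ 3]"

definition wt3 :: "3 \<Rightarrow> nat" where
  "wt3 i = 5 * of_bool (i = 1) + 2 * of_bool (i = 2) + of_bool (i = 3)"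

locale leading = odd_entire +
  assumes leading: "sigma_leading_part \<sigma>"
begin

section \<open>Derivatives of \<sigma> along weighted dilations\<close>

definition sd :: "nat \<Rightarrow> nat \<Rightarrow> nat \<Rightarrow> complex^3 \<Rightarrow> complex" where
  "sd a b c = (pd 1 ^^ a) ((pd 2 ^^ b) ((pd 3 ^^ c) \<sigma>))"

lemma hol_sd: "hol3 UNIV (sd a b c)"
  unfolding sd_def by (intro hol3_pd_pow open_UNIV hol_sigma)

lemma pd_sd_123:
  "pd 1 (sd a b c) = sd (Suc a) b c" "pd 2 (sd a b c) = sd a (Suc b) c" "pd 3 (sd a b c) = sd a b (Suc c)"
proof -
  note h = hol3_pd_pow[OF open_UNIV]
  have 3: "pd 3 ((pd 2 ^^ b) ((pd 3 ^^ c) \<sigma>)) = (pd 2 ^^ b) ((pd 3 ^^ Suc c) \<sigma>)"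
    using pd_pow_commute[OF open_UNIV h[OF hol_sigma] UNIV_I] by (auto simp: fun_eq_iff)
  show "pd 1 (sd a b c) = sd (Suc a) b c" by (simp add: sd_def)
  show "pd 2 (sd a b c) = sd a (Suc b) c"
    unfolding sd_def using pd_pow_commute[OF open_UNIV h[OF h[OF hol_sigma]] UNIV_I]
    by (auto simp: fun_eq_iff)
  show "pd 3 (sd a b c) = sd a b (Suc c)"
    unfolding sd_def 3[symmetric] using pd_pow_commute[OF open_UNIV h[OF h[OF hol_sigma]] UNIV_I]
    by (auto simp: fun_eq_iff)
qed

lemma pd_sd: "pd i (sd a b c) = sd (of_bool (i = 1) + a) (of_bool (i = 2) + b) (of_bool (i = 3) + c)"
  using exhaust_3[of i] pd_sd_123 by auto

lemma sd_000: "sd 0 0 0 = \<sigma>" by (simp add: sd_def)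

text \<open>The given Taylor coefficients times factorials: 5!/20 = 6 and -2! = -2.\<close>

lemma sd_at_0:
  assumes "5 * a + 2 * b + c \<le> 5"
  shows "sd a b c 0 = (if (a, b, c) = (0, 0, 5) then 6 else if (a, b, c) = (0, 2, 1) then - 2
     else if (a, b, c) = (1, 0, 0) then 1 else 0)"
proof -
  have "sd a b c 0 = taylor_coeff \<sigma> a b c * (fact a * fact b * fact c)"
    by (simp add: sd_def taylor_coeff_def)
  then show ?thesis
    using leading assms unfolding sigma_leading_part_def by (auto simp: fact_numeral)
qed

definition sdf :: "complex^3 \<Rightarrow> nat \<Rightarrow> nat \<Rightarrow> nat \<Rightarrow> complex fps" where
  "sdf u a b c = fps_expansion (\<lambda>\<epsilon>. sd a b c (dilate u \<epsilon>)) 0"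

lemma sd_dilate_deriv:
  "((\<lambda>\<epsilon>. sd a b c (dilate u \<epsilon>)) has_field_derivative
     5 * u $ 1 * \<epsilon>^4 * sd (Suc a) b c (dilate u \<epsilon>) + 2 * u $ 2 * \<epsilon> * sd a (Suc b) c (dilate u \<epsilon>)
     + u $ 3 * sd a b (Suc c) (dilate u \<epsilon>)) (at \<epsilon>)"
proof -
  have "((\<lambda>\<epsilon>. dilate u \<epsilon> $ i) has_field_derivative
      (if i = 1 then 5 * u $ 1 * \<epsilon>^4 else if i = 2 then 2 * u $ 2 * \<epsilon> else u $ 3)) (at \<epsilon>)" for i
    using exhaust_3[of i] by (auto simp: dilate_def intro!: derivative_eq_intros)
  from hol3_chain[OF open_UNIV hol_sd UNIV_I this] show ?thesis
    by (simp add: sum_3 pd_sd_123)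
qed

lemma sdf: "(\<lambda>\<epsilon>. sd a b c (dilate u \<epsilon>)) has_fps_expansion sdf u a b c"
  unfolding sdf_def
proof (rule has_fps_expansion_fps_expansion[OF open_UNIV UNIV_I])
  show "(\<lambda>\<epsilon>. sd a b c (dilate u \<epsilon>)) holomorphic_on UNIV"
    unfolding holomorphic_on_def field_differentiable_def using sd_dilate_deriv by blast
qed

lemma dilate_0: "dilate u 0 = 0"
  by (simp add: dilate_def vec_eq_iff forall_3)

lemma sdf_nth_0: "fps_nth (sdf u a b c) 0 = sd a b c 0"
  using has_fps_expansion_imp_0_eq_fps_nth_0[OF sdf, of a b c u] by (simp add: dilate_0)

lemma sdf_deriv:
  "fps_deriv (sdf u a b c) = fps_const (5 * u $ 1) * fps_X^4 * sdf u (Suc a) b c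
     + fps_const (2 * u $ 2) * fps_X^1 * sdf u a (Suc b) c + fps_const (u $ 3) * sdf u a b (Suc c)"
proof (rule has_fps_expansion_unique_at)
  show "deriv (\<lambda>\<epsilon>. sd a b c (dilate u \<epsilon>)) has_fps_expansion fps_deriv (sdf u a b c)"
    by (intro fps_expansion_intros sdf)
  show "(\<lambda>\<epsilon>. 5 * u $ 1 * \<epsilon>^4 * sd (Suc a) b c (dilate u \<epsilon>) + 2 * u $ 2 * \<epsilon>^1 * sd a (Suc b) c (dilate u \<epsilon>)
     + u $ 3 * sd a b (Suc c) (dilate u \<epsilon>)) has_fps_expansion
     fps_const (5 * u $ 1) * fps_X^4 * sdf u (Suc a) b c
     + fps_const (2 * u $ 2) * fps_X^1 * sdf u a (Suc b) c + fps_const (u $ 3) * sdf u a b (Suc c)"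
    by (intro fps_expansion_intros sdf)
qed (simp add: DERIV_imp_deriv[OF sd_dilate_deriv])

text \<open>Solves \<open>sdf_deriv\<close> through order five, the weight of the leading part. The
  derivative in the first variable is accompanied by \<open>\<epsilon>^4\<close> and so appears at
  order five only.\<close>

lemma sdf_nth:
  "fps_nth (sdf u a b c) (Suc 0) = u $ 3 * fps_nth (sdf u a b (Suc c)) 0"
  "fps_nth (sdf u a b c) (Suc (Suc 0)) =
     (u $ 3 * fps_nth (sdf u a b (Suc c)) (Suc 0) + 2 * u $ 2 * fps_nth (sdf u a (Suc b) c) 0) / 2"
  "fps_nth (sdf u a b c) (Suc (Suc (Suc 0))) =
     (u $ 3 * fps_nth (sdf u a b (Suc c)) (Suc (Suc 0)) + 2 * u $ 2 * fps_nth (sdf u a (Suc b) c) (Suc 0)) / 3"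
  "fps_nth (sdf u a b c) (Suc (Suc (Suc (Suc 0)))) =
     (u $ 3 * fps_nth (sdf u a b (Suc c)) (Suc (Suc (Suc 0)))
      + 2 * u $ 2 * fps_nth (sdf u a (Suc b) c) (Suc (Suc 0))) / 4"
  "fps_nth (sdf u a b c) (Suc (Suc (Suc (Suc (Suc 0))))) =
     (u $ 3 * fps_nth (sdf u a b (Suc c)) (Suc (Suc (Suc (Suc 0))))
      + 2 * u $ 2 * fps_nth (sdf u a (Suc b) c) (Suc (Suc (Suc 0)))
      + 5 * u $ 1 * fps_nth (sdf u (Suc a) b c) 0) / 5"
proof -
  have c: "of_nat (Suc n) * fps_nth (sdf u a b c) (Suc n) =
     fps_nth (fps_const (5 * u $ 1) * (fps_X^4 * sdf u (Suc a) b c)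
     + fps_const (2 * u $ 2) * (fps_X^1 * sdf u a (Suc b) c) + fps_const (u $ 3) * sdf u a b (Suc c)) n" for n
    using arg_cong[OF sdf_deriv[of u a b c], of "\<lambda>F. fps_nth F n"] by (simp add: mult.assoc)
  note [simp] = fps_mult_left_const_nth fps_X_power_mult_nth
  show "fps_nth (sdf u a b c) (Suc 0) = u $ 3 * fps_nth (sdf u a b (Suc c)) 0"
    using c[of 0] by simp
  show "fps_nth (sdf u a b c) (Suc (Suc 0)) =
     (u $ 3 * fps_nth (sdf u a b (Suc c)) (Suc 0) + 2 * u $ 2 * fps_nth (sdf u a (Suc b) c) 0) / 2"
    using c[of "Suc 0"] by (simp add: add.commute mult.commute del: power_Suc)
  show "fps_nth (sdf u a b c) (Suc (Suc (Suc 0))) =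
     (u $ 3 * fps_nth (sdf u a b (Suc c)) (Suc (Suc 0)) + 2 * u $ 2 * fps_nth (sdf u a (Suc b) c) (Suc 0)) / 3"
    using c[of "Suc (Suc 0)"] by (simp add: add.commute mult.commute del: power_Suc)
  show "fps_nth (sdf u a b c) (Suc (Suc (Suc (Suc 0)))) =
     (u $ 3 * fps_nth (sdf u a b (Suc c)) (Suc (Suc (Suc 0)))
      + 2 * u $ 2 * fps_nth (sdf u a (Suc b) c) (Suc (Suc 0))) / 4"
    using c[of "Suc (Suc (Suc 0))"] by (simp add: add.commute mult.commute del: power_Suc)
  show "fps_nth (sdf u a b c) (Suc (Suc (Suc (Suc (Suc 0))))) =
     (u $ 3 * fps_nth (sdf u a b (Suc c)) (Suc (Suc (Suc (Suc 0))))
      + 2 * u $ 2 * fps_nth (sdf u a (Suc b) c) (Suc (Suc (Suc 0)))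
      + 5 * u $ 1 * fps_nth (sdf u (Suc a) b c) 0) / 5"
    using c[of "Suc (Suc (Suc (Suc 0)))"] by (simp add: add_ac mult.commute del: power_Suc)
qed

text \<open>Taylor coefficients of \<sigma> of weight below five vanish, so a derivative of weight w
  starts at order 5 - w at the earliest. The coefficient of that order sees the leading part
  alone.\<close>

lemma sdf_low_order:
  assumes "5 * a + 2 * b + c \<le> 5"
  shows "(\<forall>k<5 - (5 * a + 2 * b + c). fps_nth (sdf u a b c) k = 0) \<and>
     fps_nth (sdf u a b c) (5 - (5 * a + 2 * b + c)) = schur a b c u"
proof -
  note [simp] = sdf_nth sdf_nth_0 sd_at_0
  have b0: "fps_nth (sdf u a b c) k = 0" if "5 * a + 2 * b + c + k < 5" for a b c k
  proof -
    have "k = 0 \<or> k = Suc 0 \<or> k = Suc (Suc 0) \<or> k = Suc (Suc (Suc 0)) \<or> k = Suc (Suc (Suc (Suc 0)))"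
      using that by linarith
    then show ?thesis using that by (elim disjE) (hypsubst, auto)+
  qed
  have abc: "a = 0 \<and> b = 0 \<and> (c = 0 \<or> c = 1 \<or> c = 2 \<or> c = 3 \<or> c = 4 \<or> c = 5) \<or>
      a = 0 \<and> b = 1 \<and> (c = 0 \<or> c = 1 \<or> c = 2 \<or> c = 3) \<or>
      a = 0 \<and> b = 2 \<and> (c = 0 \<or> c = 1) \<or> a = 1 \<and> b = 0 \<and> c = 0"
    using assms by presburger
  have t: "fps_nth (sdf u 0 0 0) (5 - (5 * 0 + 2 * 0 + 0)) = schur 0 0 0 u"
    "fps_nth (sdf u 0 0 1) (5 - (5 * 0 + 2 * 0 + 1)) = schur 0 0 1 u"
    "fps_nth (sdf u 0 0 2) (5 - (5 * 0 + 2 * 0 + 2)) = schur 0 0 2 u"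
    "fps_nth (sdf u 0 0 3) (5 - (5 * 0 + 2 * 0 + 3)) = schur 0 0 3 u"
    "fps_nth (sdf u 0 0 4) (5 - (5 * 0 + 2 * 0 + 4)) = schur 0 0 4 u"
    "fps_nth (sdf u 0 0 5) (5 - (5 * 0 + 2 * 0 + 5)) = schur 0 0 5 u"
    "fps_nth (sdf u 0 1 0) (5 - (5 * 0 + 2 * 1 + 0)) = schur 0 1 0 u"
    "fps_nth (sdf u 0 1 1) (5 - (5 * 0 + 2 * 1 + 1)) = schur 0 1 1 u"
    "fps_nth (sdf u 0 1 2) (5 - (5 * 0 + 2 * 1 + 2)) = schur 0 1 2 u"
    "fps_nth (sdf u 0 1 3) (5 - (5 * 0 + 2 * 1 + 3)) = schur 0 1 3 u"
    "fps_nth (sdf u 0 2 0) (5 - (5 * 0 + 2 * 2 + 0)) = schur 0 2 0 u"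
    "fps_nth (sdf u 0 2 1) (5 - (5 * 0 + 2 * 2 + 1)) = schur 0 2 1 u"
    "fps_nth (sdf u 1 0 0) (5 - (5 * 1 + 2 * 0 + 0)) = schur 1 0 0 u"
    by (simp_all add: schur_def numeral_eq_Suc) (simp_all add: field_simps)
  have "fps_nth (sdf u a b c) (5 - (5 * a + 2 * b + c)) = schur a b c u"
    using abc by (elim disjE conjE) (simp_all only: t)
  then show ?thesis using b0 by simp
qed

text \<open>Up to weight five this reads off one power series coefficient. Beyond it the derivative
  of the leading part is zero, and the surplus power of \<open>\<epsilon>\<close> forces the limit 0
  by continuity.\<close>

lemma sd_dilate_limit:
  "((\<lambda>\<epsilon>. \<epsilon> ^ (5 * a + 2 * b + c) * sd a b c (dilate u \<epsilon>) / \<epsilon>^5) \<longlongrightarrow> schur a b c u) (at 0)"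
proof (cases "5 * a + 2 * b + c \<le> 5")
  case False
  define n where "n = 5 * a + 2 * b + c - 5"
  have n: "n > 0" "5 * a + 2 * b + c = n + 5" using False by (auto simp: n_def)
  have "isCont (\<lambda>\<epsilon>. sd a b c (dilate u \<epsilon>)) 0" by (rule DERIV_isCont[OF sd_dilate_deriv])
  then have "((\<lambda>\<epsilon>. \<epsilon> ^ n * sd a b c (dilate u \<epsilon>)) \<longlongrightarrow> 0 ^ n * sd a b c (dilate u 0)) (at 0)"
    by (intro tendsto_mult tendsto_power tendsto_ident_at) (simp add: continuous_at)
  moreover have "schur a b c u = 0" using False by (auto simp: schur_def)
  moreover have "(0::complex) ^ n = 0" using n(1) by simp
  ultimately have "((\<lambda>\<epsilon>. \<epsilon> ^ n * sd a b c (dilate u \<epsilon>)) \<longlongrightarrow> schur a b c u) (at 0)" by simp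
  then show ?thesis
    unfolding n(2) by (rule Lim_transform_eventually) (simp add: eventually_at_filter power_add)
next
  case True
  define m where "m = 5 - (5 * a + 2 * b + c)"
  have *: "(\<forall>k<m. fps_nth (sdf u a b c) k = 0) \<and> fps_nth (sdf u a b c) m = schur a b c u"
    unfolding m_def by (rule sdf_low_order[OF True])
  have "((\<lambda>\<epsilon>. sd a b c (dilate u \<epsilon>) / \<epsilon> ^ m) \<longlongrightarrow> fps_nth (sdf u a b c) m) (at 0)"
    by (rule tendsto_of_fps_expansion[OF sdf]) (use * in blast)
  then have lim: "((\<lambda>\<epsilon>. sd a b c (dilate u \<epsilon>) / \<epsilon> ^ m) \<longlongrightarrow> schur a b c u) (at 0)"
    using * by simp
  define n where "n = 5 * a + 2 * b + c"
  have "m + n = 5" using True by (simp add: m_def n_def)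
  then have e: "\<epsilon> ^ 5 = \<epsilon> ^ m * \<epsilon> ^ n" for \<epsilon> :: complex by (metis power_add)
  have "\<forall>\<^sub>F \<epsilon> in at 0. sd a b c (dilate u \<epsilon>) / \<epsilon> ^ m = \<epsilon> ^ n * sd a b c (dilate u \<epsilon>) / \<epsilon>^5"
    unfolding e by (simp add: eventually_at_filter)
  from Lim_transform_eventually[OF lim this] show ?thesis by (simp only: n_def)
qed

section \<open>Leading terms of the two- and three-index functions\<close>

lemma wp2_sd:
  assumes "u \<in> Om"
  shows "wp2 \<sigma> u i j = (pd i \<sigma> u * pd j \<sigma> u - \<sigma> u * pd i (pd j \<sigma>) u) / \<sigma> u ^ 2"
  using pd_minus[OF hol_ld assms, of i j] pd_ld[OF assms, of i j] by (simp add: wp2_def ld_def)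

lemma wp3_sd:
  assumes u: "u \<in> Om"
  shows "wp3 \<sigma> u i j k = (pd i (pd j \<sigma>) u * pd k \<sigma> u + pd j \<sigma> u * pd i (pd k \<sigma>) u
     - pd i \<sigma> u * pd j (pd k \<sigma>) u - \<sigma> u * pd i (pd j (pd k \<sigma>)) u) / \<sigma> u ^ 2
     - 2 * pd i \<sigma> u * (pd j \<sigma> u * pd k \<sigma> u - \<sigma> u * pd j (pd k \<sigma>) u) / \<sigma> u ^ 3" (is "_ = ?R")
proof -
  note h = hol3_pd[OF open_UNIV]
  have 1: "pd j (\<lambda>v. pd k \<sigma> v / \<sigma> v) v =
      - ((pd j \<sigma> v * pd k \<sigma> v - \<sigma> v * pd j (pd k \<sigma>) v) / \<sigma> v ^ 2)" if "v \<in> Om" for v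
    using wp2_sd[OF that, of j k] unfolding wp2_def by (metis minus_minus)
  have "pd i (pd j (\<lambda>v. pd k \<sigma> v / \<sigma> v)) u =
      pd i (\<lambda>v. - ((pd j \<sigma> v * pd k \<sigma> v - \<sigma> v * pd j (pd k \<sigma>) v) / \<sigma> v ^ 2)) u"
    by (rule pd_cong[OF open_Om u 1])
  also have "\<dots> = - ?R"
  proof (rule pd_eqI)
    have s: "\<sigma> u \<noteq> 0" using u by (simp add: Om_def)
    note d = hol3_has_pd[OF hol_sigma UNIV_I] hol3_has_pd[OF h[OF hol_sigma] UNIV_I]
      hol3_has_pd[OF h[OF h[OF hol_sigma]] UNIV_I]
    show "((\<lambda>z. - ((pd j \<sigma> (u + z *s axis i 1) * pd k \<sigma> (u + z *s axis i 1)
        - \<sigma> (u + z *s axis i 1) * pd j (pd k \<sigma>) (u + z *s axis i 1)) / \<sigma> (u + z *s axis i 1) ^ 2))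
        has_field_derivative - ?R) (at 0)"
    proof -
      let ?N = "\<lambda>v. pd j \<sigma> v * pd k \<sigma> v - \<sigma> v * pd j (pd k \<sigma>) v"
      have N: "((\<lambda>z. ?N (u + z *s axis i 1)) has_field_derivative
          pd i (pd j \<sigma>) u * pd k \<sigma> u + pd j \<sigma> u * pd i (pd k \<sigma>) u
          - pd i \<sigma> u * pd j (pd k \<sigma>) u - \<sigma> u * pd i (pd j (pd k \<sigma>)) u) (at 0)"
        by (auto intro!: derivative_eq_intros d)
      have S: "((\<lambda>z. \<sigma> (u + z *s axis i 1) ^ 2) has_field_derivative 2 * \<sigma> u * pd i \<sigma> u) (at 0)"
        by (auto intro!: derivative_eq_intros d)
      have "((\<lambda>z. ?N (u + z *s axis i 1) / \<sigma> (u + z *s axis i 1) ^ 2) has_field_derivative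
          ((pd i (pd j \<sigma>) u * pd k \<sigma> u + pd j \<sigma> u * pd i (pd k \<sigma>) u
          - pd i \<sigma> u * pd j (pd k \<sigma>) u - \<sigma> u * pd i (pd j (pd k \<sigma>)) u) * \<sigma> u ^ 2
           - ?N u * (2 * \<sigma> u * pd i \<sigma> u)) / (\<sigma> u ^ 2 * \<sigma> u ^ 2)) (at 0)"
        using DERIV_divide[OF N S] s by simp
      from DERIV_minus[OF this] show ?thesis unfolding derivative_over_square[OF s] .
    qed
  qed
  finally show ?thesis by (simp add: wp3_def)
qed

lemma pd_sigma_limit:
  "((\<lambda>\<epsilon>. \<sigma> (dilate u \<epsilon>) / \<epsilon>^5) \<longlongrightarrow> schur 0 0 0 u) (at 0)"
  "((\<lambda>\<epsilon>. \<epsilon> ^ wt3 i * pd i \<sigma> (dilate u \<epsilon>) / \<epsilon>^5) \<longlongrightarrow> schur1 u i) (at 0)"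
  "((\<lambda>\<epsilon>. \<epsilon> ^ (wt3 i + wt3 j) * pd i (pd j \<sigma>) (dilate u \<epsilon>) / \<epsilon>^5) \<longlongrightarrow> schur2 u i j) (at 0)"
  "((\<lambda>\<epsilon>. \<epsilon> ^ (wt3 i + (wt3 j + wt3 k)) * pd i (pd j (pd k \<sigma>)) (dilate u \<epsilon>) / \<epsilon>^5) \<longlongrightarrow> schur3 u i j k) (at 0)"
proof -
  have p: "pd i \<sigma> = sd (of_bool (i = 1)) (of_bool (i = 2)) (of_bool (i = 3))" for i
    using pd_sd[of i 0 0 0] by (simp add: sd_000)
  show "((\<lambda>\<epsilon>. \<sigma> (dilate u \<epsilon>) / \<epsilon>^5) \<longlongrightarrow> schur 0 0 0 u) (at 0)"
    using sd_dilate_limit[of 0 0 0 u] by (simp add: sd_000)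
  have w1: "5 * of_bool (i = 1) + 2 * of_bool (i = 2) + of_bool (i = 3) = wt3 i" for i
    by (simp add: wt3_def)
  show "((\<lambda>\<epsilon>. \<epsilon> ^ wt3 i * pd i \<sigma> (dilate u \<epsilon>) / \<epsilon>^5) \<longlongrightarrow> schur1 u i) (at 0)"
    using sd_dilate_limit[of "of_bool (i = 1)" "of_bool (i = 2)" "of_bool (i = 3)" u]
    unfolding w1 by (simp only: p schur1_def)
  have w2: "5 * (of_bool (i = 1) + a) + 2 * (of_bool (i = 2) + b) + (of_bool (i = 3) + c) =
      wt3 i + (5 * a + 2 * b + c)" for i a b c
    by (simp add: wt3_def)
  show "((\<lambda>\<epsilon>. \<epsilon> ^ (wt3 i + wt3 j) * pd i (pd j \<sigma>) (dilate u \<epsilon>) / \<epsilon>^5) \<longlongrightarrow> schur2 u i j) (at 0)"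
    using sd_dilate_limit[of "of_bool (i = 1) + of_bool (j = 1)" "of_bool (i = 2) + of_bool (j = 2)"
        "of_bool (i = 3) + of_bool (j = 3)" u]
    unfolding w2 w1 by (simp only: p pd_sd schur2_def)
  show "((\<lambda>\<epsilon>. \<epsilon> ^ (wt3 i + (wt3 j + wt3 k)) * pd i (pd j (pd k \<sigma>)) (dilate u \<epsilon>) / \<epsilon>^5) \<longlongrightarrow> schur3 u i j k) (at 0)"
    using sd_dilate_limit[of "of_bool (i = 1) + (of_bool (j = 1) + of_bool (k = 1))"
        "of_bool (i = 2) + (of_bool (j = 2) + of_bool (k = 2))"
        "of_bool (i = 3) + (of_bool (j = 3) + of_bool (k = 3))" u]
    unfolding w2 w1 by (simp only: p pd_sd schur3_def)
qed

lemma dilate_in_Om: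
  assumes "schur 0 0 0 u \<noteq> 0"
  shows "\<forall>\<^sub>F \<epsilon> in at 0. \<epsilon> \<noteq> 0 \<and> dilate u \<epsilon> \<in> Om"
proof -
  have "\<forall>\<^sub>F \<epsilon> in at 0. \<sigma> (dilate u \<epsilon>) / \<epsilon>^5 \<noteq> 0"
    by (rule tendsto_imp_eventually_ne[OF pd_sigma_limit(1) assms])
  then show ?thesis by (rule eventually_mono) (auto simp: Om_def)
qed

text \<open>After division of \<sigma> and its derivatives by \<open>\<epsilon>^5\<close>, every
  factor converges, and the denominator tends to the square of the leading part, which is nonzero at
  \<open>u\<close>.\<close>

lemma wp2_limit:
  assumes S: "schur 0 0 0 u \<noteq> 0"
  shows "((\<lambda>\<epsilon>. \<epsilon> ^ (wt3 i + wt3 j) * wp2 \<sigma> (dilate u \<epsilon>) i j) \<longlongrightarrow> schur_wp2 u i j) (at 0)"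
proof -
  define s where "s = (\<lambda>\<epsilon>. \<sigma> (dilate u \<epsilon>) / \<epsilon>^5)"
  define s1 where "s1 = (\<lambda>i \<epsilon>. \<epsilon> ^ wt3 i * pd i \<sigma> (dilate u \<epsilon>) / \<epsilon>^5)"
  define s2 where "s2 = (\<lambda>i j \<epsilon>. \<epsilon> ^ (wt3 i + wt3 j) * pd i (pd j \<sigma>) (dilate u \<epsilon>) / \<epsilon>^5)"
  have "((\<lambda>\<epsilon>. (s1 i \<epsilon> * s1 j \<epsilon> - s \<epsilon> * s2 i j \<epsilon>) / s \<epsilon> ^ 2) \<longlongrightarrow> schur_wp2 u i j) (at 0)"
    unfolding schur_wp2_def s_def s1_def s2_def using S by (intro tendsto_intros pd_sigma_limit) auto
  moreover have "\<forall>\<^sub>F \<epsilon> in at 0. (s1 i \<epsilon> * s1 j \<epsilon> - s \<epsilon> * s2 i j \<epsilon>) / s \<epsilon> ^ 2 =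
      \<epsilon> ^ (wt3 i + wt3 j) * wp2 \<sigma> (dilate u \<epsilon>) i j"
    using dilate_in_Om[OF S]
  proof (rule eventually_mono, elim conjE)
    fix \<epsilon> :: complex assume e: "\<epsilon> \<noteq> 0" "dilate u \<epsilon> \<in> Om"
    define e5 where "e5 = \<epsilon> ^ 5"
    have e5: "e5 \<noteq> 0" using e by (simp add: e5_def)
    have z: "\<sigma> (dilate u \<epsilon>) \<noteq> 0" using e by (simp add: Om_def)
    show "(s1 i \<epsilon> * s1 j \<epsilon> - s \<epsilon> * s2 i j \<epsilon>) / s \<epsilon> ^ 2 = \<epsilon> ^ (wt3 i + wt3 j) * wp2 \<sigma> (dilate u \<epsilon>) i j"
      unfolding s_def s1_def s2_def wp2_sd[OF e(2)] e5_def[symmetric] power_add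
      by (rule rescale_second_log_derivative[OF e5 z])
  qed
  ultimately show ?thesis by (rule Lim_transform_eventually)
qed

lemma wp3_limit:
  assumes S: "schur 0 0 0 u \<noteq> 0"
  shows "((\<lambda>\<epsilon>. \<epsilon> ^ (wt3 i + (wt3 j + wt3 k)) * wp3 \<sigma> (dilate u \<epsilon>) i j k) \<longlongrightarrow> schur_wp3 u i j k) (at 0)"
proof -
  define s where "s = (\<lambda>\<epsilon>. \<sigma> (dilate u \<epsilon>) / \<epsilon>^5)"
  define s1 where "s1 = (\<lambda>i \<epsilon>. \<epsilon> ^ wt3 i * pd i \<sigma> (dilate u \<epsilon>) / \<epsilon>^5)"
  define s2 where "s2 = (\<lambda>i j \<epsilon>. \<epsilon> ^ (wt3 i + wt3 j) * pd i (pd j \<sigma>) (dilate u \<epsilon>) / \<epsilon>^5)"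
  define s3 where "s3 = (\<lambda>i j k \<epsilon>. \<epsilon> ^ (wt3 i + (wt3 j + wt3 k)) * pd i (pd j (pd k \<sigma>)) (dilate u \<epsilon>) / \<epsilon>^5)"
  let ?f = "\<lambda>\<epsilon>. (s2 i j \<epsilon> * s1 k \<epsilon> + s1 j \<epsilon> * s2 i k \<epsilon> - s1 i \<epsilon> * s2 j k \<epsilon> - s \<epsilon> * s3 i j k \<epsilon>) / s \<epsilon> ^ 2
      - 2 * s1 i \<epsilon> * (s1 j \<epsilon> * s1 k \<epsilon> - s \<epsilon> * s2 j k \<epsilon>) / s \<epsilon> ^ 3"
  have "(?f \<longlongrightarrow> schur_wp3 u i j k) (at 0)"
    unfolding schur_wp3_def s_def s1_def s2_def s3_def using S by (intro tendsto_intros pd_sigma_limit) auto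
  moreover have "\<forall>\<^sub>F \<epsilon> in at 0. ?f \<epsilon> = \<epsilon> ^ (wt3 i + (wt3 j + wt3 k)) * wp3 \<sigma> (dilate u \<epsilon>) i j k"
    using dilate_in_Om[OF S]
  proof (rule eventually_mono, elim conjE)
    fix \<epsilon> :: complex assume e: "\<epsilon> \<noteq> 0" "dilate u \<epsilon> \<in> Om"
    define e5 where "e5 = \<epsilon> ^ 5"
    have e5: "e5 \<noteq> 0" using e by (simp add: e5_def)
    have z: "\<sigma> (dilate u \<epsilon>) \<noteq> 0" using e by (simp add: Om_def)
    show "?f \<epsilon> = \<epsilon> ^ (wt3 i + (wt3 j + wt3 k)) * wp3 \<sigma> (dilate u \<epsilon>) i j k"
      unfolding s_def s1_def s2_def s3_def wp3_sd[OF e(2)] e5_def[symmetric] power_add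
      by (rule rescale_third_log_derivative[OF e5 z])
  qed
  ultimately show ?thesis by (rule Lim_transform_eventually)
qed

end

section \<open>Linear independence by weights\<close>

text \<open>Sorted by weight, where the indices 1, 2, 3 count 5, 2, 1. The entry 1 lets terms linear
  in the three-index functions be treated as products, so a bilinear expression has 7 * 10
  coefficients.\<close>

definition wps2 :: "(3 \<Rightarrow> 3 \<Rightarrow> complex) \<Rightarrow> complex list" where
  "wps2 p = [1, p 3 3, p 2 3, p 2 2, p 1 3, p 1 2, p 1 1]"

definition wps3 :: "(3 \<Rightarrow> 3 \<Rightarrow> 3 \<Rightarrow> complex) \<Rightarrow> complex list" where
  "wps3 q = [q 3 3 3, q 2 3 3, q 2 2 3, q 2 2 2, q 1 3 3, q 1 2 3, q 1 2 2, q 1 1 3, q 1 1 2, q 1 1 1]"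

definition wts2 :: "nat list" where "wts2 = [0, 2, 3, 4, 6, 7, 10]"
definition wts3 :: "nat list" where "wts3 = [3, 4, 5, 6, 7, 8, 9, 11, 12, 15]"

definition bilinear_form ::
    "(nat \<Rightarrow> nat \<Rightarrow> complex) \<Rightarrow> (3 \<Rightarrow> 3 \<Rightarrow> complex) \<Rightarrow> (3 \<Rightarrow> 3 \<Rightarrow> 3 \<Rightarrow> complex) \<Rightarrow> complex" where
  "bilinear_form C p q = (\<Sum>i<7. \<Sum>j<10. C i j * (wps2 p ! i * wps3 q ! j))"

definition weight_part ::
    "nat \<Rightarrow> (nat \<Rightarrow> nat \<Rightarrow> complex) \<Rightarrow> (3 \<Rightarrow> 3 \<Rightarrow> complex) \<Rightarrow> (3 \<Rightarrow> 3 \<Rightarrow> 3 \<Rightarrow> complex) \<Rightarrow> complex" where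
  "weight_part N C p q = (\<Sum>i<7. \<Sum>j<10.
     if wts2 ! i + wts3 ! j = N then C i j * (wps2 p ! i * wps3 q ! j) else 0)"

definition weight_le :: "nat \<Rightarrow> (nat \<Rightarrow> nat \<Rightarrow> complex) \<Rightarrow> bool" where
  "weight_le N C \<longleftrightarrow> (\<forall>i<7. \<forall>j<10. N < wts2 ! i + wts3 ! j \<longrightarrow> C i j = 0)"

text \<open>The relations as lists of entries \<open>(i, j, c)\<close>, standing for \<open>c\<close> times entry \<open>i\<close> of \<open>wps2\<close> times
  entry \<open>j\<close> of \<open>wps3\<close>.\<close>

definition rel_table :: "(nat \<Rightarrow> complex) \<Rightarrow> (nat \<times> nat \<times> complex) list list" where
  "rel_table lam =
    [[(0, 0, lam 3), (0, 3, 1), (1, 1, - 2), (2, 0, 2)],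
     [(0, 4, 2), (1, 2, - 2), (2, 1, 1), (3, 0, 1)],
     [(0, 5, - 4), (1, 3, - 2), (2, 2, - 2), (3, 1, 4)],
     [(0, 0, 4 * lam 2 - lam 3 * lam 3), (0, 3, - lam 3), (0, 6, 4), (1, 4, - 8), (2, 3, - 2), (3, 2, 2),
      (4, 0, 8)],
     [(1, 5, 2), (2, 4, 1), (4, 1, - 2), (5, 0, - 1)],
     [(0, 7, 4), (1, 6, 2), (2, 5, 2), (3, 4, - 1), (5, 1, - 3)],
     [(0, 7, 1), (1, 6, - 1), (2, 5, 2), (3, 4, 2), (4, 2, - 3)],
     [(0, 0, lam 1), (1, 4, - lam 3), (2, 6, - 1), (4, 0, lam 3), (5, 2, 1)],
     [(0, 0, - 2 * lam 1), (0, 8, - 1), (1, 4, 2 * lam 3), (2, 6, 1), (3, 5, - 2), (4, 0, - 2 * lam 3),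
      (4, 3, 1)],
     [(0, 1, lam 1), (0, 4, - 2 * lam 2), (1, 7, - 8), (2, 4, - 3 * lam 3), (3, 6, - 3), (4, 1, 3 * lam
      3), (4, 4, 4), (5, 3, 3), (6, 0, 4)],
     [(1, 8, 2), (2, 7, - 2), (4, 5, 4), (5, 4, - 4)],
     [(0, 2, (3/2) * lam 1), (0, 5, - 3 * lam 2), (0, 7, (9/2) * lam 3), (1, 8, 2), (2, 7, 4), (4, 5, -
      2), (5, 4, - 1), (6, 1, - 3)],
     [(0, 0, - (4/3) * lam 0 - (1/6) * lam 1 * lam 3), (0, 3, (1/3) * lam 1), (0, 6, - lam 2), (0, 8,
      (3/2) * lam 3), (0, 9, - 1), (1, 4, (2/3) * lam 2), (2, 8, (4/3)), (3, 7, (2/3)), (4, 0, - (2/3) *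
      lam 2), (4, 6, - (1/3)), (5, 5, - (2/3)), (6, 2, - 1)],
     [(0, 0, - (4/3) * lam 0 - (1/6) * lam 1 * lam 3), (0, 3, - (1/6) * lam 1), (1, 4, (2/3) * lam 2),
      (2, 8, (1/3)), (3, 7, - (1/3)), (4, 0, - (2/3) * lam 2), (4, 6, (2/3)), (5, 5, - (2/3))],
     [(0, 1, - 4 * lam 0), (0, 4, 3 * lam 1), (1, 7, 2 * lam 3), (2, 4, 2 * lam 2), (3, 8, 2), (4, 1, - 2
      * lam 2), (4, 4, - lam 3), (5, 6, - 1), (6, 0, - lam 3), (6, 3, - 1)],
     [(0, 2, 2 * lam 0), (0, 5, - (4/3) * lam 1), (0, 7, (2/3) * lam 2), (1, 9, (2/3)), (4, 7, (2/3)),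
      (6, 4, - (4/3))],
     [(0, 0, - lam 0 * lam 3), (0, 3, lam 0), (0, 6, - (4/3) * lam 1), (0, 8, (2/3) * lam 2), (1, 4, lam
      1), (2, 9, (2/3)), (4, 0, - lam 1), (4, 8, (1/3)), (5, 7, (1/3)), (6, 5, - (4/3))],
     [(0, 0, - lam 0 * lam 3), (0, 3, - 2 * lam 0), (0, 6, (2/3) * lam 1), (0, 8, - (1/3) * lam 2), (1,
      4, lam 1), (2, 9, - (1/3)), (4, 0, - lam 1), (4, 8, (4/3)), (5, 7, - (5/3)), (6, 5, (2/3))],
     [(0, 1, - 2 * lam 0 * lam 3 + (2/9) * lam 1 * lam 2), (0, 4, (8/3) * lam 0 + (4/3) * lam 1 * lam 3 -
      (4/9) * lam 2 * lam 2), (1, 7, (8/9) * lam 2), (2, 4, 2 * lam 1), (3, 9, (2/3)), (4, 1, - 2 * lam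
      1), (4, 4, - (4/9) * lam 2), (5, 8, (2/3)), (6, 0, - (4/9) * lam 2), (6, 6, - (4/3))],
     [(0, 0, - 2 * lam 0 * lam 2 + (1/2) * lam 1 * lam 1), (0, 6, - 3 * lam 0), (0, 8, (1/2) * lam 1),
      (1, 4, 4 * lam 0), (4, 0, - 4 * lam 0), (4, 9, 1), (6, 7, - 1)],
     [(0, 1, - 2 * lam 0 * lam 2 + (2/3) * lam 1 * lam 1), (0, 4, 3 * lam 0 * lam 3 - (1/3) * lam 1 * lam
      2), (1, 7, (2/3) * lam 1), (2, 4, 4 * lam 0), (4, 1, - 4 * lam 0), (4, 4, - (1/3) * lam 1), (5, 9,
      1), (6, 0, - (1/3) * lam 1), (6, 8, - 1)]]"

text \<open>The largest weight of a monomial in each relation. Coefficients containing some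
  \<open>lam j\<close> occur only at smaller weights.\<close>

definition rel_weights :: "nat list" where
  "rel_weights = [6, 7, 8, 9, 10, 11, 11, 12, 12, 13, 14, 14, 15, 15, 16, 17, 18, 18, 19, 21, 22]"

definition rel_coeff :: "(nat \<Rightarrow> complex) \<Rightarrow> nat \<Rightarrow> nat \<Rightarrow> nat \<Rightarrow> complex" where
  "rel_coeff lam n i j = (\<Sum>(i', j', c)\<leftarrow>rel_table lam ! n. if i' = i \<and> j' = j then c else 0)"

lemma all_less_numeral: "(\<forall>n<numeral k. P n) \<longleftrightarrow> P (pred_numeral k) \<and> (\<forall>n<pred_numeral k. P n)"
  by (simp add: numeral_eq_Suc less_Suc_eq all_conj_distrib conj_commute)

lemma sum_list_zero: "(\<And>x. x \<in> set xs \<Longrightarrow> f x = 0) \<Longrightarrow> (\<Sum>x\<leftarrow>xs. f x) = (0::complex)"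
  by (induction xs) auto

lemma rel_coeff_weight: "n < 21 \<Longrightarrow> weight_le (rel_weights ! n) (rel_coeff lam n)"
proof -
  have "\<forall>n<21. \<forall>(i, j, c)\<in>set (rel_table lam ! n). wts2 ! i + wts3 ! j \<le> rel_weights ! n"
    by (simp add: all_less_numeral rel_table_def rel_weights_def wts2_def wts3_def)
  then show "n < 21 \<Longrightarrow> weight_le (rel_weights ! n) (rel_coeff lam n)"
    unfolding weight_le_def rel_coeff_def by (fastforce intro!: sum_list_zero)
qed

lemma sum_indicator_list:
  fixes m n :: nat
  assumes "\<forall>(i, j, c)\<in>set T. i < m \<and> j < n"
  shows "(\<Sum>i<m. \<Sum>j<n. (\<Sum>(i', j', c)\<leftarrow>T. if i' = i \<and> j' = j then c else 0) * (x i * y j)) =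
     (\<Sum>(i, j, c)\<leftarrow>T. c * (x i * y j :: complex))"
  using assms
proof (induction T)
  case (Cons t T)
  obtain i0 j0 c0 where t: "t = (i0, j0, c0)" by (metis prod_cases3)
  have ij: "i0 < m" "j0 < n" using Cons.prems by (simp_all add: t)
  have "(\<Sum>j<n. (if i0 = i \<and> j0 = j then c0 else 0) * (x i * y j)) = (if i0 = i then c0 * (x i * y j0) else 0)" for i
  proof -
    have "(\<Sum>j<n. (if i0 = i \<and> j0 = j then c0 else 0) * (x i * y j)) =
        (\<Sum>j<n. if j0 = j then (if i0 = i then c0 else 0) * (x i * y j) else 0)"
      by (intro sum.cong) auto
    then show ?thesis using ij by simp
  qed
  then have "(\<Sum>i<m. \<Sum>j<n. (if i0 = i \<and> j0 = j then c0 else 0) * (x i * y j)) = c0 * (x i0 * y j0)"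
    using ij by simp
  with Cons show ?case by (simp add: t distrib_right sum.distrib)
qed simp

lemma relations34_form:
  assumes "n < 21"
  shows "relations34 lam p q ! n = bilinear_form (rel_coeff lam n) p q"
proof -
  have "\<forall>n<21. \<forall>(i, j, c)\<in>set (rel_table lam ! n). i < 7 \<and> j < 10"
    by (simp add: all_less_numeral rel_table_def)
  then have "bilinear_form (rel_coeff lam n) p q =
      (\<Sum>(i, j, c)\<leftarrow>rel_table lam ! n. c * (wps2 p ! i * wps3 q ! j))"
    unfolding bilinear_form_def rel_coeff_def using sum_indicator_list assms by blast
  moreover have "relations34 lam p q =
      map (\<lambda>T. \<Sum>(i, j, c)\<leftarrow>T. c * (wps2 p ! i * wps3 q ! j)) (rel_table lam)"
    unfolding relations34_def rel_table_def list.map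
    by (intro arg_cong2[where f = Cons] refl; simp add: wps2_def wps3_def; algebra)
  moreover have "length (rel_table lam) = 21" by (simp add: rel_table_def)
  ultimately show ?thesis using assms by simp
qed

lemma bilinear_form_linear:
  "bilinear_form (\<lambda>i j. C i j + (\<Sum>n<(m::nat). a n * D n i j)) p q =
    bilinear_form C p q + (\<Sum>n<m. a n * bilinear_form (D n) p q)"
  unfolding bilinear_form_def
proof (induction m)
  case (Suc m)
  then show ?case
    by (simp add: distrib_right sum.distrib sum_distrib_left mult.assoc flip: add.assoc)
qed simp

lemma bilinear_form_monomial:
  "i0 < 7 \<Longrightarrow> j0 < 10 \<Longrightarrow>
    bilinear_form (\<lambda>i j. if i0 = i \<and> j0 = j then c else 0) p q = c * (wps2 p ! i0 * wps3 q ! j0)"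
  using sum_indicator_list[of "[(i0, j0, c)]" 7 10 "\<lambda>i. wps2 p ! i" "\<lambda>j. wps3 q ! j"]
  by (simp add: bilinear_form_def)

text \<open>On symmetric arrays the many index tuples of \<open>bilinear_expr\<close> collapse to
  the 70 monomials of \<open>bilinear_form\<close>.\<close>

definition is_form :: "((3 \<Rightarrow> 3 \<Rightarrow> complex) \<Rightarrow> (3 \<Rightarrow> 3 \<Rightarrow> 3 \<Rightarrow> complex) \<Rightarrow> complex) \<Rightarrow> bool" where
  "is_form f \<longleftrightarrow> (\<exists>C. \<forall>p q. symmetric2 p \<longrightarrow> symmetric3 q \<longrightarrow> f p q = bilinear_form C p q)"

lemma is_form_sum:
  assumes "finite A" "\<And>x. x \<in> A \<Longrightarrow> is_form (f x)"
  shows "is_form (\<lambda>p q. \<Sum>x\<in>A. f x p q)"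
  using assms
proof (induction A rule: finite_induct)
  case empty
  show ?case unfolding is_form_def
    by (rule exI[of _ "\<lambda>_ _. 0"]) (simp add: bilinear_form_def)
next
  case (insert x A)
  have "is_form (f x)" "is_form (\<lambda>p q. \<Sum>x\<in>A. f x p q)" using insert by simp_all
  then obtain C D where
    "\<forall>p q. symmetric2 p \<longrightarrow> symmetric3 q \<longrightarrow> f x p q = bilinear_form C p q"
    "\<forall>p q. symmetric2 p \<longrightarrow> symmetric3 q \<longrightarrow> (\<Sum>x\<in>A. f x p q) = bilinear_form D p q"
    unfolding is_form_def by blast
  then show ?case
    using insert.hyps unfolding is_form_def
    by (intro exI[of _ "\<lambda>i j. C i j + D i j"]) (simp add: bilinear_form_def distrib_right sum.distrib)
qed

lemma is_form_add: "is_form f \<Longrightarrow> is_form g \<Longrightarrow> is_form (\<lambda>p q. f p q + g p q)"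
  using is_form_sum[of UNIV "\<lambda>b. if b then f else g"] by (simp add: UNIV_bool add.commute)

lemma is_form_monomial:
  "is_form (\<lambda>p q. c * q k l m)" "is_form (\<lambda>p q. d * (p i j * q k l m))"
proof -
  have 2: "\<exists>i0<7. \<forall>p. symmetric2 p \<longrightarrow> p i j = wps2 p ! i0"
  proof -
    have "\<exists>i0\<in>{1, 2, 3, 4, 5, 6}. \<forall>p. symmetric2 p \<longrightarrow> p i j = wps2 p ! i0"
      using exhaust_3[of i] exhaust_3[of j]
      by (elim disjE; hypsubst; simp add: wps2_def symmetric2_def; metis)
    then obtain i0 :: nat where "i0 \<in> {1, 2, 3, 4, 5, 6}" "\<forall>p. symmetric2 p \<longrightarrow> p i j = wps2 p ! i0" by blast
    moreover from this(1) have "i0 < 7" by auto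
    ultimately show ?thesis by blast
  qed
  have 3: "\<exists>j0<10. \<forall>q. symmetric3 q \<longrightarrow> q k l m = wps3 q ! j0"
  proof -
    have "\<exists>j0\<in>{0, 1, 2, 3, 4, 5, 6, 7, 8, 9}. \<forall>q. symmetric3 q \<longrightarrow> q k l m = wps3 q ! j0"
      using exhaust_3[of k] exhaust_3[of l] exhaust_3[of m]
      by (elim disjE; hypsubst; simp add: wps3_def symmetric3_def; metis)
    then obtain j0 :: nat where "j0 \<in> {0, 1, 2, 3, 4, 5, 6, 7, 8, 9}"
      "\<forall>q. symmetric3 q \<longrightarrow> q k l m = wps3 q ! j0" by blast
    moreover from this(1) have "j0 < 10" by auto
    ultimately show ?thesis by blast
  qed
  obtain i0 j0 where *: "i0 < 7" "j0 < 10" "\<forall>p. symmetric2 p \<longrightarrow> p i j = wps2 p ! i0"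
    "\<forall>q. symmetric3 q \<longrightarrow> q k l m = wps3 q ! j0"
    using 2 3 by blast
  show "is_form (\<lambda>p q. d * (p i j * q k l m))"
    unfolding is_form_def using * bilinear_form_monomial[OF *(1,2), of d]
    by (intro exI[of _ "\<lambda>i j. if i0 = i \<and> j0 = j then d else 0"]) simp
  show "is_form (\<lambda>p q. c * q k l m)"
    unfolding is_form_def using * bilinear_form_monomial[of 0 j0 c]
    by (intro exI[of _ "\<lambda>i j. if 0 = i \<and> j0 = j then c else 0"]) (simp add: wps2_def)
qed

lemma is_form_bilinear_expr: "is_form (bilinear_expr c d)"
proof -
  have "is_form (\<lambda>p q. bilinear_expr c d p q)"
    unfolding bilinear_expr_def by (intro is_form_add is_form_sum is_form_monomial finite)
  then show ?thesis .
qed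

section \<open>Linear algebra in a single weight\<close>

definition weight_reducible :: "(nat \<Rightarrow> complex) \<Rightarrow> nat \<Rightarrow> (nat \<Rightarrow> nat \<Rightarrow> complex) \<Rightarrow> bool" where
  "weight_reducible lam N C \<longleftrightarrow> (\<exists>a. (\<forall>n<21. a n \<noteq> 0 \<longrightarrow> rel_weights ! n = N) \<and>
     (\<forall>i<7. \<forall>j<10. wts2 ! i + wts3 ! j = N \<longrightarrow> C i j = (\<Sum>n<21. a n * rel_coeff lam n i j)))"

lemma sum_less_numeral: "sum f {..<numeral k} = sum f {..<pred_numeral k} + f (pred_numeral k)"
  by (simp add: numeral_eq_Suc lessThan_Suc add.commute)

lemmas reduction_simps = all_less_numeral sum_less_numeral rel_coeff_def rel_table_def rel_weights_def wts2_def wts3_def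

text \<open>Points where the lowest-weight part of \<open>\<sigma>\<close> equals \<open>1\<close> and that separate the monomials.\<close>

definition pt :: "nat \<Rightarrow> complex^3" where
  "pt n = [vector [7/5, -1, 2], vector [3/5, 1, -2], vector [37/5, 2, 2], vector [1, 2, 0]] ! n"

lemma schur_at_pt:
  shows "schur 0 0 0 (pt 0) = 1"
  and "wps2 (schur_wp2 (pt 0)) = [1, 1, 10, 20, 3, 4, 1]"
  and "wps3 (schur_wp3 (pt 0)) = [6, -28, -90, -176, -10, -22, -36, -6, -8, -2]"
  and "schur 0 0 0 (pt 1) = 1"
  and "wps2 (schur_wp2 (pt 1)) = [1, 17, 14, 12, 3, 4, 1]"
  and "wps3 (schur_wp3 (pt 1)) = [-138, -116, -98, -80, -26, -26, -28, -6, -8, -2]"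
  and "schur 0 0 0 (pt 2) = 1"
  and "wps2 (schur_wp2 (pt 2)) = [1, -8, 4, 68, 0, -8, 1]"
  and "wps3 (schur_wp3 (pt 2)) = [-12, -64, 66, 1120, 8, -4, -132, 0, 16, -2]"
  and "schur 0 0 0 (pt 3) = 1"
  and "wps2 (schur_wp2 (pt 3)) = [1, 16, 4, 0, -4, 0, 1]"
  and "wps3 (schur_wp3 (pt 3)) = [128, 32, 2, 0, -32, -4, 0, 8, 0, -2]"
  by (simp_all add: pt_def schur_def schur_wp2_def schur_wp3_def schur1_def schur2_def schur3_def wps2_def wps3_def)

lemmas weight_part_simps =
  weight_part_def wts2_def wts3_def sum_less_numeral schur_at_pt[unfolded One_nat_def]

text \<open>In every weight the monomials outnumber the relations of that weight by at most four, so
  four points can determine the coefficients up to these relations. Each step solves for all but as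
  many coefficients as there are relations; matching the free ones gives the multipliers. In weights
  3, 4, 5 and 25 no relation exists and all coefficients vanish.\<close>

lemma weight_step_3:
  assumes v: "\<And>n. n < 4 \<Longrightarrow> weight_part 3 C (schur_wp2 (pt n)) (schur_wp3 (pt n)) = 0"
  shows "weight_reducible lam 3 C"
proof -
  have e0: "(6) * C 0 0 = 0"
    using v[of 0] by (simp add: weight_part_simps; algebra)
  have c: "C 0 0 = 0"
    using e0 by algebra+
  show ?thesis
    unfolding weight_reducible_def
    by (rule exI[of _ "\<lambda>n. 0"])
      (simp add: reduction_simps c[unfolded One_nat_def]; algebra)
qed

lemma weight_step_4:
  assumes v: "\<And>n. n < 4 \<Longrightarrow> weight_part 4 C (schur_wp2 (pt n)) (schur_wp3 (pt n)) = 0"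
  shows "weight_reducible lam 4 C"
proof -
  have e0: "- (28) * C 0 1 = 0"
    using v[of 0] by (simp add: weight_part_simps; algebra)
  have c: "C 0 1 = 0"
    using e0 by algebra+
  show ?thesis
    unfolding weight_reducible_def
    by (rule exI[of _ "\<lambda>n. 0"])
      (simp add: reduction_simps c[unfolded One_nat_def]; algebra)
qed

lemma weight_step_5:
  assumes v: "\<And>n. n < 4 \<Longrightarrow> weight_part 5 C (schur_wp2 (pt n)) (schur_wp3 (pt n)) = 0"
  shows "weight_reducible lam 5 C"
proof -
  have e0: "- (90) * C 0 2 + (6) * C 1 0 = 0"
    using v[of 0] by (simp add: weight_part_simps; algebra)
  have e1: "- (98) * C 0 2 - (2346) * C 1 0 = 0"
    using v[of 1] by (simp add: weight_part_simps; algebra)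
  have c: "C 0 2 = 0"
    "C 1 0 = 0"
    using e0 e1 by algebra+
  show ?thesis
    unfolding weight_reducible_def
    by (rule exI[of _ "\<lambda>n. 0"])
      (simp add: reduction_simps c[unfolded One_nat_def]; algebra)
qed

lemma weight_step_6:
  assumes v: "\<And>n. n < 4 \<Longrightarrow> weight_part 6 C (schur_wp2 (pt n)) (schur_wp3 (pt n)) = 0"
  shows "weight_reducible lam 6 C"
proof -
  have e0: "- (176) * C 0 3 - (28) * C 1 1 + (60) * C 2 0 = 0"
    using v[of 0] by (simp add: weight_part_simps; algebra)
  have e1: "- (80) * C 0 3 - (1972) * C 1 1 - (1932) * C 2 0 = 0"
    using v[of 1] by (simp add: weight_part_simps; algebra)
  have c: "C 1 1 = - (2) * C 0 3"
    "C 2 0 = (2) * C 0 3"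
    using e0 e1 by algebra+
  show ?thesis
    unfolding weight_reducible_def
    by (rule exI[of _ "\<lambda>n. if n = 0 then C 0 3 else 0"])
      (simp add: reduction_simps c[unfolded One_nat_def]; algebra)
qed

lemma weight_step_7:
  assumes v: "\<And>n. n < 4 \<Longrightarrow> weight_part 7 C (schur_wp2 (pt n)) (schur_wp3 (pt n)) = 0"
  shows "weight_reducible lam 7 C"
proof -
  have e0: "- (10) * C 0 4 - (90) * C 1 2 - (280) * C 2 1 + (120) * C 3 0 = 0"
    using v[of 0] by (simp add: weight_part_simps; algebra)
  have e1: "- (26) * C 0 4 - (1666) * C 1 2 - (1624) * C 2 1 - (1656) * C 3 0 = 0"
    using v[of 1] by (simp add: weight_part_simps; algebra)
  have e2: "(8) * C 0 4 - (528) * C 1 2 - (256) * C 2 1 - (816) * C 3 0 = 0"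
    using v[of 2] by (simp add: weight_part_simps; algebra)
  have c: "C 1 2 = - C 0 4"
    "C 2 1 = (1/2) * C 0 4"
    "C 3 0 = (1/2) * C 0 4"
    using e0 e1 e2 by algebra+
  show ?thesis
    unfolding weight_reducible_def
    by (rule exI[of _ "\<lambda>n. if n = 1 then (1/2) * C 0 4 else 0"])
      (simp add: reduction_simps c[unfolded One_nat_def]; algebra)
qed

lemma weight_step_8:
  assumes v: "\<And>n. n < 4 \<Longrightarrow> weight_part 8 C (schur_wp2 (pt n)) (schur_wp3 (pt n)) = 0"
  shows "weight_reducible lam 8 C"
proof -
  have e0: "- (22) * C 0 5 - (176) * C 1 3 - (900) * C 2 2 - (560) * C 3 1 = 0"
    using v[of 0] by (simp add: weight_part_simps; algebra)
  have e1: "- (26) * C 0 5 - (1360) * C 1 3 - (1372) * C 2 2 - (1392) * C 3 1 = 0"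
    using v[of 1] by (simp add: weight_part_simps; algebra)
  have e2: "- (4) * C 0 5 - (8960) * C 1 3 + (264) * C 2 2 - (4352) * C 3 1 = 0"
    using v[of 2] by (simp add: weight_part_simps; algebra)
  have c: "C 1 3 = (1/2) * C 0 5"
    "C 2 2 = (1/2) * C 0 5"
    "C 3 1 = - C 0 5"
    using e0 e1 e2 by algebra+
  show ?thesis
    unfolding weight_reducible_def
    by (rule exI[of _ "\<lambda>n. if n = 2 then - (1/4) * C 0 5 else 0"])
      (simp add: reduction_simps c[unfolded One_nat_def]; algebra)
qed

text \<open>Five monomials stand against one relation, so all four points are used.\<close>

lemma weight_step_9:
  assumes v: "\<And>n. n < 4 \<Longrightarrow> weight_part 9 C (schur_wp2 (pt n)) (schur_wp3 (pt n)) = 0"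
  shows "weight_reducible lam 9 C"
proof -
  have e0: "- (36) * C 0 6 - (10) * C 1 4 - (1760) * C 2 3 - (1800) * C 3 2 + (18) * C 4 0 = 0"
    using v[of 0] by (simp add: weight_part_simps; algebra)
  have e1: "- (28) * C 0 6 - (442) * C 1 4 - (1120) * C 2 3 - (1176) * C 3 2 - (414) * C 4 0 = 0"
    using v[of 1] by (simp add: weight_part_simps; algebra)
  have e2: "- (132) * C 0 6 - (64) * C 1 4 + (4480) * C 2 3 + (4488) * C 3 2 = 0"
    using v[of 2] by (simp add: weight_part_simps; algebra)
  have e3: "- (512) * C 1 4 - (512) * C 4 0 = 0"
    using v[of 3] by (simp add: weight_part_simps; algebra)
  have c: "C 1 4 = - (2) * C 0 6"
    "C 2 3 = - (1/2) * C 0 6"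
    "C 3 2 = (1/2) * C 0 6"
    "C 4 0 = (2) * C 0 6"
    using e0 e1 e2 e3 by algebra+
  show ?thesis
    unfolding weight_reducible_def
    by (rule exI[of _ "\<lambda>n. if n = 3 then (1/4) * C 0 6 else 0"])
      (simp add: reduction_simps c[unfolded One_nat_def]; algebra)
qed

lemma weight_step_10:
  assumes v: "\<And>n. n < 4 \<Longrightarrow> weight_part 10 C (schur_wp2 (pt n)) (schur_wp3 (pt n)) = 0"
  shows "weight_reducible lam 10 C"
proof -
  have e0: "- (22) * C 1 5 - (100) * C 2 4 - (3520) * C 3 3 - (84) * C 4 1 + (24) * C 5 0 = 0"
    using v[of 0] by (simp add: weight_part_simps; algebra)
  have e1: "- (442) * C 1 5 - (364) * C 2 4 - (960) * C 3 3 - (348) * C 4 1 - (552) * C 5 0 = 0"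
    using v[of 1] by (simp add: weight_part_simps; algebra)
  have e2: "(32) * C 1 5 + (32) * C 2 4 + (76160) * C 3 3 + (96) * C 5 0 = 0"
    using v[of 2] by (simp add: weight_part_simps; algebra)
  have e3: "- (64) * C 1 5 - (128) * C 2 4 - (128) * C 4 1 = 0"
    using v[of 3] by (simp add: weight_part_simps; algebra)
  have c: "C 2 4 = (1/2) * C 1 5"
    "C 3 3 = 0"
    "C 4 1 = - C 1 5"
    "C 5 0 = - (1/2) * C 1 5"
    using e0 e1 e2 e3 by algebra+
  show ?thesis
    unfolding weight_reducible_def
    by (rule exI[of _ "\<lambda>n. if n = 4 then (1/2) * C 1 5 else 0"])
      (simp add: reduction_simps c[unfolded One_nat_def]; algebra)
qed

lemma weight_step_11:
  assumes v: "\<And>n. n < 4 \<Longrightarrow> weight_part 11 C (schur_wp2 (pt n)) (schur_wp3 (pt n)) = 0"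
  shows "weight_reducible lam 11 C"
proof -
  have e0: "- (6) * C 0 7 - (36) * C 1 6 - (220) * C 2 5 - (200) * C 3 4 - (270) * C 4 2 - (112) * C 5 1 = 0"
    using v[of 0] by (simp add: weight_part_simps; algebra)
  have e1: "- (6) * C 0 7 - (476) * C 1 6 - (364) * C 2 5 - (312) * C 3 4 - (294) * C 4 2 - (464) * C 5 1 = 0"
    using v[of 1] by (simp add: weight_part_simps; algebra)
  have e2: "(1056) * C 1 6 - (16) * C 2 5 + (544) * C 3 4 + (512) * C 5 1 = 0"
    using v[of 2] by (simp add: weight_part_simps; algebra)
  have e3: "(8) * C 0 7 - (16) * C 2 5 - (8) * C 4 2 = 0"
    using v[of 3] by (simp add: weight_part_simps; algebra)
  have c: "C 2 5 = C 0 7 - C 1 6"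
    "C 3 4 = (1/2) * C 0 7 - (3/2) * C 1 6"
    "C 4 2 = - C 0 7 + (2) * C 1 6"
    "C 5 1 = - (1/2) * C 0 7 - (1/2) * C 1 6"
    using e0 e1 e2 e3 by algebra+
  show ?thesis
    unfolding weight_reducible_def
    \<comment> \<open>Two relations have weight 11. With multipliers a and b, the monomials (0, 7)
      and (1, 6) require 4 a + b = \<open>C 0 7\<close> and 2 a - b = \<open>C 1 6\<close>.\<close>
    by (rule exI[of _ "\<lambda>n. if n = 5 then (1/6) * C 0 7 + (1/6) * C 1 6 else if n = 6 then (1/3) * C 0 7 - (2/3) * C 1 6 else 0"])
      (simp add: reduction_simps c[unfolded One_nat_def]; algebra)
qed

lemma weight_step_12:
  assumes v: "\<And>n. n < 4 \<Longrightarrow> weight_part 12 C (schur_wp2 (pt n)) (schur_wp3 (pt n)) = 0"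
  shows "weight_reducible lam 12 C"
proof -
  have e0: "- (8) * C 0 8 - (360) * C 2 6 - (440) * C 3 5 - (528) * C 4 3 - (360) * C 5 2 = 0"
    using v[of 0] by (simp add: weight_part_simps; algebra)
  have e1: "- (8) * C 0 8 - (392) * C 2 6 - (312) * C 3 5 - (240) * C 4 3 - (392) * C 5 2 = 0"
    using v[of 1] by (simp add: weight_part_simps; algebra)
  have e2: "(16) * C 0 8 - (528) * C 2 6 - (272) * C 3 5 - (528) * C 5 2 = 0"
    using v[of 2] by (simp add: weight_part_simps; algebra)
  have c: "C 3 5 = (2) * C 0 8"
    "C 4 3 = - C 0 8"
    "C 5 2 = - C 0 8 - C 2 6"
    using e0 e1 e2 by algebra+
  show ?thesis
    unfolding weight_reducible_def
    by (rule exI[of _ "\<lambda>n. if n = 7 then - C 0 8 - C 2 6 else if n = 8 then - C 0 8 else 0"])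
      (simp add: reduction_simps c[unfolded One_nat_def]; algebra)
qed

lemma weight_step_13:
  assumes v: "\<And>n. n < 4 \<Longrightarrow> weight_part 13 C (schur_wp2 (pt n)) (schur_wp3 (pt n)) = 0"
  shows "weight_reducible lam 13 C"
proof -
  have e0: "- (6) * C 1 7 - (720) * C 3 6 - (30) * C 4 4 - (704) * C 5 3 + (6) * C 6 0 = 0"
    using v[of 0] by (simp add: weight_part_simps; algebra)
  have e1: "- (102) * C 1 7 - (336) * C 3 6 - (78) * C 4 4 - (320) * C 5 3 - (138) * C 6 0 = 0"
    using v[of 1] by (simp add: weight_part_simps; algebra)
  have e2: "- (8976) * C 3 6 - (8960) * C 5 3 - (12) * C 6 0 = 0"
    using v[of 2] by (simp add: weight_part_simps; algebra)
  have e3: "(128) * C 1 7 + (128) * C 4 4 + (128) * C 6 0 = 0"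
    using v[of 3] by (simp add: weight_part_simps; algebra)
  have c: "C 3 6 = (3/8) * C 1 7"
    "C 4 4 = - (1/2) * C 1 7"
    "C 5 3 = - (3/8) * C 1 7"
    "C 6 0 = - (1/2) * C 1 7"
    using e0 e1 e2 e3 by algebra+
  show ?thesis
    unfolding weight_reducible_def
    by (rule exI[of _ "\<lambda>n. if n = 9 then - (1/8) * C 1 7 else 0"])
      (simp add: reduction_simps c[unfolded One_nat_def]; algebra)
qed

lemma weight_step_14:
  assumes v: "\<And>n. n < 4 \<Longrightarrow> weight_part 14 C (schur_wp2 (pt n)) (schur_wp3 (pt n)) = 0"
  shows "weight_reducible lam 14 C"
proof -
  have e0: "- (8) * C 1 8 - (60) * C 2 7 - (66) * C 4 5 - (40) * C 5 4 - (28) * C 6 1 = 0"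
    using v[of 0] by (simp add: weight_part_simps; algebra)
  have e1: "- (136) * C 1 8 - (84) * C 2 7 - (78) * C 4 5 - (104) * C 5 4 - (116) * C 6 1 = 0"
    using v[of 1] by (simp add: weight_part_simps; algebra)
  have e2: "- (128) * C 1 8 - (64) * C 5 4 - (64) * C 6 1 = 0"
    using v[of 2] by (simp add: weight_part_simps; algebra)
  have c: "C 4 5 = C 1 8 - C 2 7"
    "C 5 4 = - (3/2) * C 1 8 + (1/2) * C 2 7"
    "C 6 1 = - (1/2) * C 1 8 - (1/2) * C 2 7"
    using e0 e1 e2 by algebra+
  show ?thesis
    unfolding weight_reducible_def
    by (rule exI[of _ "\<lambda>n. if n = 10 then (1/3) * C 1 8 - (1/6) * C 2 7 else if n = 11 then (1/6) * C 1 8 + (1/6) * C 2 7 else 0"])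
      (simp add: reduction_simps c[unfolded One_nat_def]; algebra)
qed

lemma weight_step_15:
  assumes v: "\<And>n. n < 4 \<Longrightarrow> weight_part 15 C (schur_wp2 (pt n)) (schur_wp3 (pt n)) = 0"
  shows "weight_reducible lam 15 C"
proof -
  have e0: "- (2) * C 0 9 - (80) * C 2 8 - (120) * C 3 7 - (108) * C 4 6 - (88) * C 5 5 - (90) * C 6 2 = 0"
    using v[of 0] by (simp add: weight_part_simps; algebra)
  have e1: "- (2) * C 0 9 - (112) * C 2 8 - (72) * C 3 7 - (84) * C 4 6 - (104) * C 5 5 - (98) * C 6 2 = 0"
    using v[of 1] by (simp add: weight_part_simps; algebra)
  have e2: "- (2) * C 0 9 + (64) * C 2 8 + (32) * C 5 5 + (66) * C 6 2 = 0"
    using v[of 2] by (simp add: weight_part_simps; algebra)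
  have e3: "- (2) * C 0 9 + (2) * C 6 2 = 0"
    using v[of 3] by (simp add: weight_part_simps; algebra)
  have c: "C 3 7 = - (2) * C 0 9 - C 2 8"
    "C 4 6 = (3) * C 0 9 + (2) * C 2 8"
    "C 5 5 = - (2) * C 0 9 - (2) * C 2 8"
    "C 6 2 = C 0 9"
    using e0 e1 e2 e3 by algebra+
  show ?thesis
    unfolding weight_reducible_def
    \<comment> \<open>Of the two relations of weight 15 only the first contains the monomial (0, 9),
      with coefficient -1; the monomial (2, 8), with coefficients 4/3 and 1/3, then fixes the second
      multiplier.\<close>
    by (rule exI[of _ "\<lambda>n. if n = 12 then - C 0 9 else if n = 13 then (4) * C 0 9 + (3) * C 2 8 else 0"])
      (simp add: reduction_simps c[unfolded One_nat_def]; intro conjI; simp add: field_simps)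
qed

lemma weight_step_16:
  assumes v: "\<And>n. n < 4 \<Longrightarrow> weight_part 16 C (schur_wp2 (pt n)) (schur_wp3 (pt n)) = 0"
  shows "weight_reducible lam 16 C"
proof -
  have e0: "- (160) * C 3 8 - (144) * C 5 6 - (176) * C 6 3 = 0"
    using v[of 0] by (simp add: weight_part_simps; algebra)
  have e1: "- (96) * C 3 8 - (112) * C 5 6 - (80) * C 6 3 = 0"
    using v[of 1] by (simp add: weight_part_simps; algebra)
  have c: "C 5 6 = - (1/2) * C 3 8"
    "C 6 3 = - (1/2) * C 3 8"
    using e0 e1 by algebra+
  show ?thesis
    unfolding weight_reducible_def
    by (rule exI[of _ "\<lambda>n. if n = 14 then (1/2) * C 3 8 else 0"])
      (simp add: all_less_numeral wts2_def wts3_def rel_weights_def del: One_nat_def; (intro conjI)?; simp add: c sum_less_numeral; simp add: rel_coeff_def rel_table_def; (simp add: field_simps; fail)?)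
qed

lemma weight_step_17:
  assumes v: "\<And>n. n < 4 \<Longrightarrow> weight_part 17 C (schur_wp2 (pt n)) (schur_wp3 (pt n)) = 0"
  shows "weight_reducible lam 17 C"
proof -
  have e0: "- (2) * C 1 9 - (18) * C 4 7 - (10) * C 6 4 = 0"
    using v[of 0] by (simp add: weight_part_simps; algebra)
  have e1: "- (34) * C 1 9 - (18) * C 4 7 - (26) * C 6 4 = 0"
    using v[of 1] by (simp add: weight_part_simps; algebra)
  have c: "C 4 7 = C 1 9"
    "C 6 4 = - (2) * C 1 9"
    using e0 e1 by algebra+
  show ?thesis
    unfolding weight_reducible_def
    by (rule exI[of _ "\<lambda>n. if n = 15 then (3/2) * C 1 9 else 0"])
      (simp add: all_less_numeral wts2_def wts3_def rel_weights_def del: One_nat_def; (intro conjI)?; simp add: c sum_less_numeral; simp add: rel_coeff_def rel_table_def; (simp add: field_simps; fail)?)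
qed

lemma weight_step_18:
  assumes v: "\<And>n. n < 4 \<Longrightarrow> weight_part 18 C (schur_wp2 (pt n)) (schur_wp3 (pt n)) = 0"
  shows "weight_reducible lam 18 C"
proof -
  have e0: "- (20) * C 2 9 - (24) * C 4 8 - (24) * C 5 7 - (22) * C 6 5 = 0"
    using v[of 0] by (simp add: weight_part_simps; algebra)
  have e1: "- (28) * C 2 9 - (24) * C 4 8 - (24) * C 5 7 - (26) * C 6 5 = 0"
    using v[of 1] by (simp add: weight_part_simps; algebra)
  have c: "C 5 7 = C 2 9 - C 4 8"
    "C 6 5 = - (2) * C 2 9"
    using e0 e1 by algebra+
  show ?thesis
    unfolding weight_reducible_def
    by (rule exI[of _ "\<lambda>n. if n = 16 then (4/3) * C 2 9 + (1/3) * C 4 8 else if n = 17 then - (1/3) * C 2 9 + (2/3) * C 4 8 else 0"])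
      (simp add: reduction_simps c[unfolded One_nat_def]; intro conjI; simp add: field_simps)
qed

lemma weight_step_19:
  assumes v: "\<And>n. n < 4 \<Longrightarrow> weight_part 19 C (schur_wp2 (pt n)) (schur_wp3 (pt n)) = 0"
  shows "weight_reducible lam 19 C"
proof -
  have e0: "- (40) * C 3 9 - (32) * C 5 8 - (36) * C 6 6 = 0"
    using v[of 0] by (simp add: weight_part_simps; algebra)
  have e1: "- (24) * C 3 9 - (32) * C 5 8 - (28) * C 6 6 = 0"
    using v[of 1] by (simp add: weight_part_simps; algebra)
  have c: "C 5 8 = C 3 9"
    "C 6 6 = - (2) * C 3 9"
    using e0 e1 by algebra+
  show ?thesis
    unfolding weight_reducible_def
    by (rule exI[of _ "\<lambda>n. if n = 18 then (3/2) * C 3 9 else 0"])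
      (simp add: all_less_numeral wts2_def wts3_def rel_weights_def del: One_nat_def; (intro conjI)?; simp add: c sum_less_numeral; simp add: rel_coeff_def rel_table_def; (simp add: field_simps; fail)?)
qed

lemma weight_step_21:
  assumes v: "\<And>n. n < 4 \<Longrightarrow> weight_part 21 C (schur_wp2 (pt n)) (schur_wp3 (pt n)) = 0"
  shows "weight_reducible lam 21 C"
proof -
  have "weight_part 21 C (schur_wp2 (pt 0)) (schur_wp3 (pt 0)) = - 6 * (C 4 9 + C 6 7)"
    by (simp add: weight_part_def wts2_def wts3_def sum_less_numeral schur_at_pt)
  then have "- 6 * (C 4 9 + C 6 7) = 0" using v[of 0] by (metis zero_less_numeral)
  then have c: "C 6 7 = - C 4 9" by algebra
  show ?thesis
    unfolding weight_reducible_def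
    by (rule exI[of _ "\<lambda>n. if n = 19 then C 4 9 else 0"])
      (simp add: all_less_numeral wts2_def wts3_def rel_weights_def del: One_nat_def; (intro conjI)?; simp add: c sum_less_numeral; simp add: rel_coeff_def rel_table_def; (simp add: field_simps; fail)?)
qed

lemma weight_step_22:
  assumes v: "\<And>n. n < 4 \<Longrightarrow> weight_part 22 C (schur_wp2 (pt n)) (schur_wp3 (pt n)) = 0"
  shows "weight_reducible lam 22 C"
proof -
  have "weight_part 22 C (schur_wp2 (pt 0)) (schur_wp3 (pt 0)) = - 8 * (C 5 9 + C 6 8)"
    by (simp add: weight_part_def wts2_def wts3_def sum_less_numeral schur_at_pt)
  then have "- 8 * (C 5 9 + C 6 8) = 0" using v[of 0] by (metis zero_less_numeral)
  then have c: "C 6 8 = - C 5 9" by algebra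
  show ?thesis
    unfolding weight_reducible_def
    by (rule exI[of _ "\<lambda>n. if n = 20 then C 5 9 else 0"])
      (simp add: all_less_numeral wts2_def wts3_def rel_weights_def del: One_nat_def; (intro conjI)?; simp add: c sum_less_numeral; simp add: rel_coeff_def rel_table_def; (simp add: field_simps; fail)?)
qed

lemma weight_step_25:
  assumes v: "\<And>n. n < 4 \<Longrightarrow> weight_part 25 C (schur_wp2 (pt n)) (schur_wp3 (pt n)) = 0"
  shows "weight_reducible lam 25 C"
proof -
  have e0: "- (2) * C 6 9 = 0"
    using v[of 0] by (simp add: weight_part_simps; algebra)
  have c: "C 6 9 = 0"
    using e0 by algebra+
  show ?thesis
    unfolding weight_reducible_def
    by (rule exI[of _ "\<lambda>n. 0"])
      (simp add: reduction_simps c[unfolded One_nat_def]; algebra)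
qed

lemma weight_reducible_empty:
  assumes "\<forall>i<7. \<forall>j<10. wts2 ! i + wts3 ! j \<noteq> N"
  shows "weight_reducible lam N C"
  unfolding weight_reducible_def
proof (rule exI[of _ "\<lambda>_. 0"], intro conjI allI impI)
  fix i j :: nat assume "i < 7" "j < 10" "wts2 ! i + wts3 ! j = N"
  with assms show "C i j = (\<Sum>n<21. 0 * rel_coeff lam n i j)" by metis
qed (rule notE, assumption, rule refl)

lemma weight_reducible_le_25:
  assumes "N \<le> 25"
    and "\<And>n. n < 4 \<Longrightarrow> weight_part N C (schur_wp2 (pt n)) (schur_wp3 (pt n)) = 0"
  shows "weight_reducible lam N C"
proof -
  have "N = 0 \<or> N = 1 \<or> N = 2 \<or> N = 3 \<or> N = 4 \<or> N = 5 \<or> N = 6 \<or> N = 7 \<or> N = 8 \<or> N = 9 \<or> N = 10 \<or>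
      N = 11 \<or> N = 12 \<or> N = 13 \<or> N = 14 \<or> N = 15 \<or> N = 16 \<or> N = 17 \<or> N = 18 \<or> N = 19 \<or> N = 20 \<or>
      N = 21 \<or> N = 22 \<or> N = 23 \<or> N = 24 \<or> N = 25"
    using assms(1) by presburger
  \<comment> \<open>These are the numbers up to 25 that are not the weight of any of the 70
    monomials.\<close>
  moreover have "weight_reducible lam N C" if "N \<in> {0, 1, 2, 20, 23, 24}"
  proof (rule weight_reducible_empty)
    show "\<forall>i<7. \<forall>j<10. wts2 ! i + wts3 ! j \<noteq> N"
      using that by (elim insertE emptyE; simp add: all_less_numeral wts2_def wts3_def)
  qed
  ultimately show ?thesis
    using assms(2) weight_step_3 weight_step_4 weight_step_5 weight_step_6 weight_step_7 weight_step_8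
      weight_step_9 weight_step_10 weight_step_11 weight_step_12 weight_step_13 weight_step_14
      weight_step_15 weight_step_16 weight_step_17 weight_step_18 weight_step_19 weight_step_21
      weight_step_22 weight_step_25
    by (elim disjE; hypsubst; simp)
qed

lemma schur_pt_nonzero: "n < 4 \<Longrightarrow> schur 0 0 0 (pt n) \<noteq> 0"
proof -
  have "\<forall>n<4. schur 0 0 0 (pt n) \<noteq> 0" by (simp add: all_less_numeral schur_at_pt[unfolded One_nat_def])
  then show "n < 4 \<Longrightarrow> schur 0 0 0 (pt n) \<noteq> 0" by blast
qed

context leading
begin

section \<open>Descent in the weight\<close>

lemma wps2_limit:
  assumes "schur 0 0 0 u \<noteq> 0" "i < 7"
  shows "((\<lambda>\<epsilon>. \<epsilon> ^ (wts2 ! i) * wps2 (wp2 \<sigma> (dilate u \<epsilon>)) ! i) \<longlongrightarrow> wps2 (schur_wp2 u) ! i) (at 0)"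
proof -
  have l: "((\<lambda>\<epsilon>. \<epsilon> ^ w * wp2 \<sigma> (dilate u \<epsilon>) i j) \<longlongrightarrow> schur_wp2 u i j) (at 0)" if "w = wt3 i + wt3 j" for w i j
    using wp2_limit[OF assms(1), of i j] that by simp
  have "\<forall>i<7. ((\<lambda>\<epsilon>. \<epsilon> ^ (wts2 ! i) * wps2 (wp2 \<sigma> (dilate u \<epsilon>)) ! i) \<longlongrightarrow> wps2 (schur_wp2 u) ! i) (at 0)"
    using l[of 2 3 3] l[of 3 2 3] l[of 4 2 2] l[of 6 1 3] l[of 7 1 2] l[of 10 1 1]
    by (simp add: all_less_numeral wts2_def wps2_def wt3_def del: One_nat_def)
  then show ?thesis using assms(2) by blast
qed

lemma wps3_limit:
  assumes "schur 0 0 0 u \<noteq> 0" "i < 10"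
  shows "((\<lambda>\<epsilon>. \<epsilon> ^ (wts3 ! i) * wps3 (wp3 \<sigma> (dilate u \<epsilon>)) ! i) \<longlongrightarrow> wps3 (schur_wp3 u) ! i) (at 0)"
proof -
  have l: "((\<lambda>\<epsilon>. \<epsilon> ^ w * wp3 \<sigma> (dilate u \<epsilon>) i j k) \<longlongrightarrow> schur_wp3 u i j k) (at 0)"
    if "w = wt3 i + (wt3 j + wt3 k)" for w i j k
    using wp3_limit[OF assms(1), of i j k] that by simp
  have "\<forall>i<10. ((\<lambda>\<epsilon>. \<epsilon> ^ (wts3 ! i) * wps3 (wp3 \<sigma> (dilate u \<epsilon>)) ! i) \<longlongrightarrow> wps3 (schur_wp3 u) ! i) (at 0)"
    using l[of 3 3 3 3] l[of 4 2 3 3] l[of 5 2 2 3] l[of 6 2 2 2] l[of 7 1 3 3] l[of 8 1 2 3] l[of 9 1 2 2]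
      l[of 11 1 1 3] l[of 12 1 1 2] l[of 15 1 1 1]
    by (simp add: all_less_numeral wts3_def wps3_def wt3_def del: One_nat_def)
  then show ?thesis using assms(2) by blast
qed

text \<open>At a dilated point, multiplied by \<open>\<epsilon>^N\<close>, monomials of weight below
  \<open>N\<close> keep a positive power of \<open>\<epsilon>\<close> and die out, while those of
  weight \<open>N\<close> converge. The whole expression is zero there, hence so is the
  limit.\<close>

lemma weight_part_vanishes:
  assumes C: "weight_le N C" and S: "schur 0 0 0 u \<noteq> 0"
    and zero: "\<And>v. v \<in> Om \<Longrightarrow> bilinear_form C (wp2 \<sigma> v) (wp3 \<sigma> v) = 0"
  shows "weight_part N C (schur_wp2 u) (schur_wp3 u) = 0"
proof -
  have lim: "((\<lambda>\<epsilon>. \<epsilon> ^ N * (C i j * (wps2 (wp2 \<sigma> (dilate u \<epsilon>)) ! i * wps3 (wp3 \<sigma> (dilate u \<epsilon>)) ! j)))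
      \<longlongrightarrow> (if wts2 ! i + wts3 ! j = N then C i j * (wps2 (schur_wp2 u) ! i * wps3 (schur_wp3 u) ! j) else 0))
      (at 0)" if ij: "i < 7" "j < 10" for i j
  proof (cases "C i j = 0")
    case False
    define k where "k = N - (wts2 ! i + wts3 ! j)"
    have "wts2 ! i + wts3 ! j \<le> N" using C ij False unfolding weight_le_def by (meson not_le)
    then have N: "N = k + (wts2 ! i + wts3 ! j)" by (simp add: k_def)
    have "((\<lambda>\<epsilon>. \<epsilon> ^ k * (C i j * ((\<epsilon> ^ (wts2 ! i) * wps2 (wp2 \<sigma> (dilate u \<epsilon>)) ! i) *
        (\<epsilon> ^ (wts3 ! j) * wps3 (wp3 \<sigma> (dilate u \<epsilon>)) ! j))))
        \<longlongrightarrow> 0 ^ k * (C i j * (wps2 (schur_wp2 u) ! i * wps3 (schur_wp3 u) ! j))) (at 0)"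
      by (intro tendsto_intros wps2_limit[OF S ij(1)] wps3_limit[OF S ij(2)])
    then show ?thesis
      by (cases "k = 0") (simp_all add: N power_add mult_ac power_0_left)
  qed simp
  have "((\<lambda>\<epsilon>. \<epsilon> ^ N * bilinear_form C (wp2 \<sigma> (dilate u \<epsilon>)) (wp3 \<sigma> (dilate u \<epsilon>)))
      \<longlongrightarrow> weight_part N C (schur_wp2 u) (schur_wp3 u)) (at 0)"
    unfolding bilinear_form_def weight_part_def sum_distrib_left
    by (intro tendsto_sum lim) simp_all
  moreover have "((\<lambda>\<epsilon>. \<epsilon> ^ N * bilinear_form C (wp2 \<sigma> (dilate u \<epsilon>)) (wp3 \<sigma> (dilate u \<epsilon>))) \<longlongrightarrow> 0) (at 0)"
    by (rule tendsto_eventually) (use dilate_in_Om[OF S] zero in \<open>auto elim!: eventually_mono\<close>)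
  ultimately show ?thesis by (rule tendsto_unique[rotated]) simp
qed

text \<open>Induction on a strict bound for the weights occurring in \<open>C\<close>. The layer of
  top weight is a combination of top-weight parts of relations; subtracting those relations lowers
  the bound and preserves vanishing on \<open>Om\<close>.\<close>

lemma bilinear_form_in_span:
  assumes relations: "\<And>n v. n < 21 \<Longrightarrow> v \<in> Om \<Longrightarrow> relations34 lam (wp2 \<sigma> v) (wp3 \<sigma> v) ! n = 0"
  shows "N \<le> 26 \<Longrightarrow> \<forall>i<7. \<forall>j<10. N \<le> wts2 ! i + wts3 ! j \<longrightarrow> C i j = 0 \<Longrightarrow>
    \<forall>v\<in>Om. bilinear_form C (wp2 \<sigma> v) (wp3 \<sigma> v) = 0 \<Longrightarrow>
    \<exists>a. \<forall>p q. bilinear_form C p q = (\<Sum>n<21. a n * relations34 lam p q ! n)"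
proof (induction N arbitrary: C)
  case 0
  then have "bilinear_form C p q = 0" for p q
    by (auto simp: bilinear_form_def)
  then show ?case by (intro exI[of _ "\<lambda>_. 0"]) simp
next
  case (Suc N)
  have "weight_le N C" using Suc.prems(2) by (simp add: weight_le_def Suc_le_eq)
  then have "weight_part N C (schur_wp2 (pt n)) (schur_wp3 (pt n)) = 0" if "n < 4" for n
    using weight_part_vanishes schur_pt_nonzero[OF that] Suc.prems(3) by blast
  then have "weight_reducible lam N C" using weight_reducible_le_25 Suc.prems(1) by simp
  then obtain a where a: "\<forall>n<21. a n \<noteq> 0 \<longrightarrow> rel_weights ! n = N"
    "\<forall>i<7. \<forall>j<10. wts2 ! i + wts3 ! j = N \<longrightarrow> C i j = (\<Sum>n<21. a n * rel_coeff lam n i j)"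
    unfolding weight_reducible_def by blast
  define D where "D = (\<lambda>i j. C i j + (\<Sum>n<21. - a n * rel_coeff lam n i j))"
  have D: "bilinear_form D p q = bilinear_form C p q - (\<Sum>n<21. a n * relations34 lam p q ! n)" for p q
    unfolding D_def bilinear_form_linear by (simp add: relations34_form sum_negf)
  have "\<forall>i<7. \<forall>j<10. N \<le> wts2 ! i + wts3 ! j \<longrightarrow> D i j = 0"
  proof (intro allI impI)
    fix i j :: nat assume ij: "i < 7" "j < 10" "N \<le> wts2 ! i + wts3 ! j"
    show "D i j = 0"
    proof (cases "wts2 ! i + wts3 ! j = N")
      case True
      then show ?thesis using a(2) ij by (simp add: D_def sum_negf)
    next
      case False
      then have w: "N < wts2 ! i + wts3 ! j" using ij by simp
      \<comment> \<open>Only relations whose top weight is exactly \<open>N\<close> have been used,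
        so the subtraction creates nothing above \<open>N\<close>.\<close>
      have "a n * rel_coeff lam n i j = 0" if "n < 21" for n
        using a(1) rel_coeff_weight[OF that] w ij that unfolding weight_le_def by (metis mult_eq_0_iff)
      then have "(\<Sum>n<21. - a n * rel_coeff lam n i j) = 0" by (intro sum.neutral) auto
      moreover have "C i j = 0" using Suc.prems(2) w ij by simp
      ultimately show ?thesis by (simp add: D_def)
    qed
  qed
  moreover have "\<forall>v\<in>Om. bilinear_form D (wp2 \<sigma> v) (wp3 \<sigma> v) = 0"
    using Suc.prems(3) relations by (simp add: D)
  ultimately obtain b where "\<And>p q. bilinear_form D p q = (\<Sum>n<21. b n * relations34 lam p q ! n)"
    using Suc.IH[of D] Suc.prems(1) by auto
  then have "bilinear_form C p q = (\<Sum>n<21. (b n + a n) * relations34 lam p q ! n)" for p q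
    using D[of p q] by (simp add: distrib_right sum.distrib)
  then show ?case by (intro exI[of _ "\<lambda>n. b n + a n"]) blast
qed

lemma symmetric_wp:
  assumes "u \<in> Om"
  shows "symmetric2 (wp2 \<sigma> u)" "symmetric3 (wp3 \<sigma> u)"
  unfolding symmetric2_def symmetric3_def wp2_eq[OF assms] wp3_eq[OF assms]
  by (simp_all only: ac_simps simp_thms)

text \<open>Along the dilations of \<open>pt 0\<close> the function \<open>p333\<close> grows like
  \<open>6 / \<epsilon>^3\<close>, so it cannot vanish near the origin on that curve.\<close>

lemma exists_wp333_nonzero: "\<exists>v\<in>Om. wp 0 0 3 v \<noteq> 0"
proof -
  have S: "schur 0 0 0 (pt 0) \<noteq> 0" by (simp add: schur_at_pt)
  have "schur_wp3 (pt 0) 3 3 3 = 6"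
    using schur_at_pt(3) by (simp add: wps3_def)
  then have "((\<lambda>\<epsilon>. \<epsilon> ^ (wt3 3 + (wt3 3 + wt3 3)) * wp3 \<sigma> (dilate (pt 0) \<epsilon>) 3 3 3) \<longlongrightarrow> 6) (at 0)"
    using wp3_limit[OF S, of 3 3 3] by simp
  then have "\<forall>\<^sub>F \<epsilon> in at 0. \<epsilon> ^ (wt3 3 + (wt3 3 + wt3 3)) * wp3 \<sigma> (dilate (pt 0) \<epsilon>) 3 3 3 \<noteq> 0"
    by (rule tendsto_imp_eventually_ne) simp
  then have "\<forall>\<^sub>F \<epsilon> in at 0. dilate (pt 0) \<epsilon> \<in> Om \<and> wp3 \<sigma> (dilate (pt 0) \<epsilon>) 3 3 3 \<noteq> 0"
    using dilate_in_Om[OF S] by eventually_elim auto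
  then obtain v where "v \<in> Om" "wp3 \<sigma> v 3 3 3 \<noteq> 0"
    using eventually_happens'[OF at_neq_bot] by blast
  then show ?thesis using wp3_eq[of v 3 3 3] by (auto simp: numeral_3_eq_3)
qed

end

context klein_curve
begin

text \<open>The lemmas \<open>rel1\<close> to \<open>rel21\<close> have denominators cleared and
  common factors removed, so each entry of the list is a constant multiple of one of them.\<close>

lemma relations34_vanish:
  assumes u: "u \<in> Om" and n: "n < 21"
  shows "relations34 lam (wp2 \<sigma> u) (wp3 \<sigma> u) ! n = 0"
proof -
  have p: "wp2 \<sigma> u 1 1 = p11 u" "wp2 \<sigma> u 1 2 = p12 u" "wp2 \<sigma> u 1 3 = p13 u" "wp2 \<sigma> u 2 2 = p22 u"
    "wp2 \<sigma> u 2 3 = p23 u" "wp2 \<sigma> u 3 3 = p33 u" "wp3 \<sigma> u 1 1 1 = p111 u" "wp3 \<sigma> u 1 1 2 = p112 u"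
    "wp3 \<sigma> u 1 1 3 = p113 u" "wp3 \<sigma> u 1 2 2 = p122 u" "wp3 \<sigma> u 1 2 3 = p123 u" "wp3 \<sigma> u 1 3 3 = p133 u"
    "wp3 \<sigma> u 2 2 2 = p222 u" "wp3 \<sigma> u 2 2 3 = p223 u" "wp3 \<sigma> u 2 3 3 = p233 u" "wp3 \<sigma> u 3 3 3 = p333 u"
    by (simp_all add: wp2_eq[OF u] wp3_eq[OF u] numeral_2_eq_2 numeral_3_eq_3)
  have "list_all (\<lambda>x. x = 0) (relations34 lam (wp2 \<sigma> u) (wp3 \<sigma> u))"
    unfolding relations34_def p list.pred_inject
    apply (intro conjI TrueI)
    subgoal using rel1[OF u] by (assumption | (simp add: field_simps power2_eq_square del: One_nat_def; fail) | algebra)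
    subgoal using rel2[OF u] by (assumption | (simp add: field_simps power2_eq_square del: One_nat_def; fail) | algebra)
    subgoal using rel3[OF u] by (assumption | (simp add: field_simps power2_eq_square del: One_nat_def; fail) | algebra)
    subgoal using rel4[OF u] by (assumption | (simp add: field_simps power2_eq_square del: One_nat_def; fail) | algebra)
    subgoal using rel5[OF u] by (assumption | (simp add: field_simps power2_eq_square del: One_nat_def; fail) | algebra)
    subgoal using rel6[OF u] by (assumption | (simp add: field_simps power2_eq_square del: One_nat_def; fail) | algebra)
    subgoal using rel7[OF u] by (assumption | (simp add: field_simps power2_eq_square del: One_nat_def; fail) | algebra)
    subgoal using rel8[OF u] by (assumption | (simp add: field_simps power2_eq_square del: One_nat_def; fail) | algebra)
    subgoal using rel9[OF u] by (assumption | (simp add: field_simps power2_eq_square del: One_nat_def; fail) | algebra)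
    subgoal using rel10[OF u] by (assumption | (simp add: field_simps power2_eq_square del: One_nat_def; fail) | algebra)
    subgoal using rel11[OF u] by (assumption | (simp add: field_simps power2_eq_square del: One_nat_def; fail) | algebra)
    subgoal using rel12[OF u] by (assumption | (simp add: field_simps power2_eq_square del: One_nat_def; fail) | algebra)
    subgoal using rel13[OF u] by (assumption | (simp add: field_simps power2_eq_square del: One_nat_def; fail) | algebra)
    subgoal using rel14[OF u] by (assumption | (simp add: field_simps power2_eq_square del: One_nat_def; fail) | algebra)
    subgoal using rel15[OF u] by (assumption | (simp add: field_simps power2_eq_square del: One_nat_def; fail) | algebra)
    subgoal using rel16[OF u] by (assumption | (simp add: field_simps power2_eq_square del: One_nat_def; fail) | algebra)
    subgoal using rel17[OF u] by (assumption | (simp add: field_simps power2_eq_square del: One_nat_def; fail) | algebra)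
    subgoal using rel18[OF u] by (assumption | (simp add: field_simps power2_eq_square del: One_nat_def; fail) | algebra)
    subgoal using rel19[OF u] by (assumption | (simp add: field_simps power2_eq_square del: One_nat_def; fail) | algebra)
    subgoal using rel20[OF u] by (assumption | (simp add: field_simps power2_eq_square del: One_nat_def; fail) | algebra)
    subgoal using rel21[OF u] by (assumption | (simp add: field_simps power2_eq_square del: One_nat_def; fail) | algebra)
    by simp
  then have "\<forall>k<length (relations34 lam (wp2 \<sigma> u) (wp3 \<sigma> u)). relations34 lam (wp2 \<sigma> u) (wp3 \<sigma> u) ! k = 0"
    by (simp only: list_all_length)
  moreover have "length (relations34 lam (wp2 \<sigma> u) (wp3 \<sigma> u)) = 21"
    unfolding relations34_def list.size by simp
  ultimately show ?thesis using n by (simp only:)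
qed

end

theorem theorem4p5:
  fixes lam :: "nat \<Rightarrow> complex" and \<sigma> :: "complex^3 \<Rightarrow> complex"
  assumes "nonsingular_curve lam" and "kleinian_sigma lam \<sigma>"
  shows "(\<forall>n<21. \<forall>u. \<sigma> u \<noteq> 0 \<longrightarrow> relations34 lam (wp2 \<sigma> u) (wp3 \<sigma> u) ! n = 0) \<and>
         (\<forall>c d. bilinear_relation \<sigma> c d \<longrightarrow>
            (\<exists>a :: nat \<Rightarrow> complex. \<forall>p q. symmetric2 p \<longrightarrow> symmetric3 q \<longrightarrow>
               bilinear_expr c d p q = (\<Sum>n<21. a n * relations34 lam p q ! n)))"
proof -
  have sigma: "entire3 \<sigma>" "\<And>u. \<sigma> (- u) = - \<sigma> u" "sigma_leading_part \<sigma>" "sigma_klein_formula lam \<sigma>"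
    using assms(2) by (auto simp: kleinian_sigma_def sigma_zeros_def)
  have odd_entire: "odd_entire \<sigma>"
    by (rule odd_entire.intro[OF entire3_hol3[OF sigma(1)] sigma(2)])
  \<comment> \<open>This comes first: the leading part shows that neither \<sigma> nor
    \<open>p333\<close> vanishes identically, as the other locales require.\<close>
  interpret leading \<sigma>
    by (rule leading.intro[OF odd_entire leading_axioms.intro[OF sigma(3)]])
  obtain \<rho> Y W where chart: "chart lam \<rho> Y W" using chart_exists by blast
  have nonzero: "\<exists>u. \<sigma> u \<noteq> 0" using exists_wp333_nonzero unfolding Om_def by blast
  have klein_chart: "klein_chart lam \<rho> Y W \<sigma>"
    by (rule klein_chart.intro[OF chart odd_entire klein_chart_axioms.intro[OF sigma(4) nonzero]])
  have klein_curve: "klein_curve lam \<rho> Y W \<sigma>"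
    by (rule klein_curve.intro[OF klein_chart klein_curve_axioms.intro[OF exists_wp333_nonzero]])
  have rel: "relations34 lam (wp2 \<sigma> u) (wp3 \<sigma> u) ! n = 0" if "n < 21" "u \<in> Om" for n u
    using klein_curve.relations34_vanish[OF klein_curve] that by blast
  have "\<exists>a. \<forall>p q. symmetric2 p \<longrightarrow> symmetric3 q \<longrightarrow>
      bilinear_expr c d p q = (\<Sum>n<21. a n * relations34 lam p q ! n)" if "bilinear_relation \<sigma> c d" for c d
  proof -
    obtain C where C: "\<And>p q. symmetric2 p \<Longrightarrow> symmetric3 q \<Longrightarrow> bilinear_expr c d p q = bilinear_form C p q"
      using is_form_bilinear_expr[of c d] unfolding is_form_def by blast
    \<comment> \<open>The largest weight is 10 + 15 = 25, so the bound 26 holds vacuously and starts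
      the descent.\<close>
    have top: "\<forall>i<7. \<forall>j<10. 26 \<le> wts2 ! i + wts3 ! j \<longrightarrow> C i j = 0"
      by (simp add: all_less_numeral wts2_def wts3_def)
    have "\<forall>v\<in>Om. bilinear_form C (wp2 \<sigma> v) (wp3 \<sigma> v) = 0"
      using that C symmetric_wp unfolding bilinear_relation_def Om_def by (metis mem_Collect_eq)
    then obtain a where "\<forall>p q. bilinear_form C p q = (\<Sum>n<21. a n * relations34 lam p q ! n)"
      using bilinear_form_in_span[OF rel _ top] by auto
    then show ?thesis by (intro exI[of _ a]) (simp add: C)
  qed
  then show ?thesis using rel unfolding Om_def by blast
qed

end
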